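(* Every finite embedding problem over a Hilbertian field has a solution. That is: let $k$ be a Hilbertian field, $G$ a finite group, $L/k$ a finite separable extension, and $\alpha : G \rightarrow \mathrm{Aut}(L/k)$ an epimorphism. Then there exist a finite separable extension $E/k$ with $L \subseteq E$ and an isomorphism $\beta : \mathrm{Aut}(E/k) \rightarrow G$ such that every element of $\mathrm{Aut}(E/k)$ maps $L$ onto itself and $\alpha(\beta(\sigma)) = \sigma|_L$ for all $\sigma \in \mathrm{Aut}(E/k)$.
   Context: For a field extension $F/K$, $\mathrm{Aut}(F/K)$ denotes the group of all field automorphisms of $F$ fixing $K$ pointwise. A finite embedding problem over a field $k$ is an epimorphism $\alpha : G \rightarrow \mathrm{Aut}(L/k)$, where $G$ is a finite group and $L/k$ is a finite separable extension (not necessarily Galois); a solution is an isomorphism $\beta$ as in the claim. A field $k$ is Hilbertian if Hilbert's irreducibility theorem holds for it (in the sense of Fried–Jarden, Field Arithmetic): for all $n, m\geq 1$, algebraically independent indeterminates $\mathbf{T}=(T_1,\dots,T_n)$, polynomials $f_1,\dots,f_m \in k(\mathbf{T})[X]$ that are irreducible and separable over $k(\mathbf{T})$, and nonzero $g\in k[\mathbf{T}]$, there is $\mathbf{t}\in k^n$ with $g(\mathbf{t})\neq 0$ such that each $f_i(\mathbf{t},X)$ is defined and irreducible in $k[X]$. *)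

theory Defs
  imports
    "HOL-Library.Poly_Mapping"
    "HOL-Computational_Algebra.Fraction_Field"
    "HOL-Algebra.Bij"
    "HOL-Algebra.Algebraic_Closure_Type"
begin

section \<open>Separable polynomials and irreducibility over a subfield\<close>

definition separable_poly :: "'a::field poly \<Rightarrow> bool" where
  "separable_poly f \<longleftrightarrow> rsquarefree (map_poly to_ac f)"

definition polys_over :: "'a::field set \<Rightarrow> 'a poly set" where
  "polys_over F = {f. \<forall>j. Polynomial.coeff f j \<in> F}"

text \<open>Irreducibility in the ring \<open>F[X]\<close> for a subfield \<open>F\<close> of the ambient field; the
  non-zero non-units of \<open>F[X]\<close> are its polynomials of positive degree.\<close>

definition irreducible_over :: "'a::field set \<Rightarrow> 'a poly \<Rightarrow> bool" where
  "irreducible_over F f \<longleftrightarrow>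
     f \<in> polys_over F \<and> Polynomial.degree f > 0 \<and>
     (\<forall>a\<in>polys_over F. \<forall>b\<in>polys_over F.
        f = a * b \<longrightarrow> Polynomial.degree a = 0 \<or> Polynomial.degree b = 0)"


section \<open>Hilbertian fields\<close>

text \<open>Polynomials over \<open>'a\<close> in the countably many indeterminates \<open>T\<^sub>i\<close>, \<open>i :: nat\<close>: finitely
  supported functions from exponent vectors to coefficients. A field such as
  \<open>k(T\<^sub>0,\<dots>,T\<^bsub>n-1\<^esub>)\<close>, with \<open>n\<close> quantified inside the definition below, is a subfield of the
  fraction field of this ring. Separability does not depend on which of these fields is used, since
  the order of a root is unaffected by enlarging the field.\<close>

type_synonym 'a mpoly = "(nat \<Rightarrow>\<^sub>0 nat) \<Rightarrow>\<^sub>0 'a"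

definition mpolys :: "nat \<Rightarrow> 'a::field mpoly set" where
  "mpolys n = {p. \<forall>m\<in>Poly_Mapping.keys p. Poly_Mapping.keys m \<subseteq> {..<n}}"

definition ratfuns :: "nat \<Rightarrow> 'a::field mpoly fract set" where
  "ratfuns n = {Fract p q |p q. p \<in> mpolys n \<and> q \<in> mpolys n \<and> q \<noteq> 0}"

definition mpoly_eval :: "(nat \<Rightarrow> 'a) \<Rightarrow> 'a::field mpoly \<Rightarrow> 'a" where
  "mpoly_eval t p =
     (\<Sum>m\<in>Poly_Mapping.keys p.
        Poly_Mapping.lookup p m * (\<Prod>i\<in>Poly_Mapping.keys m. t i ^ Poly_Mapping.lookup m i))"

text \<open>The rational function \<open>c\<close> in the first \<open>n\<close> indeterminates is defined at \<open>t\<close>, with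
  value \<open>v\<close>.\<close>

definition ratfun_value :: "nat \<Rightarrow> (nat \<Rightarrow> 'a) \<Rightarrow> 'a::field mpoly fract \<Rightarrow> 'a \<Rightarrow> bool" where
  "ratfun_value n t c v \<longleftrightarrow>
     (\<exists>p\<in>mpolys n. \<exists>q\<in>mpolys n.
        c = Fract p q \<and> mpoly_eval t q \<noteq> 0 \<and> v = mpoly_eval t p / mpoly_eval t q)"

text \<open>\<open>f(t,X)\<close> is defined and equals \<open>h\<close>.\<close>

definition specializes_to ::
    "nat \<Rightarrow> (nat \<Rightarrow> 'a) \<Rightarrow> 'a::field mpoly fract poly \<Rightarrow> 'a poly \<Rightarrow> bool" where
  "specializes_to n t f h \<longleftrightarrow>
     (\<forall>j. ratfun_value n t (Polynomial.coeff f j) (Polynomial.coeff h j))"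

text \<open>A point of \<open>k\<^sup>n\<close> is represented by a function on \<open>nat\<close>; only its values at
  \<open>i < n\<close> matter for polynomials in \<^term>\<open>mpolys n\<close>.\<close>

definition hilbertian :: "'a::field itself \<Rightarrow> bool" where
  "hilbertian (_ :: 'a itself) \<longleftrightarrow>
     (\<forall>n\<ge>1. \<forall>m\<ge>1. \<forall>f :: nat \<Rightarrow> 'a mpoly fract poly. \<forall>g \<in> mpolys n.
        (\<forall>i<m. irreducible_over (ratfuns n) (f i) \<and> separable_poly (f i)) \<and> g \<noteq> 0 \<longrightarrow>
        (\<exists>t :: nat \<Rightarrow> 'a. mpoly_eval t g \<noteq> 0 \<and>
           (\<forall>i<m. \<exists>h. specializes_to n t (f i) h \<and> Factorial_Ring.irreducible h)))"


section \<open>Finite separable extensions inside an algebraic closure\<close>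

text \<open>The base field \<open>k\<close> is the type \<open>'a\<close>, identified with the subfield \<open>range to_ac\<close> of its
  algebraic closure \<open>'a alg_closure\<close>; extensions of \<open>k\<close> are taken inside that closure.\<close>

definition field_extension :: "'a::field alg_closure set \<Rightarrow> bool" where
  "field_extension L \<longleftrightarrow>
     range to_ac \<subseteq> L \<and>
     (\<forall>x\<in>L. \<forall>y\<in>L. x + y \<in> L \<and> x - y \<in> L \<and> x * y \<in> L) \<and> (\<forall>x\<in>L. inverse x \<in> L)"

definition ac_scale :: "'a::field \<Rightarrow> 'a alg_closure \<Rightarrow> 'a alg_closure" where
  "ac_scale c x = to_ac c * x"

text \<open>\<open>x\<close> is separable over \<open>k\<close>: it is a root of a separable irreducible polynomial over \<open>k\<close>,
  necessarily its minimal polynomial up to a constant factor.\<close>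

definition separable_element :: "'a::field alg_closure \<Rightarrow> bool" where
  "separable_element x \<longleftrightarrow>
     (\<exists>p :: 'a poly. Factorial_Ring.irreducible p \<and> separable_poly p \<and>
        poly (map_poly to_ac p) x = 0)"

definition finite_separable_extension :: "'a::field alg_closure set \<Rightarrow> bool" where
  "finite_separable_extension L \<longleftrightarrow>
     field_extension L \<and>
     (\<exists>B. finite B \<and> module.span ac_scale B = L) \<and>
     (\<forall>x\<in>L. separable_element x)"

text \<open>\<open>Aut(L/k)\<close>. As in \<^const>\<open>BijGroup\<close>, its elements are extensional functions on \<open>L\<close> and its
  multiplication is composition.\<close>

definition field_auts :: "'a::field alg_closure set \<Rightarrow> ('a alg_closure \<Rightarrow> 'a alg_closure) set" where
  "field_auts L =
     {\<sigma> \<in> Bij L.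
        (\<forall>x\<in>L. \<forall>y\<in>L. \<sigma> (x + y) = \<sigma> x + \<sigma> y \<and> \<sigma> (x * y) = \<sigma> x * \<sigma> y) \<and>
        (\<forall>c. \<sigma> (to_ac c) = to_ac c)}"

definition Aut :: "'a::field alg_closure set \<Rightarrow> ('a alg_closure \<Rightarrow> 'a alg_closure) monoid" where
  "Aut L = BijGroup L\<lparr>carrier := field_auts L\<rparr>"

end

theory Submission
  imports Defs "HOL-Combinatorics.Permutations"
begin

text \<open>All fields live in the algebraic closure, on which the group \<open>gal\<close> of \<open>k\<close>-automorphisms acts.
  Let \<open>k\<close> be Hilbertian and write \<open>L = k(c)\<close>. A generic polynomial of degree \<open>|G|\<close> can be
  specialised so that its roots are permuted arbitrarily and independently of \<open>c\<close>. Labelling the roots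
  by \<open>G\<close>, each \<open>g\<close> acts on \<open>k(w) = k(c, roots)\<close> through \<open>\<alpha> g\<close> and left translation, with fixed field
  \<open>F = k(b)\<close>; so the embedding problem is solved by \<open>k(w)/F\<close>, but \<open>k(w)\<close> may have further automorphisms
  over \<open>k\<close>. To remove them, adjoin a root \<open>z\<close> of a cubic with coefficients in \<open>F\<close>. The cubic and its
  conjugates can be chosen generic and independent, so every
  \<open>k\<close>-automorphism of \<open>E = k(w, z)\<close> fixes \<open>z\<close> and \<open>b\<close>, and hence \<open>Aut(E/k) = Gal(k(w)/F) = G\<close>.

  The specialisations are obtained from a single resolvent whose roots are the values of a linear form
  at all tuples of roots. It is irreducible over \<open>k(T)\<close> because these tuples are parametrised
  polynomially by free coordinates.\<close>

text \<open>\<open>hilbertian\<close> only promises that irreducible polynomials stay irreducible;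
  it says nothing about permutations of roots. So each statement about permuting roots is cast as
  transitivity of \<open>gal\<close> on the points of a triangular system, and this is read off from
  the irreducibility of one polynomial with one root per point. Irreducibility over k(T) in turn
  becomes the absence of zero divisors among polynomial functions on the points, which can be tested
  along lines of an affine space.

  The element \<open>b\<close> is a value A(u) of the polynomial whose roots form the G-orbit of
  \<open>w\<close>, with \<open>u\<close> in k chosen so that no other conjugate of A has the same
  value; hence the stabiliser of \<open>b\<close> permutes that orbit. There is one cubic per
  conjugate of \<open>b\<close>. Its coefficients are polynomials in that conjugate with as many
  free coefficients as there are conjugates, just enough to prescribe all the cubics independently.
  Degree three leaves room for a transposition that fixes \<open>z\<close> but moves any other root
  of these cubics supposed to lie in \<open>E\<close>; a quadratic would not do, as its second root
  is determined by \<open>z\<close>.\<close>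

section \<open>Homomorphisms of integral domains and their coefficientwise action on
  polynomials\<close>

locale rhom =
  fixes f :: "'b::idom \<Rightarrow> 'c::idom"
  assumes hom_add: "f (x + y) = f x + f y"
    and hom_mult: "f (x * y) = f x * f y"
    and hom_1: "f 1 = 1"
begin

lemma hom_0: "f 0 = 0"
  using hom_add[of 0 0] by (metis add.right_neutral add_left_cancel)

lemma hom_minus: "f (- x) = - f x"
  using hom_add[of x "- x"] by (simp add: hom_0 eq_neg_iff_add_eq_0 add.commute)

lemma hom_diff: "f (x - y) = f x - f y"
  using hom_add[of x "- y"] by (simp add: hom_minus)

lemma hom_sum: "f (sum g A) = (\<Sum>i\<in>A. f (g i))"
  by (induction A rule: infinite_finite_induct) (simp_all add: hom_0 hom_add)

lemma hom_prod: "f (prod g A) = (\<Prod>i\<in>A. f (g i))"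
  by (induction A rule: infinite_finite_induct) (simp_all add: hom_1 hom_mult)

lemma coeff_hom: "coeff (map_poly f p) i = f (coeff p i)"
  by (simp add: coeff_map_poly hom_0)

lemma degree_map_poly_hom_le: "degree (map_poly f p) \<le> degree p"
  by (rule degree_le) (simp add: coeff_hom coeff_eq_0 hom_0)

lemma map_poly_hom: "rhom (map_poly f)"
proof
  show "map_poly f (p + q) = map_poly f p + map_poly f q" for p q
    by (rule poly_eqI) (simp add: coeff_hom hom_add)
  show "map_poly f (p * q) = map_poly f p * map_poly f q" for p q
    by (rule poly_eqI) (simp add: coeff_hom coeff_mult hom_sum hom_mult)
  show "map_poly f 1 = 1"
    by (rule poly_eqI) (simp add: coeff_hom hom_1 hom_0)
qed

lemma map_poly_hom_pCons: "map_poly f (pCons a p) = pCons (f a) (map_poly f p)"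
  by (rule poly_eqI) (simp add: coeff_hom coeff_pCons split: nat.split)

lemma poly_hom: "f (poly p x) = poly (map_poly f p) (f x)"
  by (induction p) (simp_all add: hom_0 map_poly_hom_pCons hom_add hom_mult)

lemma map_poly_hom_pderiv: "map_poly f (pderiv p) = pderiv (map_poly f p)"
proof (rule poly_eqI)
  have "f (of_nat n) = of_nat n" for n
    by (induction n) (simp_all add: hom_0 hom_add hom_1)
  then show "coeff (map_poly f (pderiv p)) n = coeff (pderiv (map_poly f p)) n" for n
    by (simp only: coeff_hom coeff_pderiv hom_mult)
qed

end

lemma rhom_to_ac: "rhom to_ac"
  by unfold_locales simp_all

lemma degree_map_poly_to_ac [simp]: "degree (map_poly to_ac p) = degree p"
  by (rule degree_map_poly) simp

lemma map_poly_to_ac_eq_0_iff [simp]: "map_poly to_ac p = 0 \<longleftrightarrow> p = 0"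
  by (rule map_poly_eq_0_iff) simp_all

lemma polys_over_range_to_ac: "polys_over (range to_ac) = range (map_poly to_ac)"
proof (intro equalityI subsetI)
  fix p :: "'a alg_closure poly" assume "p \<in> polys_over (range to_ac)"
  then have "p = map_poly to_ac (map_poly of_ac p)"
    by (intro poly_eqI) (auto simp: polys_over_def coeff_map_poly to_ac_of_ac)
  then show "p \<in> range (map_poly to_ac)" by blast
qed (auto simp: polys_over_def rhom.coeff_hom[OF rhom_to_ac])

section \<open>Subrings of the closure that contain k, and simple extensions\<close>

text \<open>Closure under inverses is left out because it is automatic in an algebraic extension,
  see \<open>inverse_eq_poly\<close>. Equalizers, preimages under automorphisms and simple
  extensions then only have to be checked for the ring operations.\<close>

definition subring_over :: "'a::field alg_closure set \<Rightarrow> bool" where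
  "subring_over F \<longleftrightarrow>
     range to_ac \<subseteq> F \<and> (\<forall>x\<in>F. \<forall>y\<in>F. x + y \<in> F \<and> x - y \<in> F \<and> x * y \<in> F)"

context
  fixes F :: "'a::field alg_closure set"
  assumes F: "subring_over F"
begin

lemma subring_to_ac: "to_ac c \<in> F"
  using F by (auto simp: subring_over_def)

lemma subring_add: "x \<in> F \<Longrightarrow> y \<in> F \<Longrightarrow> x + y \<in> F"
  and subring_diff: "x \<in> F \<Longrightarrow> y \<in> F \<Longrightarrow> x - y \<in> F"
  and subring_mult: "x \<in> F \<Longrightarrow> y \<in> F \<Longrightarrow> x * y \<in> F"
  using F by (auto simp: subring_over_def)

lemma subring_0: "0 \<in> F" and subring_1: "1 \<in> F"
  using subring_to_ac[of 0] subring_to_ac[of 1] by simp_all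

lemma subring_sum: "(\<And>i. i \<in> A \<Longrightarrow> g i \<in> F) \<Longrightarrow> sum g A \<in> F"
  by (induction A rule: infinite_finite_induct) (auto simp: subring_0 subring_add)

lemma polys_over_0: "0 \<in> polys_over F"
  by (simp add: polys_over_def subring_0)

lemma polys_over_1: "1 \<in> polys_over F"
  by (auto simp: polys_over_def subring_0 subring_1)

lemma polys_over_add: "p \<in> polys_over F \<Longrightarrow> q \<in> polys_over F \<Longrightarrow> p + q \<in> polys_over F"
  and polys_over_diff: "p \<in> polys_over F \<Longrightarrow> q \<in> polys_over F \<Longrightarrow> p - q \<in> polys_over F"
  by (auto simp: polys_over_def subring_add subring_diff)

lemma polys_over_mult: "p \<in> polys_over F \<Longrightarrow> q \<in> polys_over F \<Longrightarrow> p * q \<in> polys_over F"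
  by (auto simp: polys_over_def coeff_mult intro!: subring_sum subring_mult)

lemma polys_over_prod: "(\<And>i. i \<in> A \<Longrightarrow> g i \<in> polys_over F) \<Longrightarrow> prod g A \<in> polys_over F"
  by (induction A rule: infinite_finite_induct) (auto simp: polys_over_1 polys_over_mult)

lemma polys_over_monom: "a \<in> F \<Longrightarrow> monom a n \<in> polys_over F"
  by (auto simp: polys_over_def subring_0)

lemma polys_over_pCons: "pCons a p \<in> polys_over F \<longleftrightarrow> a \<in> F \<and> p \<in> polys_over F"
  by (fastforce simp: polys_over_def coeff_pCons all_conj_distrib split: nat.splits)

lemma polys_over_map_to_ac: "map_poly to_ac p \<in> polys_over F"
  by (auto simp: polys_over_def rhom.coeff_hom[OF rhom_to_ac] subring_to_ac)

lemma poly_in_subring: "p \<in> polys_over F \<Longrightarrow> x \<in> F \<Longrightarrow> poly p x \<in> F"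
  by (induction p) (auto simp: subring_0 polys_over_pCons subring_add subring_mult)

end

text \<open>Take a nonzero polynomial over k with root \<open>y\<close> and strip factors X until
  the constant term \<open>a\<close> is nonzero. What remains reads y q(y) = - a, so the inverse of
  \<open>y\<close> is a constant multiple of q(y).\<close>

lemma inverse_eq_poly:
  fixes y :: "'a::field alg_closure"
  obtains h :: "'a poly" where "inverse y = poly (map_poly to_ac h) y"
proof (cases "y = 0")
  case True
  then show ?thesis using that[of 0] by simp
next
  case False
  obtain p :: "'a poly" where p: "p \<noteq> 0" "poly (map_poly to_ac p) y = 0"
    by (rule alg_closure_algebraic)
  have "\<exists>h. inverse y = poly (map_poly to_ac h) y"
    using p
  proof (induction p)
    case (pCons a q)
    note hom = rhom.map_poly_hom_pCons[OF rhom_to_ac]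
    show ?case
    proof (cases "a = 0")
      case True
      then show ?thesis using pCons False by (auto simp: hom)
    next
      case a: False
      have "y * poly (map_poly to_ac q) y = - to_ac a"
        using pCons.prems by (simp add: hom eq_neg_iff_add_eq_0 add.commute)
      then have "inverse y = to_ac (- inverse a) * poly (map_poly to_ac q) y"
        using False a by (simp add: field_simps)
      moreover have "map_poly to_ac ([:- inverse a:] * q) = [:to_ac (- inverse a):] * map_poly to_ac q"
        by (simp only: rhom.hom_mult[OF rhom.map_poly_hom[OF rhom_to_ac]] hom map_poly_0)
      ultimately have "inverse y = poly (map_poly to_ac ([:- inverse a:] * q)) y"
        by (simp only: poly_mult poly_pCons poly_0 mult_zero_right add.right_neutral)
      then show ?thesis ..
    qed
  qed simp
  then show ?thesis using that by blast
qed

lemma field_extension_iff_subring_over: "field_extension F \<longleftrightarrow> subring_over F"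
proof
  assume F: "subring_over F"
  have "inverse x \<in> F" if "x \<in> F" for x
    by (rule inverse_eq_poly[of x])
       (auto intro: poly_in_subring[OF F] polys_over_map_to_ac[OF F] that)
  with F show "field_extension F"
    by (auto simp: field_extension_def subring_over_def)
qed (auto simp: field_extension_def subring_over_def)

lemma subring_over_range_to_ac: "subring_over (range to_ac)"
  unfolding subring_over_def by (auto simp flip: to_ac_add to_ac_diff to_ac_mult)

text \<open>This is the ring F[x]; it coincides with F(x) because everything is algebraic over
  k.\<close>

definition adjoin :: "'a::field alg_closure set \<Rightarrow> 'a alg_closure \<Rightarrow> 'a alg_closure set" where
  "adjoin F x = {poly p x |p. p \<in> polys_over F}"

lemma adjoinI: "p \<in> polys_over F \<Longrightarrow> a = poly p x \<Longrightarrow> a \<in> adjoin F x"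
  by (auto simp: adjoin_def)

lemma subset_adjoin: assumes "subring_over F" shows "F \<subseteq> adjoin F x"
proof
  fix a assume "a \<in> F"
  then have "[:a:] \<in> polys_over F"
    by (simp only: polys_over_pCons[OF assms] polys_over_0[OF assms])
  then show "a \<in> adjoin F x" by (rule adjoinI) simp
qed

lemma mem_adjoin: assumes "subring_over F" shows "x \<in> adjoin F x"
proof -
  have "[:0, 1:] \<in> polys_over F"
    by (simp only: polys_over_pCons[OF assms] polys_over_0[OF assms] subring_0[OF assms] subring_1[OF assms])
  then show "x \<in> adjoin F x" by (rule adjoinI) simp
qed

lemma subring_over_adjoin:
  assumes "subring_over F" shows "subring_over (adjoin F x)"
  unfolding subring_over_def
proof (intro conjI ballI)
  show "range to_ac \<subseteq> adjoin F x"
    using subset_adjoin[OF assms] assms unfolding subring_over_def by blast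
  fix a b assume "a \<in> adjoin F x" "b \<in> adjoin F x"
  then obtain p q where pq: "a = poly p x" "b = poly q x" "p \<in> polys_over F" "q \<in> polys_over F"
    unfolding adjoin_def by blast
  show "a + b \<in> adjoin F x"
    by (rule adjoinI[OF polys_over_add[OF assms pq(3,4)]]) (simp add: pq)
  show "a - b \<in> adjoin F x"
    by (rule adjoinI[OF polys_over_diff[OF assms pq(3,4)]]) (simp add: pq)
  show "a * b \<in> adjoin F x"
    by (rule adjoinI[OF polys_over_mult[OF assms pq(3,4)]]) (simp add: pq)
qed

lemma adjoin_least: "subring_over N \<Longrightarrow> F \<subseteq> N \<Longrightarrow> x \<in> N \<Longrightarrow> adjoin F x \<subseteq> N"
  unfolding adjoin_def using poly_in_subring[of N] by (auto simp: polys_over_def subset_iff)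

abbreviation kadj :: "'a::field alg_closure \<Rightarrow> 'a alg_closure set" where
  "kadj \<equiv> adjoin (range to_ac)"

lemma kadj_eq: "kadj x = {poly (map_poly to_ac h) x |h. True}"
  by (auto simp: adjoin_def polys_over_range_to_ac)

lemmas subring_over_kadj = subring_over_adjoin[OF subring_over_range_to_ac]

lemmas mem_kadj = mem_adjoin[OF subring_over_range_to_ac]

lemma kadj_least: "subring_over N \<Longrightarrow> x \<in> N \<Longrightarrow> kadj x \<subseteq> N"
  by (rule adjoin_least) (auto simp: subring_over_def)

section \<open>Automorphisms of the algebraic closure\<close>

text \<open>Automorphisms of the whole algebraic closure, not of a separable closure. Over an
  imperfect k its fixed elements need not lie in k, which is why \<open>gal_fixed_in\<close> assumes
  separability.\<close>

definition gal :: "('a::field alg_closure \<Rightarrow> 'a alg_closure) set" where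
  "gal = {\<sigma>. bij \<sigma> \<and> (\<forall>x y. \<sigma> (x + y) = \<sigma> x + \<sigma> y \<and> \<sigma> (x * y) = \<sigma> x * \<sigma> y) \<and>
            (\<forall>c. \<sigma> (to_ac c) = to_ac c)}"

lemma rhom_gal: assumes "\<sigma> \<in> gal" shows "rhom \<sigma>"
proof
  show "\<sigma> (x + y) = \<sigma> x + \<sigma> y" "\<sigma> (x * y) = \<sigma> x * \<sigma> y" for x y
    using assms unfolding gal_def by blast+
  have "\<sigma> (to_ac 1) = to_ac 1" using assms unfolding gal_def by blast
  then show "\<sigma> 1 = 1" by simp
qed

lemma gal_to_ac [simp]: "\<sigma> \<in> gal \<Longrightarrow> \<sigma> (to_ac c) = to_ac c"
  unfolding gal_def by blast

lemma galI:
  assumes "bij \<sigma>" "\<And>x y. \<sigma> (x + y) = \<sigma> x + \<sigma> y" "\<And>x y. \<sigma> (x * y) = \<sigma> x * \<sigma> y"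
    "\<And>c. \<sigma> (to_ac c) = to_ac c"
  shows "\<sigma> \<in> gal"
  unfolding gal_def using assms by blast

lemma gal_bij: "\<sigma> \<in> gal \<Longrightarrow> bij \<sigma>"
  unfolding gal_def by blast

lemma gal_inj: "\<sigma> \<in> gal \<Longrightarrow> \<sigma> x = \<sigma> y \<longleftrightarrow> x = y"
  using gal_bij by (metis bij_pointE)

lemma gal_id: "(\<lambda>x. x) \<in> gal"
  by (rule galI) (simp_all add: bij_def)

lemma gal_comp: "\<sigma> \<in> gal \<Longrightarrow> \<tau> \<in> gal \<Longrightarrow> (\<lambda>x. \<sigma> (\<tau> x)) \<in> gal"
  using bij_comp[of \<tau> \<sigma>]
  by (intro galI) (simp_all add: gal_bij comp_def rhom.hom_add[OF rhom_gal] rhom.hom_mult[OF rhom_gal])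

lemma gal_inv: "\<sigma> \<in> gal \<Longrightarrow> inv_into UNIV \<sigma> \<in> gal"
proof -
  assume s: "\<sigma> \<in> gal"
  have b: "bij \<sigma>" by (rule gal_bij[OF s])
  have e: "\<sigma> (inv_into UNIV \<sigma> x) = x" for x by (simp add: b bij_is_surj surj_f_inv_f)
  have i: "inv_into UNIV \<sigma> x = y \<longleftrightarrow> x = \<sigma> y" for x y by (metis b bij_inv_eq_iff)
  have "inv_into UNIV \<sigma> (x + y) = inv_into UNIV \<sigma> x + inv_into UNIV \<sigma> y" "inv_into UNIV \<sigma> (x * y) = inv_into UNIV \<sigma> x * inv_into UNIV \<sigma> y" for x y
    by (simp_all add: i rhom.hom_add[OF rhom_gal[OF s]] rhom.hom_mult[OF rhom_gal[OF s]] e)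
  moreover have "inv_into UNIV \<sigma> (to_ac c) = to_ac c" for c
    by (simp add: i s)
  ultimately show ?thesis by (intro galI bij_imp_bij_inv b)
qed

lemma gal_inv_apply: "\<sigma> \<in> gal \<Longrightarrow> \<sigma> (inv_into UNIV \<sigma> x) = x" "\<sigma> \<in> gal \<Longrightarrow> inv_into UNIV \<sigma> (\<sigma> x) = x"
  using gal_bij[of \<sigma>] by (simp_all add: bij_def surj_f_inv_f)

lemma gal_map_poly_to_ac: "\<sigma> \<in> gal \<Longrightarrow> map_poly \<sigma> (map_poly to_ac p) = map_poly to_ac p"
  by (rule poly_eqI) (simp add: rhom.coeff_hom[OF rhom_gal] rhom.coeff_hom[OF rhom_to_ac])

lemma gal_poly_to_ac:
  "\<sigma> \<in> gal \<Longrightarrow> \<sigma> (poly (map_poly to_ac p) x) = poly (map_poly to_ac p) (\<sigma> x)"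
  by (simp add: rhom.poly_hom[OF rhom_gal] gal_map_poly_to_ac)

lemma gal_eq_on_kadj:
  "\<sigma> \<in> gal \<Longrightarrow> \<tau> \<in> gal \<Longrightarrow> \<sigma> x = \<tau> x \<Longrightarrow> y \<in> kadj x \<Longrightarrow> \<sigma> y = \<tau> y"
  by (auto simp: kadj_eq gal_poly_to_ac)

lemma gal_image_kadj: "\<sigma> \<in> gal \<Longrightarrow> y \<in> kadj x \<Longrightarrow> \<sigma> y \<in> kadj (\<sigma> x)"
  by (auto simp: kadj_eq gal_poly_to_ac)

lemma finite_gal_orbit: "finite ((\<lambda>\<sigma>. \<sigma> x) ` gal)"
proof -
  obtain p :: "'a poly" where p: "p \<noteq> 0" "poly (map_poly to_ac p) x = 0"
    by (rule alg_closure_algebraic)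
  have "(\<lambda>\<sigma>. \<sigma> x) ` gal \<subseteq> {y. poly (map_poly to_ac p) y = 0}"
  proof (rule image_subsetI, rule CollectI)
    fix \<sigma> :: "'a alg_closure \<Rightarrow> 'a alg_closure" assume "\<sigma> \<in> gal"
    then show "poly (map_poly to_ac p) (\<sigma> x) = 0"
      using p(2) by (simp add: rhom.hom_0[OF rhom_gal] flip: gal_poly_to_ac)
  qed
  moreover have "finite {y. poly (map_poly to_ac p) y = 0}"
    using p by (intro poly_roots_finite) simp
  ultimately show ?thesis by (rule finite_subset)
qed

text \<open>The graph of a homomorphism over \<open>k\<close> between subrings of the closure. With graphs the union of
  a chain in Zorn's lemma is a plain union of sets.\<close>

definition hom_graph :: "('a::field alg_closure \<times> 'a alg_closure) set \<Rightarrow> bool" where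
  "hom_graph H \<longleftrightarrow> (\<forall>c. (to_ac c, to_ac c) \<in> H) \<and>
     (\<forall>x y x' y'. (x, y) \<in> H \<longrightarrow> (x', y') \<in> H \<longrightarrow>
        (x + x', y + y') \<in> H \<and> (x - x', y - y') \<in> H \<and> (x * x', y * y') \<in> H) \<and>
     (\<forall>y. (0, y) \<in> H \<longrightarrow> y = 0)"

text \<open>\<open>B\<close> is the image of \<open>A\<close> under the homomorphism with graph
  \<open>H\<close>. Carrying both polynomials along avoids turning the graph into a partial
  function.\<close>

definition poly_pair :: "('a::field alg_closure \<times> 'a alg_closure) set \<Rightarrow>
    'a alg_closure poly \<Rightarrow> 'a alg_closure poly \<Rightarrow> bool" where
  "poly_pair H A B \<longleftrightarrow> (\<forall>i. (coeff A i, coeff B i) \<in> H)"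

context
  fixes H :: "('a::field alg_closure \<times> 'a alg_closure) set"
  assumes H: "hom_graph H"
begin

lemma hom_graph_to_ac: "(to_ac c, to_ac c) \<in> H"
  and hom_graph_add: "(x, y) \<in> H \<Longrightarrow> (x', y') \<in> H \<Longrightarrow> (x + x', y + y') \<in> H"
  and hom_graph_diff: "(x, y) \<in> H \<Longrightarrow> (x', y') \<in> H \<Longrightarrow> (x - x', y - y') \<in> H"
  and hom_graph_mult: "(x, y) \<in> H \<Longrightarrow> (x', y') \<in> H \<Longrightarrow> (x * x', y * y') \<in> H"
  and hom_graph_0D: "(0, y) \<in> H \<Longrightarrow> y = 0"
  using H by (auto simp: hom_graph_def)

lemma hom_graph_0: "(0, 0) \<in> H" and hom_graph_1: "(1, 1) \<in> H"
  using hom_graph_to_ac[of 0] hom_graph_to_ac[of 1] by simp_all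

lemma hom_graph_fun: "(x, y) \<in> H \<Longrightarrow> (x, y') \<in> H \<Longrightarrow> y = y'"
  using hom_graph_diff[of x y x y'] hom_graph_0D by fastforce

lemma hom_graph_poly: "(x, y) \<in> H \<Longrightarrow> (poly (map_poly to_ac h) x, poly (map_poly to_ac h) y) \<in> H"
  by (induction h)
     (auto simp: hom_graph_0 rhom.map_poly_hom_pCons[OF rhom_to_ac]
           intro!: hom_graph_add hom_graph_mult hom_graph_to_ac)

text \<open>Injectivity: the inverse of \<open>x\<close> is a polynomial in \<open>x\<close>, so it
  also has an image. If \<open>x\<close> went to 0, then 1, the product of \<open>x\<close> and its
  inverse, would go to 0 as well.\<close>

lemma hom_graph_0D': assumes "(x, 0) \<in> H" shows "x = 0"
proof (rule ccontr)
  assume x: "x \<noteq> 0"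
  obtain h where h: "inverse x = poly (map_poly to_ac h) x" by (rule inverse_eq_poly)
  have "(x * inverse x, 0 * poly (map_poly to_ac h) 0) \<in> H"
    unfolding h by (intro hom_graph_mult hom_graph_poly assms)
  then have "(1, 0) \<in> H" using x by simp
  then show False using hom_graph_fun hom_graph_1 by fastforce
qed

lemma hom_graph_sum: "(\<And>i. i \<in> A \<Longrightarrow> (f i, g i) \<in> H) \<Longrightarrow> (sum f A, sum g A) \<in> H"
  by (induction A rule: infinite_finite_induct) (auto simp: hom_graph_0 hom_graph_add)

lemma poly_pair_ops:
  assumes "poly_pair H A B" "poly_pair H C D"
  shows "poly_pair H (A + C) (B + D)" "poly_pair H (A - C) (B - D)" "poly_pair H (A * C) (B * D)"
  using assms by (auto simp: poly_pair_def coeff_mult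
      intro!: hom_graph_add hom_graph_diff hom_graph_sum hom_graph_mult)

lemma poly_pair_const: "(a, b) \<in> H \<Longrightarrow> poly_pair H [:a:] [:b:]"
  by (auto simp: poly_pair_def coeff_pCons hom_graph_0 split: nat.split)

lemma poly_pair_monom: "(a, b) \<in> H \<Longrightarrow> poly_pair H (monom a n) (monom b n)"
  by (auto simp: poly_pair_def hom_graph_0)

lemma poly_pair_map_to_ac: "poly_pair H (map_poly to_ac p) (map_poly to_ac p)"
  by (auto simp: poly_pair_def rhom.coeff_hom[OF rhom_to_ac] hom_graph_to_ac)

context
  fixes A B :: "'a alg_closure poly" and x y :: "'a alg_closure"
  assumes AB: "poly_pair H A B" "A \<noteq> 0" "poly A x = 0" "poly B y = 0"
    and least: "\<And>C D. poly_pair H C D \<Longrightarrow> C \<noteq> 0 \<Longrightarrow> poly C x = 0 \<Longrightarrow> degree A \<le> degree C"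
begin

text \<open>\<open>A\<close> plays the minimal polynomial of \<open>x\<close> over the domain of
  \<open>H\<close>, and \<open>B\<close> its image. Cross-multiplication by leading coefficients
  lowers the degree of \<open>C\<close> and does the same to \<open>D\<close> in parallel. At the
  end the leading coefficient of \<open>B\<close> can be cancelled, since it is nonzero by
  injectivity.\<close>

lemma poly_pair_root_transfer:
  "poly_pair H C D \<Longrightarrow> poly C x = 0 \<Longrightarrow> poly D y = 0"
proof (induction "degree C" arbitrary: C D rule: less_induct)
  case less
  show ?case
  proof (cases "C = 0")
    case True
    then have "coeff D i = 0" for i
      using less.prems(1) hom_graph_0D by (auto simp: poly_pair_def)
    then have "D = 0" by (auto intro: poly_eqI)
    then show ?thesis by simp
  next
    case False
    have degAC: "degree A \<le> degree C" using least less.prems False by blast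
    have "degree A \<noteq> 0"
      using AB(2,3) by (metis degree_eq_zeroE mult_zero_right pCons_0_0 add.right_neutral poly_pCons poly_0)
    define n where "n = degree C - degree A"
    define C' where "C' = [:coeff A (degree A):] * C - monom (coeff C (degree C)) n * A"
    define D' where "D' = [:coeff B (degree A):] * D - monom (coeff D (degree C)) n * B"
    have pp: "poly_pair H C' D'"
      unfolding C'_def D'_def using AB(1) less.prems(1)
      by (intro poly_pair_ops poly_pair_const poly_pair_monom) (auto simp: poly_pair_def)
    have "degree C' < degree C"
    proof (rule ccontr)
      assume "\<not> degree C' < degree C"
      moreover have "degree C' \<le> degree C"
        unfolding C'_def
      proof (rule degree_diff_le)
        show "degree ([:coeff A (degree A):] * C) \<le> degree C"
          by simp
        have "degree (monom (coeff C (degree C)) n * A) \<le> n + degree A"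
          by (intro order.trans[OF degree_mult_le] add_mono degree_monom_le order.refl)
        then show "degree (monom (coeff C (degree C)) n * A) \<le> degree C"
          using degAC by (simp add: n_def)
      qed
      moreover have "coeff C' (degree C) = 0"
        using degAC by (simp add: C'_def n_def coeff_monom_mult)
      ultimately have "C' = 0" "degree C' = degree C" by (metis leading_coeff_0_iff le_antisym not_le)+
      then show False using \<open>degree A \<noteq> 0\<close> degAC by simp
    qed
    moreover have "poly C' x = 0" using AB(3) less.prems by (simp add: C'_def)
    ultimately have "poly D' y = 0" using less.hyps pp by blast
    then have "coeff B (degree A) * poly D y = 0" using AB(4) by (simp add: D'_def)
    moreover have "coeff B (degree A) \<noteq> 0"
    proof
      assume "coeff B (degree A) = 0"
      then have "(coeff A (degree A), 0) \<in> H" using AB(1) by (metis poly_pair_def)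
      then show False using hom_graph_0D' AB(2) by (metis leading_coeff_0_iff)
    qed
    ultimately show ?thesis by simp
  qed
qed

text \<open>The homomorphism is extended by sending \<open>x\<close> to the root \<open>y\<close> of
  the image of its minimal polynomial. Compatibility with the operations is formal; that the new
  relation is single-valued is exactly \<open>poly_pair_root_transfer\<close>.\<close>

lemma hom_graph_adjoin: "hom_graph {(poly C x, poly D y) |C D. poly_pair H C D}" (is "hom_graph ?H")
proof -
  have HI: "(a, b) \<in> ?H" if "poly_pair H C D" "a = poly C x" "b = poly D y" for a b C D
    using that by blast
  show ?thesis
    unfolding hom_graph_def
  proof (intro conjI allI impI)
    show "(to_ac c, to_ac c) \<in> ?H" for c
      by (rule HI[OF poly_pair_const[OF hom_graph_to_ac[of c]]]) simp_all
    show "b = 0" if b: "(0, b) \<in> ?H" for b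
    proof -
      obtain C D where CD: "poly_pair H C D" "0 = poly C x" "b = poly D y"
        using b by blast
      show ?thesis using poly_pair_root_transfer[OF CD(1)] CD(2,3) by simp
    qed
    fix a b a' b' assume "(a, b) \<in> ?H" "(a', b') \<in> ?H"
    then obtain C D C' D' where CD: "poly_pair H C D" "poly_pair H C' D'"
        and ab: "a = poly C x" "b = poly D y" "a' = poly C' x" "b' = poly D' y" by blast
    show "(a + a', b + b') \<in> ?H"
      by (rule HI[OF poly_pair_ops(1)[OF CD]]) (simp_all add: ab)
    show "(a - a', b - b') \<in> ?H"
      by (rule HI[OF poly_pair_ops(2)[OF CD]]) (simp_all add: ab)
    show "(a * a', b * b') \<in> ?H"
      by (rule HI[OF poly_pair_ops(3)[OF CD]]) (simp_all add: ab)
  qed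
qed

lemma hom_graph_adjoin_superset: "H \<subseteq> {(poly C x, poly D y) |C D. poly_pair H C D}"
proof clarify
  fix a b assume "(a, b) \<in> H"
  then show "\<exists>C D. (a, b) = (poly C x, poly D y) \<and> poly_pair H C D"
    by (intro exI[of _ "[:a:]"] exI[of _ "[:b:]"]) (simp add: poly_pair_const)
qed

lemma hom_graph_adjoin_mem: "(x, y) \<in> {(poly C x, poly D y) |C D. poly_pair H C D}"
  using poly_pair_monom[OF hom_graph_1, of 1]
  by (intro CollectI exI[of _ "monom 1 1"]) (auto simp: poly_monom)

end

text \<open>Injectivity makes the coefficients of \<open>A\<close> and \<open>B\<close> vanish
  simultaneously. The resulting equality of degrees is what makes \<open>B\<close> nonconstant, so
  that it has a root to which \<open>x\<close> can be sent.\<close>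

lemma least_poly_pair:
  obtains A B where "poly_pair H A B" "A \<noteq> 0" "poly A x = 0" "degree B = degree A"
    "\<And>C D. poly_pair H C D \<Longrightarrow> C \<noteq> 0 \<Longrightarrow> poly C x = 0 \<Longrightarrow> degree A \<le> degree C"
proof -
  obtain p :: "'a poly" where p: "p \<noteq> 0" "poly (map_poly to_ac p) x = 0"
    by (rule alg_closure_algebraic)
  let ?P = "\<lambda>(A, B). poly_pair H A B \<and> A \<noteq> 0 \<and> poly A x = 0"
  have "?P (map_poly to_ac p, map_poly to_ac p)"
    using p by (simp add: poly_pair_map_to_ac)
  then obtain AB where AB: "?P AB" "\<And>CD. ?P CD \<Longrightarrow> degree (fst AB) \<le> degree (fst CD)"
    using ex_has_least_nat[of ?P _ "\<lambda>AB. degree (fst AB)"] by blast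
  obtain A B where [simp]: "AB = (A, B)" by (cases AB)
  have zero: "coeff A i = 0 \<longleftrightarrow> coeff B i = 0" for i
  proof -
    have "(coeff A i, coeff B i) \<in> H" using AB by (auto simp: poly_pair_def)
    then show ?thesis using hom_graph_0D hom_graph_0D' by metis
  qed
  then have "B \<noteq> 0" using AB(1) by (auto simp: poly_eq_iff)
  have "degree B = degree A"
  proof (rule antisym)
    show "degree B \<le> degree A" using zero coeff_eq_0[of A] by (intro degree_le) blast
    show "degree A \<le> degree B" using zero coeff_eq_0[of B] by (intro degree_le) blast
  qed
  moreover have "degree A \<le> degree C" if "poly_pair H C D" "C \<noteq> 0" "poly C x = 0" for C D
    using AB(2)[of "(C, D)"] that by simp
  ultimately show ?thesis using that[of A B] AB by simp
qed

end

lemma hom_graph_Union: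
  assumes "\<H> \<noteq> {}" "\<And>H. H \<in> \<H> \<Longrightarrow> hom_graph H" "\<And>A B. A \<in> \<H> \<Longrightarrow> B \<in> \<H> \<Longrightarrow> A \<subseteq> B \<or> B \<subseteq> A"
  shows "hom_graph (\<Union>\<H>)"
  unfolding hom_graph_def
proof (intro conjI allI impI)
  obtain H where "H \<in> \<H>" using assms(1) by blast
  then show "(to_ac c, to_ac c) \<in> \<Union>\<H>" for c
    using hom_graph_to_ac[OF assms(2)] by blast
  show "y = 0" if "(0, y) \<in> \<Union>\<H>" for y
    using that hom_graph_0D[OF assms(2)] by blast
  fix x y x' y' assume "(x, y) \<in> \<Union>\<H>" "(x', y') \<in> \<Union>\<H>"
  then obtain A B where AB: "A \<in> \<H>" "B \<in> \<H>" "(x, y) \<in> A" "(x', y') \<in> B" by blast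
  then obtain C where C: "C \<in> \<H>" "(x, y) \<in> C" "(x', y') \<in> C"
    using assms(3)[OF AB(1,2)] by blast
  show "(x + x', y + y') \<in> \<Union>\<H>"
    using hom_graph_add[OF assms(2) C(2,3)] C(1) by blast
  show "(x - x', y - y') \<in> \<Union>\<H>"
    using hom_graph_diff[OF assms(2) C(2,3)] C(1) by blast
  show "(x * x', y * y') \<in> \<Union>\<H>"
    using hom_graph_mult[OF assms(2) C(2,3)] C(1) by blast
qed

text \<open>A maximal extension is total, since one more element could otherwise be adjoined. It is
  surjective because it maps the finite root set of each polynomial over k injectively into
  itself.\<close>

lemma hom_graph_extends_to_gal:
  assumes "hom_graph (H :: ('a::field alg_closure \<times> 'a alg_closure) set)"
  obtains \<sigma> where "\<sigma> \<in> gal" "\<And>x y. (x, y) \<in> H \<Longrightarrow> \<sigma> x = y"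
proof -
  define S where "S = {H'. hom_graph H' \<and> H \<subseteq> H'}"
  have "\<exists>M\<in>S. \<forall>N\<in>S. M \<subseteq> N \<longrightarrow> N = M"
  proof (rule subset_Zorn_nonempty)
    show "S \<noteq> {}" using assms unfolding S_def by blast
    fix \<H> assume C: "\<H> \<noteq> {}" "subset.chain S \<H>"
    have sub: "hom_graph A \<and> H \<subseteq> A" if "A \<in> \<H>" for A
      using C(2) that unfolding subset.chain_def S_def by blast
    have "A \<subseteq> B \<or> B \<subseteq> A" if "A \<in> \<H>" "B \<in> \<H>" for A B
      using C(2) that unfolding subset.chain_def by blast
    then have "hom_graph (\<Union>\<H>)"
      using C(1) sub by (intro hom_graph_Union) blast+
    moreover have "H \<subseteq> \<Union>\<H>" using C(1) sub by blast
    ultimately show "\<Union>\<H> \<in> S" by (simp add: S_def)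
  qed
  then obtain M where MS: "M \<in> S" and maxi': "\<forall>N\<in>S. M \<subseteq> N \<longrightarrow> N = M" by (elim bexE)
  then have M: "hom_graph M" "H \<subseteq> M" by (simp_all add: S_def)
  have maxi: "N = M" if "hom_graph N" "M \<subseteq> N" for N
  proof -
    have "N \<in> S" using that M(2) by (auto simp: S_def)
    then show ?thesis using maxi' that(2) by simp
  qed
  have total: "\<exists>y. (x, y) \<in> M" for x
  proof -
    obtain A B where AB: "poly_pair M A B" "A \<noteq> 0" "poly A x = 0" "degree B = degree A"
      "\<And>C D. poly_pair M C D \<Longrightarrow> C \<noteq> 0 \<Longrightarrow> poly C x = 0 \<Longrightarrow> degree A \<le> degree C"
      using least_poly_pair[OF M(1)] by metis
    have "degree A \<noteq> 0"
      using AB(2,3) by (metis degree_eq_zeroE mult_zero_right pCons_0_0 add.right_neutral poly_pCons poly_0)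
    then obtain y where "poly B y = 0" using AB(4) alg_closed_imp_poly_has_root[of B] by auto
    let ?M = "{(poly C x, poly D y) |C D. poly_pair M C D}"
    note adj = M(1) AB(1-3) \<open>poly B y = 0\<close>
    have "hom_graph ?M" by (rule hom_graph_adjoin[OF adj]) (rule AB(5))
    moreover have "M \<subseteq> ?M" by (rule hom_graph_adjoin_superset[OF adj]) (rule AB(5))
    ultimately have "?M = M" by (rule maxi)
    moreover have "(x, y) \<in> ?M" by (rule hom_graph_adjoin_mem[OF adj]) (rule AB(5))
    ultimately have "(x, y) \<in> M" by simp
    then show ?thesis by (rule exI)
  qed
  define \<sigma> where "\<sigma> x = (SOME y. (x, y) \<in> M)" for x
  have s: "(x, \<sigma> x) \<in> M" for x unfolding \<sigma>_def using total by (rule someI_ex)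
  have sI: "\<sigma> x = y" if "(x, y) \<in> M" for x y using hom_graph_fun[OF M(1) s that] .
  have hom: "\<sigma> (x + y) = \<sigma> x + \<sigma> y" "\<sigma> (x * y) = \<sigma> x * \<sigma> y" "\<sigma> (x - y) = \<sigma> x - \<sigma> y"
      "\<sigma> (to_ac c) = to_ac c" for x y c
    using M(1) s by (auto intro!: sI simp: hom_graph_add hom_graph_mult hom_graph_diff hom_graph_to_ac)
  have "inj \<sigma>"
  proof (rule injI)
    fix x y assume "\<sigma> x = \<sigma> y"
    then have "(x - y, 0) \<in> M" using hom(3)[of x y] s[of "x - y"] by simp
    then show "x = y" using hom_graph_0D'[OF M(1)] by fastforce
  qed
  have "surj \<sigma>"
  proof -
    have "y \<in> range \<sigma>" for y
    proof -
      obtain p :: "'a poly" where p: "p \<noteq> 0" "poly (map_poly to_ac p) y = 0"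
        by (rule alg_closure_algebraic)
      let ?R = "{y. poly (map_poly to_ac p) y = 0}"
      have "finite ?R" using p by (simp add: poly_roots_finite)
      moreover have "\<sigma> ` ?R \<subseteq> ?R"
      proof clarify
        fix x assume x: "poly (map_poly to_ac p) x = 0"
        have "(poly (map_poly to_ac p) x, poly (map_poly to_ac p) (\<sigma> x)) \<in> M"
          by (rule hom_graph_poly[OF M(1) s])
        then show "poly (map_poly to_ac p) (\<sigma> x) = 0" using x hom_graph_0D[OF M(1)] by simp
      qed
      ultimately have "\<sigma> ` ?R = ?R"
        using endo_inj_surj inj_on_subset[OF \<open>inj \<sigma>\<close>] by blast
      then show ?thesis using p by blast
    qed
    then show ?thesis by blast
  qed
  with \<open>inj \<sigma>\<close> have "bij \<sigma>" by (simp add: bij_def)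
  then have "\<sigma> \<in> gal" using hom(1,2,4) by (rule galI)
  then show ?thesis using that M(2) sI by blast
qed

section \<open>Simple roots\<close>

lemma rsquarefree_iff: "rsquarefree p \<longleftrightarrow> p \<noteq> 0 \<and> (\<forall>a. \<not> [:- a, 1:] ^ 2 dvd p)"
proof -
  have "(order a p = 0 \<or> order a p = 1) \<longleftrightarrow> \<not> [:- a, 1:] ^ 2 dvd p" if "p \<noteq> 0" for a
    using that unfolding order_divides by auto
  then show ?thesis unfolding rsquarefree_def by blast
qed

lemma rsquarefree_dvd: "rsquarefree p \<Longrightarrow> q dvd p \<Longrightarrow> rsquarefree q"
  unfolding rsquarefree_iff by (metis dvd_0_left_iff dvd_trans)

lemma double_root_iff:
  fixes p :: "'b::field poly"
  shows "[:- a, 1:] ^ 2 dvd p \<longleftrightarrow> poly p a = 0 \<and> poly (pderiv p) a = 0"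
proof
  assume "[:- a, 1:] ^ 2 dvd p"
  then obtain q where "p = [:- a, 1:] * ([:- a, 1:] * q)"
    by (metis dvdE power2_eq_square mult.assoc)
  then show "poly p a = 0 \<and> poly (pderiv p) a = 0" by (simp only: pderiv_mult poly_add poly_mult) simp
next
  assume p: "poly p a = 0 \<and> poly (pderiv p) a = 0"
  then obtain q where q: "p = [:- a, 1:] * q" by (metis dvdE poly_eq_0_iff_dvd)
  have "pderiv p = [:- a, 1:] * pderiv q + q * 1" unfolding q pderiv_mult by (simp add: pderiv_pCons)
  then have "poly q a = 0" using p by simp
  then obtain r where "q = [:- a, 1:] * r" by (metis dvdE poly_eq_0_iff_dvd)
  then have "p = [:- a, 1:] ^ 2 * r" by (simp only: q power2_eq_square mult.assoc)
  then show "[:- a, 1:] ^ 2 dvd p" by simp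
qed

lemma poly_prod_linear_eq_0_iff:
  fixes A :: "'b::field set"
  shows "finite A \<Longrightarrow> poly (\<Prod>a\<in>A. [:- a, 1:]) x = 0 \<longleftrightarrow> x \<in> A"
  by (simp add: poly_prod)

lemma prod_linear_dvd:
  fixes A :: "'b::field set"
  assumes "finite A" "\<And>a. a \<in> A \<Longrightarrow> poly q a = 0"
  shows "(\<Prod>a\<in>A. [:- a, 1:]) dvd q"
  using assms
proof (induction A)
  case (insert a A)
  then obtain s where s: "q = (\<Prod>a\<in>A. [:- a, 1:]) * s" by (metis dvdE insertCI)
  have "poly (\<Prod>a\<in>A. [:- a, 1:]) a \<noteq> 0"
    using insert.hyps by (simp add: poly_prod_linear_eq_0_iff)
  then have "poly s a = 0" using insert.prems[of a] by (simp add: s)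
  then have "[:- a, 1:] dvd s" by (simp add: poly_eq_0_iff_dvd)
  then have "(\<Prod>a\<in>A. [:- a, 1:]) * [:- a, 1:] dvd q" unfolding s by (rule mult_dvd_mono[OF dvd_refl])
  then show ?case unfolding prod.insert[OF insert.hyps] by (subst mult.commute)
qed simp

lemma rsquarefree_prod_linear:
  fixes A :: "'b::field set"
  assumes "finite A" shows "rsquarefree (\<Prod>a\<in>A. [:- a, 1:])"
  unfolding rsquarefree_iff
proof (intro conjI allI notI)
  show "(\<Prod>a\<in>A. [:- a, 1:]) = 0 \<Longrightarrow> False" using assms by simp
  fix a assume dvd: "[:- a, 1:] ^ 2 dvd (\<Prod>a\<in>A. [:- a, 1:])"
  then have "[:- a, 1:] dvd (\<Prod>a\<in>A. [:- a, 1:])" by (metis dvd_trans dvd_triv_left power2_eq_square)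
  then have "a \<in> A" by (simp only: poly_prod_linear_eq_0_iff[OF assms] flip: poly_eq_0_iff_dvd)
  then have "[:- a, 1:] * [:- a, 1:] dvd [:- a, 1:] * (\<Prod>a\<in>A - {a}. [:- a, 1:])"
    using dvd unfolding power2_eq_square by (metis assms prod.remove)
  then have "[:- a, 1:] dvd (\<Prod>a\<in>A - {a}. [:- a, 1:])" by (subst (asm) dvd_mult_cancel_left) auto
  then show False using assms by (simp add: poly_prod_linear_eq_0_iff flip: poly_eq_0_iff_dvd)
qed

lemma rsquarefree_factorization:
  fixes p :: "'b::alg_closed_field poly"
  assumes "rsquarefree p"
  shows "p = smult (lead_coeff p) (\<Prod>a\<in>{x. poly p x = 0}. [:- a, 1:])"
proof -
  define A where "A = {x. poly p x = 0}"
  have p0: "p \<noteq> 0" using assms by (simp add: rsquarefree_iff)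
  have fin: "finite A" unfolding A_def using p0 by (rule poly_roots_finite)
  then have "(\<Prod>a\<in>A. [:- a, 1:]) dvd p" by (rule prod_linear_dvd) (simp add: A_def)
  then obtain s where s: "p = (\<Prod>a\<in>A. [:- a, 1:]) * s" by (rule dvdE)
  have "degree s = 0"
  proof (rule ccontr)
    assume "degree s \<noteq> 0"
    then obtain b where b: "poly s b = 0" using alg_closed_imp_poly_has_root[of s] by auto
    then have "b \<in> A" by (simp add: A_def, subst s, simp)
    then have "[:- b, 1:] dvd (\<Prod>a\<in>A. [:- a, 1:])" using fin by (rule dvd_prodI[rotated])
    moreover have "[:- b, 1:] dvd s" using b by (simp add: poly_eq_0_iff_dvd)
    ultimately have "[:- b, 1:] ^ 2 dvd p"
      unfolding power2_eq_square by (subst s) (rule mult_dvd_mono)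
    then show False using assms by (simp add: rsquarefree_iff)
  qed
  then obtain c where c: "s = [:c:]" by (rule degree_eq_zeroE)
  have "lead_coeff (\<Prod>a\<in>A. [:- a, 1:]) = 1" by (simp add: lead_coeff_prod)
  moreover have "lead_coeff p = lead_coeff (\<Prod>a\<in>A. [:- a, 1:]) * lead_coeff s"
    unfolding lead_coeff_mult[symmetric] using s by (rule arg_cong)
  ultimately have "lead_coeff p = c" by (simp add: c)
  then have "p = smult (lead_coeff p) (\<Prod>a\<in>A. [:- a, 1:])" by (subst s) (simp add: c)
  then show ?thesis by (simp only: A_def)
qed

lemma rsquarefree_dvdI:
  fixes p :: "'b::alg_closed_field poly"
  assumes "rsquarefree p" "\<And>a. poly p a = 0 \<Longrightarrow> poly q a = 0"
  shows "p dvd q"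
proof -
  have "p \<noteq> 0" using assms(1) by (simp add: rsquarefree_iff)
  then have "(\<Prod>a\<in>{x. poly p x = 0}. [:- a, 1:]) dvd q"
    using assms(2) by (intro prod_linear_dvd poly_roots_finite) auto
  then show ?thesis using \<open>p \<noteq> 0\<close>
    by (subst rsquarefree_factorization[OF assms(1)]) (simp add: smult_dvd_iff)
qed

section \<open>Conjugates\<close>

lemma field_extension_inverse: "subring_over F \<Longrightarrow> x \<in> F \<Longrightarrow> inverse x \<in> F"
  unfolding field_extension_iff_subring_over[symmetric] field_extension_def by blast

lemma degree_pos_if_root:
  fixes p :: "'b::field poly"
  assumes "p \<noteq> 0" "poly p x = 0" shows "degree p > 0"
proof (rule ccontr)
  assume "\<not> degree p > 0"
  then obtain c where "p = [:c:]" by (metis degree_eq_zeroE gr0I)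
  then show False using assms by simp
qed

text \<open>With the identity of \<open>F\<close> as graph, \<open>poly_pair\<close> relates a
  polynomial over \<open>F\<close> to itself only. The least pair is then the minimal polynomial up
  to a scalar, and for every other root the extension theorem provides an automorphism over
  \<open>F\<close> reaching it.\<close>

lemma min_poly_over:
  fixes x :: "'a::field alg_closure"
  assumes F: "subring_over F"
  obtains \<mu> where "\<mu> \<in> polys_over F" "\<mu> \<noteq> 0" "poly \<mu> x = 0"
    "\<And>p. p \<in> polys_over F \<Longrightarrow> p \<noteq> 0 \<Longrightarrow> poly p x = 0 \<Longrightarrow> degree \<mu> \<le> degree p"
    "\<And>y. poly \<mu> y = 0 \<Longrightarrow> \<exists>\<sigma>\<in>gal. (\<forall>z\<in>F. \<sigma> z = z) \<and> \<sigma> x = y"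
proof -
  have H: "hom_graph (Id_on F)"
    using F unfolding hom_graph_def subring_over_def by auto
  have pp: "poly_pair (Id_on F) A B \<longleftrightarrow> A \<in> polys_over F \<and> B = A" for A B
    by (auto simp: poly_pair_def polys_over_def Id_on_iff poly_eq_iff)
  obtain A B where AB: "poly_pair (Id_on F) A B" "A \<noteq> 0" "poly A x = 0"
    "\<And>C D. poly_pair (Id_on F) C D \<Longrightarrow> C \<noteq> 0 \<Longrightarrow> poly C x = 0 \<Longrightarrow> degree A \<le> degree C"
    using least_poly_pair[OF H, of x] by metis
  have [simp]: "B = A" and A: "A \<in> polys_over F" using AB(1) by (simp_all add: pp)
  show ?thesis
  proof (rule that[OF A AB(2,3)])
    show "degree A \<le> degree p" if "p \<in> polys_over F" "p \<noteq> 0" "poly p x = 0" for p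
      using AB(4)[of p p] that by (simp add: pp)
    fix y assume y: "poly A y = 0"
    let ?H = "{(poly C x, poly D y) |C D. poly_pair (Id_on F) C D}"
    have y': "poly B y = 0" using y by simp
    note adj = H AB(1-3) y'
    have "hom_graph ?H" by (rule hom_graph_adjoin[OF adj]) (rule AB(4))
    then obtain \<sigma> where s: "\<sigma> \<in> gal" "\<And>a b. (a, b) \<in> ?H \<Longrightarrow> \<sigma> a = b"
      by (rule hom_graph_extends_to_gal) blast
    have sub: "Id_on F \<subseteq> ?H" by (rule hom_graph_adjoin_superset[OF adj]) (rule AB(4))
    have "(x, y) \<in> ?H" by (rule hom_graph_adjoin_mem[OF adj]) (rule AB(4))
    then have "\<sigma> x = y" by (rule s(2))
    moreover have "\<sigma> z = z" if "z \<in> F" for z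
      using sub that by (intro s(2)) blast
    ultimately show "\<exists>\<sigma>\<in>gal. (\<forall>z\<in>F. \<sigma> z = z) \<and> \<sigma> x = y"
      using s(1) by blast
  qed
qed

text \<open>Long division inside F[X]; the point is that the remainder keeps its coefficients in
  \<open>F\<close>, because \<open>F\<close> contains the inverse of the leading coefficient of
  \<mu>.\<close>

lemma polys_over_mod:
  fixes \<mu> :: "'a::field alg_closure poly"
  assumes F: "subring_over F" and mu: "\<mu> \<in> polys_over F" "degree \<mu> > 0" and "p \<in> polys_over F"
  obtains r where "r \<in> polys_over F" "degree r < degree \<mu>" "\<mu> dvd p - r"
proof -
  have "\<exists>r\<in>polys_over F. degree r < degree \<mu> \<and> \<mu> dvd p - r"
    using assms(4)
  proof (induction "degree p" arbitrary: p rule: less_induct)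
    case less
    show ?case
    proof (cases "degree p < degree \<mu>")
      case True
      then show ?thesis using less.prems by (intro bexI[of _ p]) simp_all
    next
      case False
      define c where "c = lead_coeff p * inverse (lead_coeff \<mu>)"
      define n where "n = degree p - degree \<mu>"
      have lc: "lead_coeff \<mu> \<noteq> 0" using mu(2) by auto
      define p' where "p' = p - monom c n * \<mu>"
      have "lead_coeff p \<in> F" "lead_coeff \<mu> \<in> F"
        using less.prems mu(1) by (simp_all add: polys_over_def)
      then have "c \<in> F"
        unfolding c_def by (intro subring_mult[OF F] field_extension_inverse[OF F])
      then have p': "p' \<in> polys_over F" unfolding p'_def
        by (intro polys_over_diff[OF F] polys_over_mult[OF F] polys_over_monom[OF F] less.prems mu(1))
      have "degree p' \<le> degree p"
      proof -
        have "degree (monom c n * \<mu>) \<le> n + degree \<mu>"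
          by (intro order.trans[OF degree_mult_le] add_mono degree_monom_le order.refl)
        then show ?thesis unfolding p'_def using False by (intro degree_diff_le) (simp_all add: n_def)
      qed
      moreover have "coeff p' (degree p) = 0"
        using False lc by (simp add: p'_def n_def c_def coeff_monom_mult)
      ultimately have "degree p' < degree p"
        using False mu(2) by (metis degree_0 le_neq_implies_less leading_coeff_0_iff not_gr_zero order_less_le_trans not_le)
      from less.hyps[OF this p'] obtain r where r: "r \<in> polys_over F" "degree r < degree \<mu>" "\<mu> dvd p' - r"
        by blast
      have "p - r = (p' - r) + monom c n * \<mu>" by (simp add: p'_def)
      then have "\<mu> dvd p - r" by (simp only: dvd_add[OF r(3) dvd_triv_right])
      then show ?thesis using r by blast
    qed
  qed
  then show ?thesis using that by blast
qed

lemma min_poly_over_dvd: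
  fixes \<mu> :: "'a::field alg_closure poly"
  assumes F: "subring_over F" and mu: "\<mu> \<in> polys_over F" "\<mu> \<noteq> 0" "poly \<mu> x = 0"
    and least: "\<And>p. p \<in> polys_over F \<Longrightarrow> p \<noteq> 0 \<Longrightarrow> poly p x = 0 \<Longrightarrow> degree \<mu> \<le> degree p"
    and p: "p \<in> polys_over F" "poly p x = 0"
  shows "\<mu> dvd p"
proof -
  obtain r where r: "r \<in> polys_over F" "degree r < degree \<mu>" "\<mu> dvd p - r"
    using polys_over_mod[OF F mu(1) degree_pos_if_root[OF mu(2,3)] p(1)] .
  then obtain q where "p - r = \<mu> * q" by (elim dvdE)
  then have "poly (p - r) x = 0" using mu(3) by (simp only: poly_mult mult_zero_left)
  then have "poly r x = 0" using p(2) by simp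
  then have "r = 0" using least[OF r(1)] r(2) by fastforce
  then show ?thesis using r(3) by simp
qed

text \<open>An irreducible polynomial over k divides the minimal polynomial of each of its roots, so
  \<open>min_poly_over\<close> with k as base applies to \<open>y\<close>.\<close>

lemma gal_transitive_on_roots:
  fixes h :: "'a::field poly"
  assumes h: "irreducible h" "poly (map_poly to_ac h) x = 0" "poly (map_poly to_ac h) y = 0"
  obtains \<sigma> where "\<sigma> \<in> gal" "\<sigma> x = y"
proof -
  note k = subring_over_range_to_ac
  obtain \<mu> where mu: "\<mu> \<in> polys_over (range to_ac)" "\<mu> \<noteq> 0" "poly \<mu> x = 0"
    "\<And>p. p \<in> polys_over (range to_ac) \<Longrightarrow> p \<noteq> 0 \<Longrightarrow> poly p x = 0 \<Longrightarrow> degree \<mu> \<le> degree p"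
    and conj: "\<And>y. poly \<mu> y = 0 \<Longrightarrow> \<exists>\<sigma>\<in>gal. (\<forall>z\<in>range to_ac. \<sigma> z = z) \<and> \<sigma> x = y"
    using min_poly_over[OF k, of x] by blast
  obtain m where m: "\<mu> = map_poly to_ac m" using mu(1) by (auto simp: polys_over_range_to_ac)
  have "m dvd h"
  proof -
    note hom = rhom.map_poly_hom[OF rhom_to_ac]
    let ?r = "map_poly to_ac (h mod m)"
    have "map_poly to_ac h = map_poly to_ac (h div m * m + h mod m)" by simp
    also have "\<dots> = map_poly to_ac (h div m) * \<mu> + ?r"
      by (simp only: rhom.hom_add[OF hom] rhom.hom_mult[OF hom] m)
    finally have "poly ?r x = 0" using h(2) mu(3) by simp
    then have "degree \<mu> \<le> degree ?r \<or> ?r = 0" using mu(4)[of ?r] by (auto simp: polys_over_range_to_ac)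
    moreover have "m \<noteq> 0" using mu(2) m by simp
    then have "h mod m = 0 \<or> degree (h mod m) < degree m" by (rule degree_mod_less)
    ultimately have "h mod m = 0" unfolding m by (auto simp: m)
    then show ?thesis by (simp add: mod_eq_0_iff_dvd)
  qed
  moreover have "\<not> is_unit m"
    using degree_pos_if_root[OF mu(2,3)] mu(2) by (simp add: m is_unit_iff_degree)
  ultimately have "h dvd m" using h(1) by (metis irreducibleD')
  then obtain q where "m = h * q" by (elim dvdE)
  then have "\<mu> = map_poly to_ac h * map_poly to_ac q"
    by (simp only: m rhom.hom_mult[OF rhom.map_poly_hom[OF rhom_to_ac]])
  then have "poly \<mu> y = 0" using h(3) by simp
  then show ?thesis using conj that by blast
qed

text \<open>The minimal polynomial of \<open>x\<close> over \<open>F\<close> has no root other than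
  \<open>x\<close>, and separability excludes multiplicity. Hence it is linear and its coefficients
  exhibit \<open>x\<close> in \<open>F\<close>.\<close>

lemma gal_fixed_in:
  fixes x :: "'a::field alg_closure"
  assumes F: "subring_over F" and sep: "separable_element x"
    and fixed: "\<And>\<sigma>. \<sigma> \<in> gal \<Longrightarrow> (\<And>z. z \<in> F \<Longrightarrow> \<sigma> z = z) \<Longrightarrow> \<sigma> x = x"
  shows "x \<in> F"
proof -
  obtain \<mu> where mu: "\<mu> \<in> polys_over F" "\<mu> \<noteq> 0" "poly \<mu> x = 0"
    "\<And>p. p \<in> polys_over F \<Longrightarrow> p \<noteq> 0 \<Longrightarrow> poly p x = 0 \<Longrightarrow> degree \<mu> \<le> degree p"
    and conj: "\<And>y. poly \<mu> y = 0 \<Longrightarrow> \<exists>\<sigma>\<in>gal. (\<forall>z\<in>F. \<sigma> z = z) \<and> \<sigma> x = y"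
    using min_poly_over[OF F, of x] by blast
  obtain p :: "'a poly" where p: "separable_poly p" "poly (map_poly to_ac p) x = 0"
    using sep by (auto simp: separable_element_def)
  have "\<mu> dvd map_poly to_ac p"
    by (rule min_poly_over_dvd[OF F mu(1-3) _ polys_over_map_to_ac[OF F] p(2)]) (rule mu(4))
  then have sq: "rsquarefree \<mu>" using p(1) by (auto simp: separable_poly_def intro: rsquarefree_dvd)
  have "{y. poly \<mu> y = 0} = {x}" using conj fixed mu(3) by blast
  with rsquarefree_factorization[OF sq] have "\<mu> = smult (lead_coeff \<mu>) [:- x, 1:]" by simp
  then have c: "coeff \<mu> 0 = - lead_coeff \<mu> * x"
    by (metis coeff_pCons_0 coeff_smult mult_minus_right mult_minus_left)
  have "x = (0 - coeff \<mu> 0) * inverse (lead_coeff \<mu>)" using mu(2) by (simp add: c)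
  also have "\<dots> \<in> F" using mu(1) unfolding polys_over_def
    by (intro subring_mult[OF F] subring_diff[OF F] subring_0[OF F] field_extension_inverse[OF F]) blast+
  finally show ?thesis .
qed

lemma irreducible_poly_of:
  fixes x :: "'a::field alg_closure"
  obtains m :: "'a poly" where "irreducible m" "poly (map_poly to_ac m) x = 0"
    "\<And>p. poly (map_poly to_ac p) x = 0 \<Longrightarrow> m dvd p"
proof -
  obtain p0 :: "'a poly" where p0: "p0 \<noteq> 0 \<and> poly (map_poly to_ac p0) x = 0"
    by (metis alg_closure_algebraic)
  obtain m :: "'a poly" where m: "m \<noteq> 0" "poly (map_poly to_ac m) x = 0"
    and least: "\<And>p. p \<noteq> 0 \<Longrightarrow> poly (map_poly to_ac p) x = 0 \<Longrightarrow> degree m \<le> degree p"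
    using ex_has_least_nat[of "\<lambda>p :: 'a poly. p \<noteq> 0 \<and> poly (map_poly to_ac p) x = 0", OF p0, of degree]
    by blast
  note hom = rhom.map_poly_hom[OF rhom_to_ac]
  have dvd: "m dvd p" if "poly (map_poly to_ac p) x = 0" for p
  proof -
    have "map_poly to_ac p = map_poly to_ac (p div m * m + p mod m)" by simp
    also have "\<dots> = map_poly to_ac (p div m) * map_poly to_ac m + map_poly to_ac (p mod m)"
      by (simp only: rhom.hom_add[OF hom] rhom.hom_mult[OF hom])
    finally have "poly (map_poly to_ac (p mod m)) x = 0" using that m(2) by simp
    then have "degree m \<le> degree (p mod m) \<or> p mod m = 0" using least by blast
    moreover have "p mod m = 0 \<or> degree (p mod m) < degree m" using m(1) by (rule degree_mod_less)
    ultimately have "p mod m = 0" by auto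
    then show ?thesis by (simp add: mod_eq_0_iff_dvd)
  qed
  have deg: "degree m > 0" using degree_pos_if_root[of "map_poly to_ac m"] m by simp
  have "irreducible m"
  proof (rule irreducibleI)
    show "m \<noteq> 0" by (rule m(1))
    show "\<not> is_unit m" using deg by (simp add: is_unit_iff_degree m(1))
    fix a b assume ab: "m = a * b"
    then have "poly (map_poly to_ac a) x * poly (map_poly to_ac b) x = 0"
      using m(2) by (simp only: rhom.hom_mult[OF hom] poly_mult)
    then have "m dvd a \<or> m dvd b" using dvd by auto
    then show "is_unit a \<or> is_unit b"
    proof
      assume "m dvd a"
      then have "a * b dvd a * 1" by (simp add: ab)
      then show ?thesis using m(1) ab by (subst (asm) dvd_mult_cancel_left) auto
    next
      assume "m dvd b"
      then have "b * a dvd b * 1" by (simp add: ab mult.commute)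
      then show ?thesis using m(1) ab by (subst (asm) dvd_mult_cancel_left) auto
    qed
  qed
  then show ?thesis using that m(2) dvd by blast
qed

section \<open>Separable elements\<close>

text \<open>Towers of simple extensions with separable generators. Every element of such a tower is separable
  because its orbit under \<open>gal\<close> lies in a larger tower, whose fixed elements are in \<open>k\<close>.\<close>

inductive sepf :: "'a::field alg_closure set \<Rightarrow> bool" where
  sepf_base: "sepf (range to_ac)"
| sepf_adjoin: "sepf N \<Longrightarrow> A \<in> polys_over N \<Longrightarrow> rsquarefree A \<Longrightarrow> poly A x = 0 \<Longrightarrow> sepf (adjoin N x)"

lemma sepf_subring_over: "sepf N \<Longrightarrow> subring_over N"
  by (induction rule: sepf.induct) (rule subring_over_range_to_ac, erule subring_over_adjoin)

lemma gal_fixes_map_poly: "\<sigma> \<in> gal \<Longrightarrow> (\<And>z. z \<in> N \<Longrightarrow> \<sigma> z = z) \<Longrightarrow> p \<in> polys_over N \<Longrightarrow> map_poly \<sigma> p = p"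
  by (rule poly_eqI) (simp add: rhom.coeff_hom[OF rhom_gal] polys_over_def)

text \<open>Descent by one storey: write y = r(x) with r of degree below that of the minimal
  polynomial \<mu> of \<open>x\<close>. Invariance of \<open>y\<close> makes r - y vanish at all
  conjugates of \<open>x\<close> over \<open>N\<close>, so the squarefree \<mu> divides it; by
  degrees r is constant and \<open>y\<close> already lies in \<open>N\<close>.\<close>

lemma sepf_fixed:
  assumes "sepf N" "y \<in> N" "\<And>\<sigma>. \<sigma> \<in> gal \<Longrightarrow> \<sigma> y = y"
  shows "y \<in> range to_ac"
  using assms
proof (induction N arbitrary: y rule: sepf.induct)
  case (sepf_adjoin N A x)
  note N = sepf_subring_over[OF sepf_adjoin.hyps(1)]
  obtain \<mu> where mu: "\<mu> \<in> polys_over N" "\<mu> \<noteq> 0" "poly \<mu> x = 0"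
    "\<And>p. p \<in> polys_over N \<Longrightarrow> p \<noteq> 0 \<Longrightarrow> poly p x = 0 \<Longrightarrow> degree \<mu> \<le> degree p"
    and conj: "\<And>y. poly \<mu> y = 0 \<Longrightarrow> \<exists>\<sigma>\<in>gal. (\<forall>z\<in>N. \<sigma> z = z) \<and> \<sigma> x = y"
    using min_poly_over[OF N, of x] by blast
  have "\<mu> dvd A"
    by (rule min_poly_over_dvd[OF N mu(1-3) _ sepf_adjoin.hyps(2,4)]) (rule mu(4))
  with sepf_adjoin.hyps(3) have sq: "rsquarefree \<mu>" by (rule rsquarefree_dvd)
  have deg: "degree \<mu> > 0" by (rule degree_pos_if_root[OF mu(2,3)])
  obtain h where h: "h \<in> polys_over N" "y = poly h x"
    using sepf_adjoin.prems(1) unfolding adjoin_def by blast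
  obtain r where r: "r \<in> polys_over N" "degree r < degree \<mu>" "\<mu> dvd h - r"
    by (rule polys_over_mod[OF N mu(1) deg h(1)])
  obtain q where "h - r = \<mu> * q" using r(3) by (elim dvdE)
  then have "poly (h - r) x = 0" using mu(3) by (simp only: poly_mult mult_zero_left)
  then have y: "y = poly r x" by (simp add: h(2))
  have "poly (r - [:y:]) x' = 0" if x': "poly \<mu> x' = 0" for x'
  proof -
    obtain \<sigma> where s: "\<sigma> \<in> gal" "\<And>z. z \<in> N \<Longrightarrow> \<sigma> z = z" "\<sigma> x = x'" using conj[OF x'] by blast
    have mr: "map_poly \<sigma> r = r" by (rule gal_fixes_map_poly[OF s(1) _ r(1)]) (rule s(2))
    have "y = \<sigma> y" using sepf_adjoin.prems(2)[OF s(1)] by simp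
    also have "\<dots> = poly r x'"
      unfolding y rhom.poly_hom[OF rhom_gal[OF s(1)]] s(3) mr ..
    finally show ?thesis by simp
  qed
  then have "\<mu> dvd r - [:y:]" by (rule rsquarefree_dvdI[OF sq])
  moreover have "degree (r - [:y:]) < degree \<mu>"
    using r(2) deg by (intro degree_diff_less) simp_all
  ultimately have "r - [:y:] = 0" by (metis dvd_imp_degree_le not_le)
  then have "y = coeff r 0" by simp
  then have "y \<in> N" using r(1) unfolding polys_over_def by simp
  then show ?case using sepf_adjoin.prems(2) by (rule sepf_adjoin.IH)
qed

lemma rsquarefree_gal:
  assumes s: "\<sigma> \<in> gal" and "rsquarefree A" shows "rsquarefree (map_poly \<sigma> A)"
  unfolding rsquarefree_iff
proof (intro conjI allI notI)
  note hom = rhom_gal[OF s]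
  assume "map_poly \<sigma> A = 0"
  then have "\<sigma> (coeff A i) = \<sigma> 0" for i by (simp add: rhom.hom_0[OF hom] flip: rhom.coeff_hom[OF hom])
  then have "A = 0" by (intro poly_eqI) (simp add: gal_inj[OF s])
  then show False using assms(2) by (simp add: rsquarefree_iff)
next
  note hom = rhom_gal[OF s]
  fix a assume "[:- a, 1:] ^ 2 dvd map_poly \<sigma> A"
  then have a: "poly (map_poly \<sigma> A) a = 0" "poly (map_poly \<sigma> (pderiv A)) a = 0"
    unfolding double_root_iff rhom.map_poly_hom_pderiv[OF hom] by blast+
  define b where "b = inv_into UNIV \<sigma> a"
  have ab: "a = \<sigma> b" by (simp add: b_def gal_inv_apply[OF s])
  have "\<sigma> (poly A b) = \<sigma> 0" "\<sigma> (poly (pderiv A) b) = \<sigma> 0"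
    using a by (simp_all only: ab rhom.poly_hom[OF hom] rhom.hom_0[OF hom])
  then have "[:- b, 1:] ^ 2 dvd A" unfolding double_root_iff gal_inj[OF s] by blast
  then show False using assms(2) by (simp add: rsquarefree_iff)
qed

text \<open>The image of a tower under \<sigma> is again a tower, because automorphisms preserve
  simple roots; it can be erected storey by storey on top of \<open>N'\<close>.\<close>

lemma sepf_join:
  assumes "sepf N" "sepf N'" and s: "\<sigma> \<in> gal"
  shows "\<exists>N''. sepf N'' \<and> N' \<subseteq> N'' \<and> \<sigma> ` N \<subseteq> N''"
  using assms(1)
proof (induction N rule: sepf.induct)
  case sepf_base
  have "\<sigma> ` range to_ac \<subseteq> N'"
    using sepf_subring_over[OF assms(2)] s by (auto simp: subring_over_def)
  then show ?case using assms(2) by blast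
next
  case (sepf_adjoin N A x)
  then obtain M where M: "sepf M" "N' \<subseteq> M" "\<sigma> ` N \<subseteq> M" by blast
  note hom = rhom_gal[OF s] and MS = sepf_subring_over[OF M(1)]
  have over: "map_poly \<sigma> p \<in> polys_over M" if "p \<in> polys_over N" for p
    using that M(3) unfolding polys_over_def by (auto simp: rhom.coeff_hom[OF hom])
  have "poly (map_poly \<sigma> A) (\<sigma> x) = 0"
    using sepf_adjoin.hyps(4) by (simp add: rhom.hom_0[OF hom] flip: rhom.poly_hom[OF hom])
  with M(1) over[OF sepf_adjoin.hyps(2)] rsquarefree_gal[OF s sepf_adjoin.hyps(3)]
  have "sepf (adjoin M (\<sigma> x))" by (rule sepf.sepf_adjoin)
  moreover have "\<sigma> ` adjoin N x \<subseteq> adjoin M (\<sigma> x)"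
  proof (rule image_subsetI)
    fix y assume "y \<in> adjoin N x"
    then obtain p where p: "p \<in> polys_over N" "y = poly p x" unfolding adjoin_def by blast
    show "\<sigma> y \<in> adjoin M (\<sigma> x)"
      by (rule adjoinI[OF over[OF p(1)]]) (simp add: p(2) rhom.poly_hom[OF hom])
  qed
  ultimately show ?case using M(2) subset_adjoin[OF MS] by blast
qed

lemma sepf_orbits:
  assumes "finite S" "S \<subseteq> gal" "sepf N"
  shows "\<exists>N'. sepf N' \<and> (\<forall>\<sigma>\<in>S. \<sigma> ` N \<subseteq> N')"
  using assms(1,2)
proof (induction S)
  case (insert \<sigma> S)
  then obtain N' where N': "sepf N'" "\<forall>\<sigma>\<in>S. \<sigma> ` N \<subseteq> N'" by blast
  then obtain M where "sepf M" "N' \<subseteq> M" "\<sigma> ` N \<subseteq> M"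
    using sepf_join[OF assms(3) N'(1), of \<sigma>] insert.prems by blast
  then show ?case using N'(2) by blast
qed (use assms(3) in blast)

lemma gal_bij_orbit:
  assumes s: "\<sigma> \<in> gal" shows "bij_betw \<sigma> ((\<lambda>\<tau>. \<tau> y) ` gal) ((\<lambda>\<tau>. \<tau> y) ` gal)"
proof (rule bij_betwI[where g = "inv_into UNIV \<sigma>"])
  show "\<sigma> \<in> (\<lambda>\<tau>. \<tau> y) ` gal \<rightarrow> (\<lambda>\<tau>. \<tau> y) ` gal"
    using gal_comp[OF s] by (auto intro!: image_eqI[where x = "\<lambda>x. \<sigma> (_ x)"])
  show "inv_into UNIV \<sigma> \<in> (\<lambda>\<tau>. \<tau> y) ` gal \<rightarrow> (\<lambda>\<tau>. \<tau> y) ` gal"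
    using gal_comp[OF gal_inv[OF s]] by (auto intro!: image_eqI[where x = "\<lambda>x. inv_into UNIV \<sigma> (_ x)"])
qed (simp_all add: gal_inv_apply s)

text \<open>The polynomial \<open>R\<close> with simple roots exactly at the orbit of
  \<open>y\<close> is invariant under \<open>gal\<close> and has coefficients in a tower, hence in
  k. The minimal polynomial of \<open>y\<close> divides it and inherits the simple roots.\<close>

lemma separable_if_in_sepf:
  fixes y :: "'a::field alg_closure"
  assumes "sepf N" "y \<in> N" shows "separable_element y"
proof -
  define Y where "Y = (\<lambda>\<sigma>. \<sigma> y) ` gal"
  have finY: "finite Y" unfolding Y_def by (rule finite_gal_orbit)
  then obtain S where S: "S \<subseteq> gal" "finite S" "Y = (\<lambda>\<sigma>. \<sigma> y) ` S"
    using finite_subset_image[of Y "\<lambda>\<sigma>. \<sigma> y" gal] Y_def by blast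
  obtain M where M: "sepf M" "\<forall>\<sigma>\<in>S. \<sigma> ` N \<subseteq> M"
    using sepf_orbits[OF S(2,1) assms(1)] by blast
  note MS = sepf_subring_over[OF M(1)]
  define R where "R = (\<Prod>a\<in>Y. [:- a, 1:])"
  have "Y \<subseteq> M" using M(2) S(3) assms(2) by blast
  then have "[:- a, 1:] \<in> polys_over M" if "a \<in> Y" for a
    using that subring_diff[OF MS subring_0[OF MS], of a]
    by (auto simp: polys_over_pCons[OF MS] polys_over_0[OF MS] subring_1[OF MS])
  then have RM: "R \<in> polys_over M" unfolding R_def by (rule polys_over_prod[OF MS])
  have "map_poly \<sigma> R = R" if s: "\<sigma> \<in> gal" for \<sigma>
  proof -
    note hom = rhom_gal[OF s]
    have "map_poly \<sigma> R = (\<Prod>a\<in>Y. [:- \<sigma> a, 1:])"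
      unfolding R_def rhom.hom_prod[OF rhom.map_poly_hom[OF hom]]
      by (simp add: rhom.map_poly_hom_pCons[OF hom] rhom.hom_minus[OF hom] rhom.hom_1[OF hom])
    also have "\<dots> = R" unfolding R_def
      by (rule prod.reindex_bij_betw[OF gal_bij_orbit[OF s, of y, folded Y_def], where g = "\<lambda>a. [:- a, 1:]"])
    finally show ?thesis .
  qed
  then have "\<sigma> (coeff R i) = coeff R i" if "\<sigma> \<in> gal" for \<sigma> i
    using that by (metis rhom.coeff_hom[OF rhom_gal])
  then have "coeff R i \<in> range to_ac" for i
    using RM unfolding polys_over_def by (intro sepf_fixed[OF M(1)]) simp_all
  then have "R \<in> polys_over (range to_ac)" by (simp add: polys_over_def)
  then obtain R' where R': "R = map_poly to_ac R'" by (auto simp: polys_over_range_to_ac)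
  obtain m :: "'a poly" where m: "irreducible m" "poly (map_poly to_ac m) y = 0"
      "\<And>p. poly (map_poly to_ac p) y = 0 \<Longrightarrow> m dvd p"
    using irreducible_poly_of[of y] by blast
  have "y \<in> Y" unfolding Y_def using gal_id by (rule rev_image_eqI) simp
  then have "poly R y = 0" using finY by (simp add: R_def poly_prod_linear_eq_0_iff)
  then have "m dvd R'" using m(3) by (simp add: R')
  then have "map_poly to_ac m dvd R"
    unfolding R' by (elim dvdE) (simp add: rhom.hom_mult[OF rhom.map_poly_hom[OF rhom_to_ac]])
  then have "rsquarefree (map_poly to_ac m)"
    using rsquarefree_prod_linear[OF finY] rsquarefree_dvd unfolding R_def by blast
  then show ?thesis unfolding separable_element_def separable_poly_def using m(1,2) by blast
qed

lemma sepf_adjoin_separable: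
  assumes "sepf N" "separable_element x" shows "sepf (adjoin N x)"
proof -
  obtain p where p: "separable_poly p" "poly (map_poly to_ac p) x = 0"
    using assms(2) by (auto simp: separable_element_def)
  show ?thesis
    by (rule sepf_adjoin[OF assms(1) _ _ p(2)])
       (use p(1) in \<open>simp_all add: separable_poly_def polys_over_map_to_ac[OF sepf_subring_over[OF assms(1)]]\<close>)
qed

lemma sepf_contains_finite:
  assumes "finite R" "\<And>r. r \<in> R \<Longrightarrow> separable_element r"
  shows "\<exists>N. sepf N \<and> R \<subseteq> N"
  using assms
proof (induction R)
  case empty
  show ?case using sepf_base by blast
next
  case (insert r R)
  then obtain N where N: "sepf N" "R \<subseteq> N" by blast
  have "sepf (adjoin N r)" using N(1) insert.prems by (intro sepf_adjoin_separable) simp_all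
  then show ?case
    using N subset_adjoin[OF sepf_subring_over[OF N(1)]] mem_adjoin[OF sepf_subring_over[OF N(1)]] by blast
qed

lemma sepf_kadj: "separable_element x \<Longrightarrow> sepf (kadj x)"
  by (rule sepf_adjoin_separable[OF sepf_base])

lemma separable_kadj: "separable_element x \<Longrightarrow> y \<in> kadj x \<Longrightarrow> separable_element y"
  using separable_if_in_sepf sepf_kadj by blast

lemma separable_root_over_kadj:
  assumes "separable_element c" "A \<in> polys_over (kadj c)" "rsquarefree A" "poly A x = 0"
  shows "separable_element x"
  using separable_if_in_sepf[OF sepf_adjoin[OF sepf_kadj[OF assms(1)] assms(2-4)]]
    mem_adjoin[OF subring_over_kadj] by blast

lemma separable_gal: assumes "separable_element x" "\<sigma> \<in> gal" shows "separable_element (\<sigma> x)"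
proof -
  obtain p where "irreducible p" "separable_poly p" "poly (map_poly to_ac p) x = 0"
    using assms(1) by (auto simp: separable_element_def)
  moreover from this have "poly (map_poly to_ac p) (\<sigma> x) = 0"
    using assms(2) by (simp add: rhom.hom_0[OF rhom_gal] flip: gal_poly_to_ac)
  ultimately show ?thesis by (auto simp: separable_element_def)
qed

section \<open>Linear forms that separate finitely many tuples, and primitive elements\<close>

text \<open>With the coefficients chosen as distinct powers of one \<open>u\<close>, the difference
  of the form at two tuples is a polynomial in \<open>u\<close>, and it is the zero polynomial only
  if the tuples agree on \<open>I\<close>. Finitely many nonzero polynomials leave a good
  \<open>u\<close> in the infinite field k.\<close>

lemma separating_linear_form:
  fixes V :: "('i \<Rightarrow> 'a::field alg_closure) set" and e :: "'i \<Rightarrow> nat"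
  assumes inf: "infinite (UNIV :: 'a set)" and "finite V" "finite I" "inj_on e I"
  obtains u :: 'a where "\<And>v w i. v \<in> V \<Longrightarrow> w \<in> V \<Longrightarrow>
    (\<Sum>i\<in>I. to_ac (u ^ e i) * v i) = (\<Sum>i\<in>I. to_ac (u ^ e i) * w i) \<Longrightarrow> i \<in> I \<Longrightarrow> v i = w i"
proof -
  define P where "P v w = (\<Sum>i\<in>I. monom (v i - w i) (e i))" for v w :: "'i \<Rightarrow> 'a alg_closure"
  define D where "D = {(v, w). v \<in> V \<and> w \<in> V \<and> P v w \<noteq> 0}"
  have "finite D" by (rule finite_subset[of _ "V \<times> V"]) (auto simp: D_def assms)
  then have "finite (\<Union>(v, w)\<in>D. {z. poly (P v w) z = 0})"
    by (rule finite_UN_I) (auto simp: D_def intro!: poly_roots_finite)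
  then have "finite (to_ac -` (\<Union>(v, w)\<in>D. {z. poly (P v w) z = 0}) :: 'a set)"
    by (rule finite_vimageI[OF _ inj_to_ac])
  then obtain u :: 'a where "u \<notin> to_ac -` (\<Union>(v, w)\<in>D. {z. poly (P v w) z = 0})"
    using inf by (metis ex_new_if_finite)
  then have u: "poly (P v w) (to_ac u) \<noteq> 0" if "v \<in> V" "w \<in> V" "P v w \<noteq> 0" for v w
    using that by (auto simp: D_def)
  show ?thesis
  proof (rule that[of u])
    fix v w i assume vw: "v \<in> V" "w \<in> V" and i: "i \<in> I"
      and eq: "(\<Sum>i\<in>I. to_ac (u ^ e i) * v i) = (\<Sum>i\<in>I. to_ac (u ^ e i) * w i)"
    have "poly (P v w) (to_ac u) = (\<Sum>i\<in>I. to_ac (u ^ e i) * v i) - (\<Sum>i\<in>I. to_ac (u ^ e i) * w i)"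
      by (simp add: P_def poly_sum poly_monom left_diff_distrib sum_subtractf mult.commute)
    then have "poly (P v w) (to_ac u) = 0" using eq by simp
    then have "P v w = 0" using u[OF vw] by blast
    then have "coeff (P v w) (e i) = 0" by simp
    moreover have "coeff (P v w) (e i) = (\<Sum>j\<in>I. if j = i then v j - w j else 0)"
      unfolding P_def coeff_sum coeff_monom
      by (rule sum.cong) (use i assms(4) in \<open>auto simp: inj_on_def\<close>)
    ultimately show "v i = w i" using i assms(3) by simp
  qed
qed

text \<open>The form separates the restrictions of automorphisms to \<open>R\<close>, so an
  automorphism fixing \<open>e\<close> fixes \<open>R\<close> pointwise. The last clause says that
  \<open>e\<close> is built from \<open>R\<close> by ring operations over k; later it lets
  properties of \<open>e\<close> be checked on the generators \<open>R\<close>.\<close>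

theorem primitive_element:
  fixes R :: "'a::field alg_closure set"
  assumes inf: "infinite (UNIV :: 'a set)" and R: "finite R" "\<And>r. r \<in> R \<Longrightarrow> separable_element r"
  shows "\<exists>e. separable_element e \<and> R \<subseteq> kadj e \<and> (\<forall>N. subring_over N \<and> R \<subseteq> N \<longrightarrow> e \<in> N)"
proof -
  obtain idx :: "'a alg_closure \<Rightarrow> nat" where idx: "inj_on idx R"
    using finite_imp_inj_to_nat_seg[OF R(1)] by blast
  define V where "V = (\<lambda>\<sigma>. restrict \<sigma> R) ` (gal :: ('a alg_closure \<Rightarrow> 'a alg_closure) set)"
  have "V \<subseteq> (\<Pi>\<^sub>E r\<in>R. (\<lambda>\<sigma>. \<sigma> r) ` gal)" by (auto simp: V_def)
  then have "finite V" by (rule finite_subset) (intro finite_PiE R(1) finite_gal_orbit)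
  then obtain u :: 'a where u: "\<And>v w i. v \<in> V \<Longrightarrow> w \<in> V \<Longrightarrow>
    (\<Sum>i\<in>R. to_ac (u ^ idx i) * v i) = (\<Sum>i\<in>R. to_ac (u ^ idx i) * w i) \<Longrightarrow> i \<in> R \<Longrightarrow> v i = w i"
    using separating_linear_form[OF inf _ R(1) idx] by blast
  define e where "e = (\<Sum>r\<in>R. to_ac (u ^ idx r) * r)"
  have eN: "e \<in> N" if N: "subring_over N" "R \<subseteq> N" for N
    unfolding e_def using N(2)
    by (intro subring_sum[OF N(1)] subring_mult[OF N(1)] subring_to_ac[OF N(1)]) blast
  have "separable_element e"
    using sepf_contains_finite[OF R] eN separable_if_in_sepf sepf_subring_over by blast
  moreover have "r \<in> kadj e" if r: "r \<in> R" for r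
  proof (rule gal_fixed_in[OF subring_over_kadj R(2)[OF r]])
    fix \<sigma> :: "'a alg_closure \<Rightarrow> 'a alg_closure" assume s: "\<sigma> \<in> gal" "\<And>z. z \<in> kadj e \<Longrightarrow> \<sigma> z = z"
    have "\<sigma> e = e" by (rule s(2)[OF mem_kadj])
    moreover have "\<sigma> e = (\<Sum>r\<in>R. to_ac (u ^ idx r) * \<sigma> r)"
      unfolding e_def rhom.hom_sum[OF rhom_gal[OF s(1)]] rhom.hom_mult[OF rhom_gal[OF s(1)]] gal_to_ac[OF s(1)] ..
    moreover have "restrict \<sigma> R \<in> V" "restrict (\<lambda>x. x) R \<in> V"
      unfolding V_def using s(1) gal_id by blast+
    ultimately have V: "restrict \<sigma> R \<in> V" "restrict (\<lambda>x. x) R \<in> V"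
      and "(\<Sum>i\<in>R. to_ac (u ^ idx i) * restrict \<sigma> R i) =
        (\<Sum>i\<in>R. to_ac (u ^ idx i) * restrict (\<lambda>x. x) R i)"
      by (simp_all add: e_def)
    then have "restrict \<sigma> R r = restrict (\<lambda>x. x) R r" using u[OF V _ r] by blast
    then show "\<sigma> r = r" using r by simp
  qed
  ultimately show ?thesis using eN by blast
qed

section \<open>Finite separable extensions\<close>

lemma vector_space_ac_scale: "vector_space (ac_scale :: 'a::field \<Rightarrow> _)"
  by unfold_locales (simp_all add: ac_scale_def algebra_simps)

lemma finite_separable_extension_kadj:
  fixes e :: "'a::field alg_closure"
  assumes "separable_element e" shows "finite_separable_extension (kadj e)"
proof -
  interpret ac: vector_space "ac_scale :: 'a \<Rightarrow> 'a alg_closure \<Rightarrow> 'a alg_closure"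
    by (rule vector_space_ac_scale)
  note k = subring_over_range_to_ac
  obtain p :: "'a poly" where p: "p \<noteq> 0" "poly (map_poly to_ac p) e = 0" by (rule alg_closure_algebraic)
  have deg: "degree (map_poly to_ac p) > 0" using p by (intro degree_pos_if_root[of _ e]) simp_all
  define B where "B = (\<lambda>i. e ^ i) ` {..<degree p}"
  have "ac.span B = kadj e"
  proof
    have "B \<subseteq> kadj e"
      unfolding B_def adjoin_def
      by (intro image_subsetI CollectI exI[of _ "monom 1 _"] conjI polys_over_monom[OF k] subring_1[OF k])
         (simp add: poly_monom)
    moreover have "ac.subspace (kadj e)"
      unfolding ac.subspace_def ac_scale_def
      by (intro conjI ballI allI subring_0 subring_add subring_mult subring_to_ac subring_over_kadj)
    ultimately show "ac.span B \<subseteq> kadj e" by (rule ac.span_minimal)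
    show "kadj e \<subseteq> ac.span B"
    proof
      fix y assume "y \<in> kadj e"
      then obtain h where h: "h \<in> polys_over (range to_ac)" "y = poly h e" unfolding adjoin_def by blast
      obtain r where r: "r \<in> polys_over (range to_ac)" "degree r < degree (map_poly to_ac p)"
          "map_poly to_ac p dvd h - r"
        by (rule polys_over_mod[OF k polys_over_map_to_ac[OF k] deg h(1)])
      obtain q where "h - r = map_poly to_ac p * q" using r(3) by (elim dvdE)
      then have "poly (h - r) e = 0" using p(2) by (simp only: poly_mult mult_zero_left)
      then have "y = poly r e" by (simp add: h(2))
      then have "y = (\<Sum>i\<le>degree r. coeff r i * e ^ i)" by (simp only: poly_altdef)
      moreover have "coeff r i * e ^ i \<in> ac.span B" if i: "i \<le> degree r" for i
      proof -
        obtain c where "coeff r i = to_ac c" using r(1) unfolding polys_over_def by blast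
        then have "coeff r i * e ^ i = ac_scale c (e ^ i)" by (simp add: ac_scale_def)
        moreover have "e ^ i \<in> B" using i r(2) by (auto simp: B_def)
        ultimately show ?thesis by (simp add: ac.span_scale ac.span_base)
      qed
      then have "(\<Sum>i\<le>degree r. coeff r i * e ^ i) \<in> ac.span B" by (intro ac.span_sum) simp
      ultimately show "y \<in> ac.span B" by simp
    qed
  qed
  moreover have "finite B" by (simp add: B_def)
  moreover have "field_extension (kadj e)"
    by (simp add: field_extension_iff_subring_over subring_over_kadj)
  ultimately show ?thesis
    unfolding finite_separable_extension_def using separable_kadj[OF assms] by blast
qed

lemma finite_separable_extension_simple:
  fixes L :: "'a::field alg_closure set"
  assumes inf: "infinite (UNIV :: 'a set)" and L: "finite_separable_extension L"
  obtains e where "separable_element e" "L = kadj e"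
proof -
  interpret ac: vector_space "ac_scale :: 'a \<Rightarrow> 'a alg_closure \<Rightarrow> 'a alg_closure"
    by (rule vector_space_ac_scale)
  obtain B where B: "finite B" "ac.span B = L" and sub: "subring_over L"
      and sep: "\<And>x. x \<in> L \<Longrightarrow> separable_element x"
    using L unfolding finite_separable_extension_def field_extension_iff_subring_over by blast
  have BL: "B \<subseteq> L" using B(2) ac.span_superset by blast
  have "separable_element r" if "r \<in> B" for r using that sep BL by blast
  from primitive_element[OF inf B(1) this]
  obtain e where e: "separable_element e" "B \<subseteq> kadj e" "\<forall>N. subring_over N \<and> B \<subseteq> N \<longrightarrow> e \<in> N"
    by blast
  have "ac.subspace (kadj e)"
    unfolding ac.subspace_def ac_scale_def
    by (intro conjI ballI allI subring_0 subring_add subring_mult subring_to_ac subring_over_kadj)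
  then have "L \<subseteq> kadj e" using ac.span_minimal[OF e(2)] B(2) by blast
  moreover have "kadj e \<subseteq> L" using e(3) sub BL by (intro kadj_least) blast+
  ultimately show ?thesis using that e(1) by blast
qed

section \<open>Automorphisms of an extension as restrictions of elements of
  \<open>gal\<close>\<close>

lemma field_auts_extend:
  assumes E: "subring_over E" and r: "\<rho> \<in> field_auts E"
  obtains \<sigma> where "\<sigma> \<in> gal" "\<And>x. x \<in> E \<Longrightarrow> \<sigma> x = \<rho> x"
proof -
  have hom: "\<rho> (x + y) = \<rho> x + \<rho> y" "\<rho> (x * y) = \<rho> x * \<rho> y" if "x \<in> E" "y \<in> E" for x y
    using r that unfolding field_auts_def by blast+
  have const: "\<rho> (to_ac c) = to_ac c" for c using r unfolding field_auts_def by blast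
  have diff: "\<rho> (x - y) = \<rho> x - \<rho> y" if "x \<in> E" "y \<in> E" for x y
    using hom(1)[OF subring_diff[OF E that] that(2)] by simp
  let ?H = "(\<lambda>x. (x, \<rho> x)) ` E"
  have HI: "(x, y) \<in> ?H \<longleftrightarrow> x \<in> E \<and> y = \<rho> x" for x y by blast
  have "hom_graph ?H"
    unfolding hom_graph_def HI
  proof (intro conjI allI impI)
    show "to_ac c \<in> E" for c by (rule subring_to_ac[OF E])
    show "to_ac c = \<rho> (to_ac c)" for c by (simp add: const)
    show "y = 0" if "0 \<in> E \<and> y = \<rho> 0" for y using that const[of 0] by simp
  qed (auto simp: hom diff subring_add[OF E] subring_diff[OF E] subring_mult[OF E])
  then obtain \<sigma> where "\<sigma> \<in> gal" "\<And>x y. (x, y) \<in> ?H \<Longrightarrow> \<sigma> x = y"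
    by (rule hom_graph_extends_to_gal) blast
  then show ?thesis using that by blast
qed

lemma field_auts_restrict:
  assumes E: "subring_over E" and s: "\<sigma> \<in> gal" "\<sigma> ` E = E"
  shows "restrict \<sigma> E \<in> field_auts E"
proof -
  have "bij_betw \<sigma> E E"
    unfolding bij_betw_def using s gal_inj[OF s(1)] by (auto simp: inj_on_def)
  then have "restrict \<sigma> E \<in> Bij E" by (simp add: Bij_def)
  then show ?thesis
    unfolding field_auts_def
    using E by (simp add: subring_add subring_mult subring_to_ac s(1) rhom.hom_add[OF rhom_gal[OF s(1)]]
        rhom.hom_mult[OF rhom_gal[OF s(1)]])
qed

section \<open>Polynomial functions\<close>

text \<open>Constants are confined to k, so these functions commute with \<open>gal\<close> acting
  on all coordinates at once (\<open>PF_gal\<close>). The index type is arbitrary; each function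
  involves finitely many coordinates by construction.\<close>

inductive_set PF :: "(('i \<Rightarrow> 'a::field alg_closure) \<Rightarrow> 'a alg_closure) set" where
  PF_const: "(\<lambda>_. to_ac c) \<in> PF"
| PF_coord: "(\<lambda>v. v i) \<in> PF"
| PF_add: "F \<in> PF \<Longrightarrow> G \<in> PF \<Longrightarrow> (\<lambda>v. F v + G v) \<in> PF"
| PF_mult: "F \<in> PF \<Longrightarrow> G \<in> PF \<Longrightarrow> (\<lambda>v. F v * G v) \<in> PF"

lemma PF_0: "(\<lambda>_. 0) \<in> PF" and PF_1: "(\<lambda>_. 1) \<in> PF"
  using PF_const[of 0] PF_const[of 1] by simp_all

lemma PF_uminus: assumes "F \<in> PF" shows "(\<lambda>v. - F v) \<in> PF"
  using PF_mult[OF PF_const[of "- 1"] assms] by simp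

lemma PF_diff: "F \<in> PF \<Longrightarrow> G \<in> PF \<Longrightarrow> (\<lambda>v. F v - G v) \<in> PF"
  using PF_add[of F "\<lambda>v. - G v"] PF_uminus[of G] by simp

lemma PF_sum: "(\<And>i. i \<in> A \<Longrightarrow> F i \<in> PF) \<Longrightarrow> (\<lambda>v. \<Sum>i\<in>A. F i v) \<in> PF"
  by (induction A rule: infinite_finite_induct) (simp_all add: PF_0 PF_add)

lemma PF_prod: "(\<And>i. i \<in> A \<Longrightarrow> F i \<in> PF) \<Longrightarrow> (\<lambda>v. \<Prod>i\<in>A. F i v) \<in> PF"
  by (induction A rule: infinite_finite_induct) (simp_all add: PF_1 PF_mult)

lemma PF_power: "F \<in> PF \<Longrightarrow> (\<lambda>v. F v ^ n) \<in> PF"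
  by (induction n) (simp_all add: PF_1 PF_mult)

lemma PF_gal: "F \<in> PF \<Longrightarrow> \<sigma> \<in> gal \<Longrightarrow> \<sigma> (F v) = F (\<lambda>i. \<sigma> (v i))"
  by (induction rule: PF.induct) (simp_all add: rhom.hom_add[OF rhom_gal] rhom.hom_mult[OF rhom_gal])

lemma PF_subst: "F \<in> PF \<Longrightarrow> (\<And>i. (\<lambda>w. u w i) \<in> PF) \<Longrightarrow> (\<lambda>w. F (u w)) \<in> PF"
  by (induction rule: PF.induct) (simp_all add: PF_const PF_add PF_mult)

text \<open>Polynomials in one further variable with coefficients in \<open>PF\<close>. The degree
  bound is uniform in \<open>v\<close>, so that evaluation is one fixed finite sum of polynomial
  functions.\<close>

definition SP :: "(('i \<Rightarrow> 'a::field alg_closure) \<Rightarrow> 'a alg_closure poly) set" where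
  "SP = {P. (\<exists>d. \<forall>v. degree (P v) \<le> d) \<and> (\<forall>i. (\<lambda>v. coeff (P v) i) \<in> PF)}"

lemma SP_coeff: "P \<in> SP \<Longrightarrow> (\<lambda>v. coeff (P v) i) \<in> PF"
  by (simp add: SP_def)

lemma SP_degree: assumes "P \<in> SP" obtains d where "\<And>v. degree (P v) \<le> d"
  using assms unfolding SP_def by blast

lemma SPI: "(\<And>v. degree (P v) \<le> d) \<Longrightarrow> (\<And>i. (\<lambda>v. coeff (P v) i) \<in> PF) \<Longrightarrow> P \<in> SP"
  unfolding SP_def by blast

lemma SP_const: assumes "F \<in> PF" shows "(\<lambda>v. [:F v:]) \<in> SP"
proof (rule SPI)
  show "(\<lambda>v. coeff [:F v:] i) \<in> PF" for i
    by (cases i) (simp_all add: assms PF_0)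
qed simp

lemma SP_map_to_ac: "(\<lambda>_. map_poly to_ac p) \<in> SP"
  by (rule SPI[where d = "degree p"]) (simp_all add: rhom.coeff_hom[OF rhom_to_ac] PF_const)

lemma SP_monom: assumes "F \<in> PF" shows "(\<lambda>v. monom (F v) n) \<in> SP"
proof (rule SPI[where d = n])
  show "(\<lambda>v. coeff (monom (F v) n) i) \<in> PF" for i
    by (cases "i = n") (simp_all add: assms PF_0)
qed (rule degree_monom_le)

lemma SP_X: "(\<lambda>_. [:0, 1:]) \<in> SP"
  using SP_monom[OF PF_1, of "Suc 0"] by (simp add: monom_Suc monom_0)

lemma SP_add: assumes "P \<in> SP" "Q \<in> SP" shows "(\<lambda>v. P v + Q v) \<in> SP"
proof -
  obtain d e where "degree (P v) \<le> d" "degree (Q v) \<le> e" for v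
    using SP_degree assms by metis
  then have "degree (P v + Q v) \<le> max d e" for v
    by (meson degree_add_le max.cobounded1 max.cobounded2 order.trans)
  then show ?thesis
    by (rule SPI) (simp add: PF_add SP_coeff assms)
qed

lemma SP_diff: assumes "P \<in> SP" "Q \<in> SP" shows "(\<lambda>v. P v - Q v) \<in> SP"
proof -
  obtain d e where "degree (P v) \<le> d" "degree (Q v) \<le> e" for v
    using SP_degree assms by metis
  then have "degree (P v - Q v) \<le> max d e" for v
    by (meson degree_diff_le max.cobounded1 max.cobounded2 order.trans)
  then show ?thesis
    by (rule SPI) (simp add: PF_diff SP_coeff assms)
qed

lemma SP_mult: assumes "P \<in> SP" "Q \<in> SP" shows "(\<lambda>v. P v * Q v) \<in> SP"
proof -
  obtain d e where "degree (P v) \<le> d" "degree (Q v) \<le> e" for v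
    using SP_degree assms by metis
  then have "degree (P v * Q v) \<le> d + e" for v
    by (meson degree_mult_le add_mono order.trans)
  then show ?thesis
    by (rule SPI) (simp add: coeff_mult PF_sum PF_mult SP_coeff assms)
qed

lemma SP_sum: "(\<And>i. i \<in> A \<Longrightarrow> P i \<in> SP) \<Longrightarrow> (\<lambda>v. \<Sum>i\<in>A. P i v) \<in> SP"
  by (induction A rule: infinite_finite_induct) (use SP_const[OF PF_0] in \<open>simp_all add: SP_add\<close>)

lemma SP_pderiv: assumes "P \<in> SP" shows "(\<lambda>v. pderiv (P v)) \<in> SP"
proof -
  obtain d where "degree (P v) \<le> d" for v using SP_degree assms by metis
  then have "coeff (P v) (Suc i) = 0" if "d < i" for v i
    using that by (intro coeff_eq_0) (meson le_less_trans less_SucI)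
  then have "degree (pderiv (P v)) \<le> d" for v
    by (intro degree_le) (simp add: coeff_pderiv)
  then show ?thesis
  proof (rule SPI)
    show "(\<lambda>v. coeff (pderiv (P v)) i) \<in> PF" for i
      unfolding coeff_pderiv using PF_mult[OF PF_const[of "of_nat (Suc i)"] SP_coeff[OF assms]]
      by (simp only: to_ac_of_nat)
  qed
qed

lemma poly_altdef_le: "degree (p :: 'b::idom poly) \<le> d \<Longrightarrow> poly p x = (\<Sum>i\<le>d. coeff p i * x ^ i)"
  unfolding poly_altdef by (rule sum.mono_neutral_left) (auto simp: coeff_eq_0)

lemma SP_poly: assumes "P \<in> SP" "F \<in> PF" shows "(\<lambda>v. poly (P v) (F v)) \<in> PF"
proof -
  obtain d where d: "degree (P v) \<le> d" for v using SP_degree assms by metis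
  show ?thesis
    unfolding poly_altdef_le[OF d] by (intro PF_sum PF_mult PF_power SP_coeff assms)
qed

lemma SP_poly_shift: assumes "P \<in> SP" shows "(\<lambda>v. poly_shift n (P v)) \<in> SP"
proof -
  obtain d where d: "degree (P v) \<le> d" for v using SP_degree assms by metis
  have "degree (poly_shift n (P v)) \<le> d" for v
    using d[of v] by (intro degree_le) (auto simp: coeff_poly_shift intro!: coeff_eq_0)
  then show ?thesis by (rule SPI) (simp add: coeff_poly_shift SP_coeff assms)
qed

text \<open>Horner's scheme. It exhibits the coefficients of the quotient by X - c as polynomials in
  \<open>c\<close> and the coefficients of \<open>p\<close>.\<close>

lemma coeff_synthetic_div: "coeff (synthetic_div p c) i = poly (poly_shift (Suc i) p) c"
proof (induction p arbitrary: i)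
  case (pCons a p)
  have "poly_shift (Suc i) (pCons a p) = poly_shift i p" for i
    by (rule poly_eqI) (simp add: coeff_poly_shift)
  then show ?case using pCons.IH by (simp add: coeff_pCons split: nat.split)
qed simp

lemma SP_synthetic_div:
  assumes "P \<in> SP" "F \<in> PF" shows "(\<lambda>v. synthetic_div (P v) (F v)) \<in> SP"
proof -
  obtain d where d: "degree (P v) \<le> d" for v using SP_degree assms by metis
  show ?thesis
  proof (rule SPI[where d = d])
    show "degree (synthetic_div (P v) (F v)) \<le> d" for v using d[of v] by (simp add: degree_synthetic_div)
    show "(\<lambda>v. coeff (synthetic_div (P v) (F v)) i) \<in> PF" for i
      unfolding coeff_synthetic_div by (rule SP_poly[OF SP_poly_shift[OF assms(1)] assms(2)])
  qed
qed

lemma SP_subst: assumes "P \<in> SP" "\<And>i. (\<lambda>w. u w i) \<in> PF" shows "(\<lambda>w. P (u w)) \<in> SP"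
proof -
  obtain d where d: "degree (P v) \<le> d" for v using SP_degree assms(1) by metis
  then show ?thesis by (rule SPI) (rule PF_subst[OF SP_coeff[OF assms(1)] assms(2)])
qed

lemma PF_as_SP:
  assumes "F \<in> PF" "\<And>i. u i \<in> SP"
  shows "\<exists>Q\<in>SP. \<forall>w x. poly (Q w) x = F (\<lambda>i. poly (u i w) x)"
  using assms(1)
proof (induction rule: PF.induct)
  case (PF_const c)
  show ?case by (rule bexI[OF _ SP_const[OF PF.PF_const[of c]]]) simp
next
  case (PF_coord i)
  show ?case by (rule bexI[OF _ assms(2)[of i]]) simp
next
  case (PF_add F G)
  then obtain P Q where "P \<in> SP" "Q \<in> SP" "\<And>w x. poly (P w) x = F (\<lambda>i. poly (u i w) x)"
    "\<And>w x. poly (Q w) x = G (\<lambda>i. poly (u i w) x)" by blast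
  then show ?case by (intro bexI[of _ "\<lambda>w. P w + Q w"]) (simp_all add: SP_add)
next
  case (PF_mult F G)
  then obtain P Q where "P \<in> SP" "Q \<in> SP" "\<And>w x. poly (P w) x = F (\<lambda>i. poly (u i w) x)"
    "\<And>w x. poly (Q w) x = G (\<lambda>i. poly (u i w) x)" by blast
  then show ?case by (intro bexI[of _ "\<lambda>w. P w * Q w"]) (simp_all add: SP_mult)
qed

text \<open>Division by a monic polynomial creates no denominators. The remainders of the powers of
  X are obtained recursively: multiply by X, then subtract the top coefficient times
  \<open>M v\<close>.\<close>

lemma SP_mod:
  assumes "P \<in> SP" "M \<in> SP" and M: "\<And>v. degree (M v) = e" "\<And>v. lead_coeff (M v) = 1" and e: "e > 0"
  shows "(\<lambda>v. P v mod M v) \<in> SP"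
proof -
  have pw: "(\<lambda>v. monom 1 n mod M v) \<in> SP" for n
  proof (induction n)
    case 0
    have "monom 1 0 mod M v = [:1:]" for v
      using e M(1)[of v] by (simp add: mod_poly_less monom_0)
    then show ?case using SP_const[OF PF_1] by simp
  next
    case (Suc n)
    define R where "R v = [:0, 1:] * (monom 1 n mod M v)" for v
    define R' where "R' v = R v - [:coeff (R v) e:] * M v" for v
    have RSP: "R \<in> SP" unfolding R_def using Suc.IH by (intro SP_mult SP_X)
    then have R'SP: "R' \<in> SP" unfolding R'_def by (intro SP_diff SP_mult SP_const SP_coeff assms)
    have "monom 1 (Suc n) mod M v = R' v" for v
    proof -
      have M0: "M v \<noteq> 0" using M(1)[of v] e by auto
      have "monom 1 (Suc n) = [:0, 1:] * monom (1 :: 'b alg_closure) n" by (simp add: monom_Suc)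
      then have "monom 1 (Suc n) mod M v = R v mod M v" by (simp only: R_def mod_mult_right_eq)
      also have "\<dots> = R' v mod M v" unfolding R'_def poly_mod_diff_left by (simp add: mod_smult_left)
      also have "\<dots> = R' v"
      proof (rule mod_poly_less)
        have "degree (monom 1 n mod M v) < e"
          using degree_mod_less[OF M0, of "monom 1 n"] e M(1)[of v] by auto
        then have "degree (R v) \<le> e" unfolding R_def by simp
        moreover have "degree ([:coeff (R v) e:] * M v) \<le> e"
          using M(1)[of v] by simp
        ultimately have "degree (R' v) \<le> e" unfolding R'_def by (rule degree_diff_le)
        moreover have "coeff (R' v) e = 0"
          using M(1,2)[of v] by (simp add: R'_def)
        ultimately have "degree (R' v) < e"
          using e by (metis degree_0 le_neq_implies_less leading_coeff_0_iff)
        then show "degree (R' v) < degree (M v)" by (simp add: M(1))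
      qed
      finally show ?thesis .
    qed
    then show ?case using R'SP by simp
  qed
  obtain d where d: "degree (P v) \<le> d" for v using SP_degree assms(1) by metis
  have "P v mod M v = (\<Sum>i\<le>d. [:coeff (P v) i:] * (monom 1 i mod M v))" for v
  proof -
    have "P v = (\<Sum>i\<le>d. [:coeff (P v) i:] * monom 1 i)"
      using poly_as_sum_of_monoms'[OF d[of v]] by (simp add: smult_monom)
    then have "P v mod M v = (\<Sum>i\<le>d. [:coeff (P v) i:] * monom 1 i) mod M v" by simp
    also have "\<dots> = (\<Sum>i\<le>d. ([:coeff (P v) i:] * monom 1 i) mod M v)"
      by (induction d) (simp_all add: poly_mod_add_left)
    finally show ?thesis by (simp add: mod_smult_left)
  qed
  then show ?thesis by (simp only:) (intro SP_sum SP_mult SP_const SP_coeff assms pw)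
qed

section \<open>Functions that are polynomial along lines\<close>

text \<open>Weaker than being polynomial, but closed under the same operations. In contrast to
  \<open>PF\<close> the constants are arbitrary elements of the field, so algebraic elements may
  occur as coefficients.\<close>

definition LP :: "(('i \<Rightarrow> 'b::field) \<Rightarrow> 'b) set" where
  "LP = {F. \<forall>u w. \<exists>p. \<forall>x. F (\<lambda>i. u i + x * (w i - u i)) = poly p x}"

lemma LP_const: "(\<lambda>_. c) \<in> LP"
  unfolding LP_def by (intro CollectI allI exI[of _ "[:c:]"]) simp

lemma LP_coord: "(\<lambda>v. v i) \<in> LP"
  unfolding LP_def
proof (intro CollectI allI exI)
  show "u i + x * (w i - u i) = poly [:u i, w i - u i:] x" for u w :: "'a \<Rightarrow> 'b" and x
    by simp
qed

lemma LP_add: "F \<in> LP \<Longrightarrow> G \<in> LP \<Longrightarrow> (\<lambda>v. F v + G v) \<in> LP"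
  unfolding LP_def by (auto, metis poly_add)

lemma LP_mult: "F \<in> LP \<Longrightarrow> G \<in> LP \<Longrightarrow> (\<lambda>v. F v * G v) \<in> LP"
  unfolding LP_def by (auto, metis poly_mult)

lemma LP_diff: "F \<in> LP \<Longrightarrow> G \<in> LP \<Longrightarrow> (\<lambda>v. F v - G v) \<in> LP"
  unfolding LP_def by (auto, metis poly_diff)

lemma LP_sum: "(\<And>i. i \<in> A \<Longrightarrow> F i \<in> LP) \<Longrightarrow> (\<lambda>v. \<Sum>i\<in>A. F i v) \<in> LP"
  by (induction A rule: infinite_finite_induct) (simp_all add: LP_const LP_add)

lemma LP_prod: "(\<And>i. i \<in> A \<Longrightarrow> F i \<in> LP) \<Longrightarrow> (\<lambda>v. \<Prod>i\<in>A. F i v) \<in> LP"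
  by (induction A rule: infinite_finite_induct) (simp_all add: LP_const LP_mult)

lemma LP_power: "F \<in> LP \<Longrightarrow> (\<lambda>v. F v ^ n) \<in> LP"
  by (induction n) (simp_all add: LP_const LP_mult)

lemma LP_PF: "F \<in> PF \<Longrightarrow> (\<And>i. (\<lambda>w. u w i) \<in> LP) \<Longrightarrow> (\<lambda>w. F (u w)) \<in> LP"
  by (induction rule: PF.induct) (simp_all add: LP_const LP_add LP_mult)

lemma PF_imp_LP: "F \<in> PF \<Longrightarrow> F \<in> LP"
  by (rule LP_PF[of F "\<lambda>w. w"]) (simp_all add: LP_coord)

lemma LP_poly_prod:
  assumes "finite A" "\<And>a i. a \<in> A \<Longrightarrow> (\<lambda>v. coeff (P a v) i) \<in> LP"
  shows "(\<lambda>v. coeff (\<Prod>a\<in>A. P a v) i) \<in> LP"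
  using assms
proof (induction A arbitrary: i)
  case empty
  show ?case by (simp add: LP_const)
next
  case (insert a A)
  then show ?case by (simp add: coeff_mult) (intro LP_sum LP_mult; simp)
qed

lemma infinite_UNIV_alg_closed: "infinite (UNIV :: 'b::alg_closed_field set)"
proof
  assume fin: "finite (UNIV :: 'b set)"
  define p where "p = (\<Prod>a\<in>(UNIV :: 'b set). [:- a, 1:]) + 1"
  have px: "poly p x = 1" for x
    using fin poly_prod_linear_eq_0_iff[OF fin, of x] by (simp add: p_def)
  then have "degree p = 0" using alg_closed_imp_poly_has_root[of p] by fastforce
  then obtain c where c: "p = [:c:]" by (rule degree_eq_zeroE)
  with px[of 0] have "p = 1" by simp
  then have "(\<Prod>a\<in>(UNIV :: 'b set). [:- a, 1:]) = 0" by (simp add: p_def)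
  then show False using fin by simp
qed

text \<open>Restricting to the line through \<open>u\<close> and \<open>w\<close> reduces the absence of zero divisors to univariate
  polynomials.\<close>

lemma LP_domain:
  fixes F G :: "('i \<Rightarrow> 'b::alg_closed_field) \<Rightarrow> 'b"
  assumes "F \<in> LP" "G \<in> LP" and FG: "\<And>v. F v * G v = 0" and "F u \<noteq> 0"
  shows "G w = 0"
proof (rule ccontr)
  assume w: "G w \<noteq> 0"
  obtain p q where p: "\<And>x. F (\<lambda>i. u i + x * (w i - u i)) = poly p x"
    and q: "\<And>x. G (\<lambda>i. u i + x * (w i - u i)) = poly q x"
    using assms(1,2) unfolding LP_def by blast
  have "poly p 0 \<noteq> 0" using p[of 0] assms(4) by simp
  moreover have "poly q 1 \<noteq> 0" using q[of 1] w by simp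
  ultimately have "p * q \<noteq> 0" by auto
  then have "finite {x. poly (p * q) x = 0}" by (rule poly_roots_finite)
  moreover have "poly (p * q) x = 0" for x
    using FG[of "\<lambda>i. u i + x * (w i - u i)"] by (simp add: p q)
  then have "{x. poly (p * q) x = 0} = UNIV" by blast
  ultimately show False using infinite_UNIV_alg_closed[where 'b = 'b] by (simp only:)
qed

section \<open>Norms\<close>

abbreviation root_prod :: "'b::comm_ring_1 list \<Rightarrow> 'b poly" where
  "root_prod rs \<equiv> \<Prod>r\<leftarrow>rs. [:- r, 1:]"

lemma root_prod_monic:
  "degree (root_prod (rs :: 'b::idom list)) = length rs \<and> lead_coeff (root_prod rs) = 1"
proof (induction rs)
  case (Cons r rs)
  then have "root_prod rs \<noteq> 0" by auto
  then have deg: "degree (root_prod (r # rs)) = Suc (length rs)"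
    using Cons by (simp add: degree_mult_eq del: mult_pCons_left)
  have "lead_coeff ([:- r, 1:] * root_prod rs) = lead_coeff [:- r, 1:] * lead_coeff (root_prod rs)"
    by (rule lead_coeff_mult)
  moreover have "lead_coeff [:- r, 1:] = 1" by simp
  ultimately have "lead_coeff (root_prod (r # rs)) = 1"
    using conjunct2[OF Cons.IH] by (simp only: list.map prod_list.Cons mult_1)
  then show ?case using deg by simp
qed simp

lemma poly_root_prod: "poly (root_prod rs) x = (\<Prod>r\<leftarrow>rs. x - r)"
  by (induction rs) (simp_all add: algebra_simps)

lemma prod_list_map_remove1:
  fixes f :: "'b \<Rightarrow> 'c::comm_monoid_mult"
  shows "r \<in> set rs \<Longrightarrow> (\<Prod>r\<leftarrow>rs. f r) = f r * (\<Prod>r\<leftarrow>remove1 r rs. f r)"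
  by (induction rs) (auto simp: mult.left_commute)

lemma poly_root_prod_eq_0_iff: "poly (root_prod (rs :: 'b::idom list)) x = 0 \<longleftrightarrow> x \<in> set rs"
  unfolding poly_root_prod by (induction rs) auto

lemma root_prod_remove1:
  assumes "r \<in> set rs" shows "root_prod rs = [:- r, 1:] * root_prod (remove1 r rs)"
  using assms by (rule prod_list_map_remove1)

lemma synthetic_div_root_prod:
  fixes r :: "'b::idom"
  assumes "r \<in> set rs" shows "synthetic_div (root_prod rs) r = root_prod (remove1 r rs)"
proof -
  have "[:- r, 1:] * synthetic_div (root_prod rs) r = root_prod rs"
    using synthetic_div_correct'[of r "root_prod rs"] poly_root_prod_eq_0_iff[of rs r] assms by simp
  then have "[:- r, 1:] * synthetic_div (root_prod rs) r = [:- r, 1:] * root_prod (remove1 r rs)"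
    by (simp only: root_prod_remove1[OF assms])
  then show ?thesis by (simp only: mult_cancel_left) simp
qed

text \<open>The norm of \<open>P\<close> with respect to one root \<open>r\<close> is \<open>P(r)\<close> times a universal expression in the
  coefficients of the quotient by \<open>X - r\<close>, hence a polynomial in \<open>r\<close>. Reduced modulo the given
  polynomial it takes the same value at all roots, so if these are distinct it is constant. The
  general case follows by density.\<close>

lemma norm_universal:
  fixes P :: "('i \<Rightarrow> 'a::field alg_closure) \<Rightarrow> 'a alg_closure poly"
  assumes P: "P \<in> SP"
  shows "\<exists>N\<in>PF. \<forall>v rs. length rs = e \<longrightarrow>
    N (case_sum v (\<lambda>i. coeff (root_prod rs) i)) = (\<Prod>r\<leftarrow>rs. poly (P v) r)"
proof (induction e)
  case 0
  show ?case by (rule bexI[OF _ PF_1]) simp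
next
  case (Suc e)
  then obtain N where N: "N \<in> PF" "\<And>v rs. length rs = e \<Longrightarrow>
      N (case_sum v (\<lambda>i. coeff (root_prod rs) i)) = (\<Prod>r\<leftarrow>rs. poly (P v) r)" by blast
  \<comment> \<open>The generic monic polynomial of degree \<open>Suc e\<close>: the coordinates
    \<open>Inr i\<close> are its lower coefficients, the coordinates \<open>Inl\<close> belong to
    \<open>v\<close>.\<close>
  define M where "M w = monom 1 (Suc e) + (\<Sum>i\<le>e. monom (w (Inr i)) i)" for w :: "'i + nat \<Rightarrow> 'a alg_closure"
  have MSP: "M \<in> SP" unfolding M_def by (intro SP_add SP_sum SP_monom PF_1 PF_coord)
  have Mc: "coeff (M w) i = (if i = Suc e then 1 else if i \<le> e then w (Inr i) else 0)" for w i
    by (simp add: M_def coeff_sum)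
  have Mdeg: "degree (M w) = Suc e" for w
    by (rule antisym[OF degree_le le_degree]) (simp_all add: Mc)
  have Mlc: "lead_coeff (M w) = 1" for w unfolding Mdeg by (simp add: Mc)
  have Mroot: "M (case_sum v (\<lambda>i. coeff (root_prod rs) i)) = root_prod rs"
    if "length rs = Suc e" for v and rs :: "'a alg_closure list"
  proof (rule poly_eqI)
    have deg: "degree (root_prod rs) = Suc e" using root_prod_monic[of rs] that by simp
    moreover have "coeff (root_prod rs) (Suc e) = 1"
      using conjunct2[OF root_prod_monic[of rs]] unfolding deg .
    ultimately show "coeff (M (case_sum v (\<lambda>i. coeff (root_prod rs) i))) i = coeff (root_prod rs) i" for i
      by (simp add: Mc coeff_eq_0)
  qed
  \<comment> \<open>Substituting these polynomials and evaluating at \<open>x\<close> replaces the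
    coefficients of \<open>M w\<close> by those of its quotient by X - x. So \<open>Q0 w\<close> at
    a root \<open>r\<close> is the product over the remaining roots, by the induction
    hypothesis.\<close>
  define u where "u i w = (case i of Inl i \<Rightarrow> [:w (Inl i):] | Inr j \<Rightarrow> poly_shift (Suc j) (M w))" for i w
  have uSP: "u i \<in> SP" for i
  proof (cases i)
    case (Inl a)
    then have "u i = (\<lambda>w. [:w (Inl a):])" by (simp add: u_def fun_eq_iff)
    then show ?thesis by (simp only: SP_const PF_coord)
  next
    case (Inr j)
    then have "u i = (\<lambda>w. poly_shift (Suc j) (M w))" by (simp add: u_def fun_eq_iff)
    then show ?thesis by (simp only: SP_poly_shift MSP)
  qed
  obtain Q0 where Q0: "Q0 \<in> SP" "\<And>w x. poly (Q0 w) x = N (\<lambda>i. poly (u i w) x)"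
    using PF_as_SP[where u = u, OF N(1) uSP] by blast
  define Q where "Q w = P (\<lambda>i. w (Inl i)) * Q0 w" for w
  have QSP: "Q \<in> SP"
    unfolding Q_def by (intro SP_mult Q0(1) SP_subst[OF P] PF_coord)
  define R where "R w = Q w mod M w" for w
  have RSP: "R \<in> SP" unfolding R_def by (rule SP_mod[OF QSP MSP Mdeg Mlc]) simp
  define N' where "N' w = coeff (R w) 0" for w
  have N'PF: "N' \<in> PF" unfolding N'_def by (rule SP_coeff[OF RSP])
  have dist: "N' (case_sum v (\<lambda>i. coeff (root_prod rs) i)) = (\<Prod>r\<leftarrow>rs. poly (P v) r)"
    if rs: "length rs = Suc e" "distinct rs" for v rs
  proof -
    define w where "w = case_sum v (\<lambda>i. coeff (root_prod rs) i)"
    define H where "H = (\<Prod>r\<leftarrow>rs. poly (P v) r)"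
    have Mw: "M w = root_prod rs" unfolding w_def by (rule Mroot[OF rs(1)])
    have Rr: "poly (R w) r = H" if r: "r \<in> set rs" for r
    proof -
      have "poly (u i w) r = case_sum v (\<lambda>i. coeff (root_prod (remove1 r rs)) i) i" for i
        by (cases i) (simp_all add: u_def w_def[symmetric] Mw synthetic_div_root_prod[OF r]
            flip: coeff_synthetic_div, simp add: w_def)
      then have "poly (Q0 w) r = (\<Prod>r\<leftarrow>remove1 r rs. poly (P v) r)"
        unfolding Q0(2) using N(2)[of "remove1 r rs" v] rs(1) r by (simp add: length_remove1)
      then have "poly (Q w) r = H"
        unfolding H_def prod_list_map_remove1[OF r, of "poly (P v)"] by (simp add: Q_def w_def)
      moreover have "Q w = Q w div M w * M w + R w" unfolding R_def by simp
      then have "poly (Q w) r = poly (Q w div M w) r * poly (M w) r + poly (R w) r"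
        by (metis poly_add poly_mult)
      moreover have "poly (M w) r = 0" using r by (simp add: Mw poly_root_prod_eq_0_iff)
      ultimately show ?thesis by simp
    qed
    \<comment> \<open>There are \<open>Suc e\<close> distinct roots \<open>rs\<close>, but the
      degree is at most \<open>e\<close>.\<close>
    have "R w - [:H:] = 0"
    proof (rule ccontr)
      assume ne: "R w - [:H:] \<noteq> 0"
      have "M w \<noteq> 0" using Mdeg[of w] by auto
      then have "degree (R w) < Suc e"
        using degree_mod_less[of "M w" "Q w"] Mdeg[of w] by (auto simp: R_def)
      then have "degree (R w - [:H:]) \<le> e" by (intro degree_diff_le) simp_all
      moreover have "set rs \<subseteq> {x. poly (R w - [:H:]) x = 0}" using Rr by auto
      then have "card (set rs) \<le> card {x. poly (R w - [:H:]) x = 0}"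
        by (rule card_mono[OF poly_roots_finite[OF ne]])
      moreover have "card {x. poly (R w - [:H:]) x = 0} \<le> degree (R w - [:H:])"
        by (rule card_poly_roots_bound[OF ne])
      ultimately show False using rs distinct_card[OF rs(2)] by simp
    qed
    then have "R w = [:H:]" by simp
    then have "N' w = H" by (simp add: N'_def)
    then show ?thesis by (simp only: w_def H_def)
  qed
  have "N' (case_sum v (\<lambda>i. coeff (root_prod rs) i)) = (\<Prod>r\<leftarrow>rs. poly (P v) r)"
    if rs: "length rs = Suc e" for v rs
  proof -
    \<comment> \<open>The roots are now treated as free variables: \<open>D\<close> is the defect of
      the formula and \<Delta> the Vandermonde product. Wherever \<Delta> is nonzero the roots are
      distinct and \<open>D\<close> vanishes, so the product is identically zero and hence
      \<open>D\<close> is.\<close>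
    define D where "D x = N' (case_sum v (\<lambda>i. coeff (\<Prod>j<Suc e. [:- x j, 1:]) i))
        - (\<Prod>j<Suc e. poly (P v) (x j))" for x :: "nat \<Rightarrow> 'a alg_closure"
    define \<Delta> where "\<Delta> x = (\<Prod>j<Suc e. \<Prod>i<j. x i - x j)" for x :: "nat \<Rightarrow> 'a alg_closure"
    have list: "(\<Prod>r\<leftarrow>map x [0..<Suc e]. f r) = (\<Prod>j<Suc e. f (x j))"
      for f :: "'a alg_closure \<Rightarrow> 'b::comm_monoid_mult" and x
      by (simp only: map_map comp_def prod.distinct_set_conv_list[symmetric, OF distinct_upt]
          set_upt atLeast0LessThan)
    have "D \<in> LP"
    proof -
      have lin: "(\<lambda>x. coeff [:- x j, 1:] i) \<in> LP" for i j :: nat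
      proof (cases i)
        case 0
        then show ?thesis using LP_diff[OF LP_const[of 0] LP_coord[of j]] by simp
      next
        case (Suc n)
        then show ?thesis by (simp add: LP_const)
      qed
      have "(\<lambda>x. case_sum v (\<lambda>i. coeff (\<Prod>j<Suc e. [:- x j, 1:]) i) k) \<in> LP" for k
        by (cases k) (simp add: LP_const, simp only: sum.case, rule LP_poly_prod, simp, rule lin)
      then have "(\<lambda>x. N' (case_sum v (\<lambda>i. coeff (\<Prod>j<Suc e. [:- x j, 1:]) i))) \<in> LP"
        by (rule LP_PF[OF N'PF])
      moreover have "(\<lambda>x. poly (P v) (x j)) \<in> LP" for j
        unfolding poly_altdef by (intro LP_sum LP_mult LP_const LP_power LP_coord)
      ultimately show ?thesis unfolding D_def by (intro LP_diff LP_prod)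
    qed
    moreover have "\<Delta> \<in> LP" unfolding \<Delta>_def by (intro LP_prod LP_diff LP_coord)
    moreover have "\<Delta> x * D x = 0" for x
    proof (cases "inj_on x {..<Suc e}")
      case True
      then have "distinct (map x [0..<Suc e])" by (simp only: distinct_map distinct_upt set_upt atLeast0LessThan)
      with dist[of "map x [0..<Suc e]" v] have "D x = 0"
        by (simp only: D_def list length_map length_upt minus_nat.diff_0 diff_self)
      then show ?thesis by simp
    next
      case False
      then obtain i j where ij: "i < Suc e" "j < Suc e" "i \<noteq> j" "x i = x j"
        unfolding inj_on_def by blast
      then obtain i j where ij: "j < Suc e" "i < j" "x i = x j"
        by (metis linorder_neqE_nat)
      then have z: "(\<Prod>i<j. x i - x j) = 0" by (intro prod_zero bexI[of _ i]) simp_all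
      have "\<Delta> x = 0" unfolding \<Delta>_def
        by (rule prod_zero[OF finite_lessThan], rule bexI[of _ j], rule z) (simp add: ij(1))
      then show ?thesis by simp
    qed
    moreover obtain x0 :: "nat \<Rightarrow> 'a alg_closure" where "inj x0"
      using infinite_countable_subset[OF infinite_UNIV_alg_closed] by blast
    then have "\<Delta> x0 \<noteq> 0" unfolding \<Delta>_def by (auto simp: inj_eq)
    ultimately have "D (\<lambda>j. rs ! j) = 0" using LP_domain by blast
    moreover have m: "map (\<lambda>j. rs ! j) [0..<Suc e] = rs" using rs by (metis map_nth)
    have "(\<Prod>j<Suc e. [:- rs ! j, 1:]) = root_prod rs"
      using list[of "\<lambda>r. [:- r, 1:]" "\<lambda>j. rs ! j"] unfolding m by (rule sym)
    moreover have "(\<Prod>j<Suc e. poly (P v) (rs ! j)) = (\<Prod>r\<leftarrow>rs. poly (P v) r)"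
      using list[of "poly (P v)" "\<lambda>j. rs ! j"] unfolding m by (rule sym)
    ultimately show ?thesis by (simp only: D_def right_minus_eq)
  qed
  then show ?case using N'PF by blast
qed

text \<open>The norm that eliminates a single coordinate \<open>j\<close> constrained by
  \<open>M\<close>. This is the single storey from which \<open>points_PF\<close> is built.\<close>

lemma norm_PF:
  fixes F :: "('i \<Rightarrow> 'a::field alg_closure) \<Rightarrow> 'a alg_closure"
  assumes F: "F \<in> PF" and M: "M \<in> SP" "\<And>v. degree (M v) = e"
  obtains N where "N \<in> PF" "\<And>v rs. M v = root_prod rs \<Longrightarrow> N v = (\<Prod>r\<leftarrow>rs. F (v(j := r)))"
proof -
  define u where "u i = (\<lambda>v :: 'i \<Rightarrow> 'a alg_closure. if i = j then [:0, 1:] else [:v i:])" for i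
  have "u i \<in> SP" for i by (cases "i = j") (simp_all add: u_def SP_X SP_const PF_coord)
  then obtain P where P: "P \<in> SP" "\<And>v x. poly (P v) x = F (\<lambda>i. poly (u i v) x)"
    using PF_as_SP[where u = u, OF F] by blast
  obtain N where N: "N \<in> PF" "\<And>v rs. length rs = e \<Longrightarrow>
      N (case_sum v (\<lambda>i. coeff (root_prod rs) i)) = (\<Prod>r\<leftarrow>rs. poly (P v) r)"
    using norm_universal[OF P(1), of e] by blast
  show ?thesis
  proof (rule that)
    have "(\<lambda>v. case_sum v (coeff (M v)) k) \<in> PF" for k
      by (cases k) (simp_all add: PF_coord SP_coeff M(1))
    then show "(\<lambda>v. N (case_sum v (coeff (M v)))) \<in> PF" by (rule PF_subst[OF N(1)])
    fix v rs assume rs: "M v = root_prod rs"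
    then have "length rs = e" using M(2)[of v] root_prod_monic[of rs] by simp
    moreover have "(\<lambda>i. poly (u i v) x) = v(j := x)" for x by (auto simp: u_def)
    ultimately show "N (case_sum v (coeff (M v))) = (\<Prod>r\<leftarrow>rs. F (v(j := r)))"
      using N(2)[of rs v] by (simp add: rs P(2))
  qed
qed

section \<open>Interpolation\<close>

definition lagrange :: "'b::field set \<Rightarrow> 'b \<Rightarrow> 'b poly" where
  "lagrange A a = (\<Prod>b\<in>A - {a}. smult (inverse (a - b)) [:- b, 1:])"

lemma poly_lagrange:
  assumes "finite A" "a \<in> A" "b \<in> A"
  shows "poly (lagrange A a) b = (if b = a then 1 else 0)"
proof (cases "b = a")
  case True
  have "poly (smult (inverse (a - c)) [:- c, 1:]) a = 1" if "c \<in> A - {a}" for c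
  proof -
    have "poly (smult (inverse (a - c)) [:- c, 1:]) a = inverse (a - c) * (a - c)"
      by (simp add: algebra_simps)
    also have "\<dots> = 1" using that by (intro field_class.field_inverse) auto
    finally show ?thesis .
  qed
  then show ?thesis using True by (simp add: lagrange_def poly_prod)
next
  case False
  then show ?thesis using assms by (auto simp: lagrange_def poly_prod)
qed

lemma degree_lagrange:
  assumes "finite A" "a \<in> A" shows "degree (lagrange A a) < card A"
proof -
  have "degree (lagrange A a) \<le> (\<Sum>b\<in>A - {a}. degree (smult (inverse (a - b)) [:- b, 1:]))"
    unfolding lagrange_def
    using degree_prod_sum_le[of "A - {a}" "\<lambda>b. smult (inverse (a - b)) [:- b, 1:]"] assms(1)
    by (simp only: finite_Diff comp_def)
  also have "\<dots> \<le> (\<Sum>b\<in>A - {a}. 1)" by (rule sum_mono) (simp add: degree_smult_le)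
  also have "\<dots> < card A"
  proof -
    have "card A > 0" using assms card_gt_0_iff by blast
    then show ?thesis using assms by simp
  qed
  finally show ?thesis .
qed

lemma poly_eq_if_agree:
  fixes p q :: "'b::field poly"
  assumes "degree p < card A" "degree q < card A" "\<And>a. a \<in> A \<Longrightarrow> poly p a = poly q a"
  shows "p = q"
proof (rule ccontr)
  assume "p \<noteq> q"
  then have ne: "p - q \<noteq> 0" by simp
  have "A \<subseteq> {x. poly (p - q) x = 0}" using assms(3) by auto
  then have "card A \<le> card {x. poly (p - q) x = 0}" by (rule card_mono[OF poly_roots_finite[OF ne]])
  also have "\<dots> \<le> degree (p - q)" by (rule card_poly_roots_bound[OF ne])
  also have "\<dots> < card A" using assms(1,2) by (rule degree_diff_less)
  finally show False by simp
qed

lemma lagrange_interpolation: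
  fixes p :: "'b::field poly"
  assumes "finite A" "degree p < card A"
  shows "p = (\<Sum>a\<in>A. smult (poly p a) (lagrange A a))"
proof (rule poly_eq_if_agree[OF assms(2)])
  have "card A > 0" using assms(2) by simp
  then show "degree (\<Sum>a\<in>A. smult (poly p a) (lagrange A a)) < card A"
    by (intro degree_sum_less) (auto intro: order.strict_trans1[OF degree_smult_le] degree_lagrange assms(1))
  fix b assume b: "b \<in> A"
  have "(\<Sum>a\<in>A. poly p a * poly (lagrange A a) b) = (\<Sum>a\<in>A. if a = b then poly p a else 0)"
    by (rule sum.cong) (use poly_lagrange[OF assms(1) _ b] in auto)
  then show "poly p b = poly (\<Sum>a\<in>A. smult (poly p a) (lagrange A a)) b"
    using b assms(1) by (simp add: poly_sum)
qed

text \<open>Interpolation at n + 1 nodes of k expresses each coefficient as a linear combination of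
  values with factors in k. It applies to the resolvent, whose values are norms while its
  coefficients are not directly accessible.\<close>

lemma SP_by_values:
  fixes P :: "('i \<Rightarrow> 'a::field alg_closure) \<Rightarrow> 'a alg_closure poly"
  assumes inf: "infinite (UNIV :: 'a set)" and deg: "\<And>v. degree (P v) \<le> n"
    and val: "\<And>c. (\<lambda>v. poly (P v) (to_ac c)) \<in> PF"
  shows "P \<in> SP"
proof -
  obtain A0 :: "'a set" where A0: "finite A0" "card A0 = Suc n"
    using infinite_arbitrarily_large[OF inf, of "Suc n"] by blast
  define A :: "'a alg_closure set" where "A = to_ac ` A0"
  have A: "finite A" "card A = Suc n"
    unfolding A_def using A0 by (simp_all add: card_image inj_on_subset[OF inj_to_ac])
  have lag: "lagrange A (to_ac a) = map_poly to_ac (lagrange A0 a)" if "a \<in> A0" for a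
  proof -
    have "A - {to_ac a} = to_ac ` (A0 - {a})" by (auto simp: A_def)
    then have "lagrange A (to_ac a) = (\<Prod>b\<in>A0 - {a}. smult (inverse (to_ac a - to_ac b)) [:- to_ac b, 1:])"
      unfolding lagrange_def by (simp add: prod.reindex inj_on_subset[OF inj_to_ac])
    also have "\<dots> = map_poly to_ac (lagrange A0 a)"
      unfolding lagrange_def rhom.hom_prod[OF rhom.map_poly_hom[OF rhom_to_ac]]
      by (rule prod.cong) (simp_all add: rhom.map_poly_hom_pCons[OF rhom_to_ac])
    finally show ?thesis .
  qed
  have "coeff (P v) i = (\<Sum>a\<in>A0. poly (P v) (to_ac a) * to_ac (coeff (lagrange A0 a) i))" for v i
  proof -
    have "P v = (\<Sum>a\<in>A. smult (poly (P v) a) (lagrange A a))"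
      using deg[of v] A by (intro lagrange_interpolation) simp_all
    also have "\<dots> = (\<Sum>a\<in>A0. smult (poly (P v) (to_ac a)) (lagrange A (to_ac a)))"
      unfolding A_def by (simp add: sum.reindex inj_on_subset[OF inj_to_ac])
    finally have "coeff (P v) i = coeff (\<Sum>a\<in>A0. smult (poly (P v) (to_ac a)) (lagrange A (to_ac a))) i"
      by simp
    also have "\<dots> = (\<Sum>a\<in>A0. poly (P v) (to_ac a) * to_ac (coeff (lagrange A0 a) i))"
      unfolding coeff_sum by (rule sum.cong) (simp_all add: lag rhom.coeff_hom[OF rhom_to_ac])
    finally show ?thesis .
  qed
  then have "(\<lambda>v. coeff (P v) i) \<in> PF" for i
    by (simp only:) (intro PF_sum PF_mult val PF_const)
  with deg show ?thesis by (rule SPI)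
qed

section \<open>Towers of polynomial equations\<close>

text \<open>The order of the roots is a choice depending on \<open>p\<close> alone; equal
  polynomials therefore give equal lists, as \<open>points_cong\<close> requires.\<close>

definition roots_of :: "'b::alg_closed_field poly \<Rightarrow> 'b list" where
  "roots_of p = (SOME rs. p = smult (lead_coeff p) (root_prod rs))"

lemma root_prod_roots_of:
  fixes p :: "'b::alg_closed_field poly"
  assumes "lead_coeff p = 1" shows "root_prod (roots_of p) = p"
proof -
  have "p \<noteq> 0" using assms by auto
  then obtain A where A: "p = smult (lead_coeff p) (\<Prod>x\<in>#A. [:- x, 1:])"
    using alg_closed_imp_factorization by blast
  obtain rs where "A = mset rs" by (metis ex_mset)
  then have "p = smult (lead_coeff p) (root_prod rs)"
    using A by (simp flip: prod_mset_prod_list)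
  then have "p = smult (lead_coeff p) (root_prod (roots_of p))"
    unfolding roots_of_def by (rule someI)
  then show ?thesis using assms by simp
qed

lemma length_roots_of: "lead_coeff p = 1 \<Longrightarrow> length (roots_of p) = degree p"
  using root_prod_monic[of "roots_of p"] by (simp add: root_prod_roots_of)

lemma set_roots_of: "lead_coeff p = 1 \<Longrightarrow> set (roots_of p) = {x. poly p x = 0}"
  using poly_root_prod_eq_0_iff[of "roots_of p"] by (auto simp: root_prod_roots_of)

lemma root_prod_double_root:
  fixes rs :: "'b::field list"
  assumes "r \<in> set rs"
  shows "poly (pderiv (root_prod rs)) r = 0 \<longleftrightarrow> r \<in> set (remove1 r rs)"
proof -
  have "poly (root_prod rs) r = 0" using assms by (simp add: poly_root_prod_eq_0_iff)
  then have "poly (pderiv (root_prod rs)) r = 0 \<longleftrightarrow> [:- r, 1:] ^ 2 dvd root_prod rs"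
    by (simp add: double_root_iff)
  also have "\<dots> \<longleftrightarrow> [:- r, 1:] * [:- r, 1:] dvd [:- r, 1:] * root_prod (remove1 r rs)"
    by (simp only: root_prod_remove1[OF assms] power2_eq_square)
  also have "\<dots> \<longleftrightarrow> [:- r, 1:] dvd root_prod (remove1 r rs)"
    by (subst dvd_mult_cancel_left) auto
  also have "\<dots> \<longleftrightarrow> r \<in> set (remove1 r rs)"
    by (simp only: poly_root_prod_eq_0_iff flip: poly_eq_0_iff_dvd)
  finally show ?thesis .
qed

lemma distinct_iff_remove1: "distinct rs \<longleftrightarrow> (\<forall>r\<in>set rs. r \<notin> set (remove1 r rs))"
  by (induction rs) auto

text \<open>Up to sign the product is the discriminant. Its factor at \<open>r\<close> vanishes
  exactly if \<open>r\<close> occurs once more in the list.\<close>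

lemma distinct_iff_disc:
  fixes rs :: "'b::field list"
  shows "(\<Prod>r\<leftarrow>rs. poly (pderiv (root_prod rs)) r) \<noteq> 0 \<longleftrightarrow> distinct rs"
proof -
  have "(\<Prod>r\<leftarrow>xs. f r) \<noteq> 0 \<longleftrightarrow> (\<forall>r\<in>set xs. f r \<noteq> 0)" for f :: "'b \<Rightarrow> 'b" and xs
    by (induction xs) auto
  then show ?thesis by (simp add: distinct_iff_remove1 root_prod_double_root)
qed

lemma rsquarefree_root_prod_iff:
  fixes rs :: "'b::field list"
  shows "rsquarefree (root_prod rs) \<longleftrightarrow> distinct rs"
proof -
  have "root_prod rs \<noteq> 0" using root_prod_monic[of rs] by auto
  then show ?thesis
    by (auto simp: rsquarefree_iff double_root_iff poly_root_prod_eq_0_iff distinct_iff_remove1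
        root_prod_double_root)
qed

text \<open>A tower is a triangular system of monic equations: the polynomial for the coordinate \<open>j\<close> depends only
  on the parameters \<open>S\<close> and on the preceding coordinates. Its solutions over given parameters are
  listed with multiplicity.\<close>

fun points :: "('i \<times> (('i \<Rightarrow> 'b::alg_closed_field) \<Rightarrow> 'b poly)) list \<Rightarrow> ('i \<Rightarrow> 'b) \<Rightarrow> ('i \<Rightarrow> 'b) list" where
  "points [] v = [v]"
| "points ((j, P) # ps) v = concat (map (\<lambda>r. points ps (v(j := r))) (roots_of (P v)))"

fun tower :: "'i set \<Rightarrow> ('i \<times> (('i \<Rightarrow> 'a::field alg_closure) \<Rightarrow> 'a alg_closure poly)) list \<Rightarrow> bool" where
  "tower S [] = True"
| "tower S ((j, P) # ps) =
     (j \<notin> S \<and> P \<in> SP \<and> (\<exists>e>0. \<forall>v. degree (P v) = e) \<and> (\<forall>v. lead_coeff (P v) = 1) \<and>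
      (\<forall>v w. (\<forall>i\<in>S. v i = w i) \<longrightarrow> P v = P w) \<and> tower (insert j S) ps)"

definition on_tower :: "('i \<times> (('i \<Rightarrow> 'b::comm_ring_1) \<Rightarrow> 'b poly)) list \<Rightarrow> ('i \<Rightarrow> 'b) \<Rightarrow> bool" where
  "on_tower ps v \<longleftrightarrow> (\<forall>(j, P)\<in>set ps. poly (P v) (v j) = 0)"

lemma tower_dep: "tower S ((j, P) # ps) \<Longrightarrow> (\<And>i. i \<in> S \<Longrightarrow> v i = w i) \<Longrightarrow> P v = P w"
  unfolding tower.simps by blast

lemma tower_disjoint: "tower S ps \<Longrightarrow> fst ` set ps \<inter> S = {}"
  by (induction S ps rule: tower.induct) auto

lemma tower_SP: "tower S ps \<Longrightarrow> (j, P) \<in> set ps \<Longrightarrow> P \<in> SP"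
  by (induction S ps rule: tower.induct) auto

lemma tower_monic: "tower S ps \<Longrightarrow> (j, P) \<in> set ps \<Longrightarrow> lead_coeff (P v) = 1"
  by (induction S ps rule: tower.induct) auto

lemma on_tower_gal:
  assumes "tower S ps" "\<sigma> \<in> gal" "on_tower ps v"
  shows "on_tower ps (\<lambda>i. \<sigma> (v i))"
  unfolding on_tower_def
proof
  note hom = rhom_gal[OF assms(2)]
  fix jP assume jP: "jP \<in> set ps"
  obtain j P where [simp]: "jP = (j, P)" by (cases jP)
  have P: "P \<in> SP" using tower_SP[OF assms(1)] jP by simp
  have "P (\<lambda>i. \<sigma> (v i)) = map_poly \<sigma> (P v)"
    by (rule poly_eqI) (simp add: rhom.coeff_hom[OF hom] PF_gal[OF SP_coeff[OF P] assms(2)])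
  moreover have "poly (P v) (v j) = 0" using assms(3) jP by (auto simp: on_tower_def)
  ultimately have "poly (P (\<lambda>i. \<sigma> (v i))) (\<sigma> (v j)) = 0"
    by (simp add: rhom.hom_0[OF hom] flip: rhom.poly_hom[OF hom])
  then show "case jP of (j, P) \<Rightarrow> poly (P (\<lambda>i. \<sigma> (v i))) (\<sigma> (v j)) = 0" by simp
qed

text \<open>The recursion evaluates \<open>P\<close> at a tuple whose later coordinates are not yet
  set. By triangularity this gives the same polynomial as at the finished tuple, so the recursion
  enumerates the solutions of the whole system.\<close>

lemma set_points:
  assumes "tower S ps"
  shows "v' \<in> set (points ps v) \<longleftrightarrow> (\<forall>i. i \<notin> fst ` set ps \<longrightarrow> v' i = v i) \<and> on_tower ps v'"
  using assms
proof (induction ps arbitrary: S v)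
  case Nil
  show ?case by (auto simp: on_tower_def)
next
  case (Cons jP ps)
  obtain j P where [simp]: "jP = (j, P)" by (cases jP)
  have t: "tower (insert j S) ps" "j \<notin> S" "lead_coeff (P v) = 1" using Cons.prems by simp_all
  have dep: "P v = P w" if "\<And>i. i \<in> S \<Longrightarrow> v i = w i" for v w
    using tower_dep[of S j P ps v w] Cons.prems that by simp
  have j: "j \<notin> fst ` set ps" and S: "fst ` set ps \<inter> S = {}"
    using tower_disjoint[OF t(1)] by auto
  have "v' \<in> set (points (jP # ps) v) \<longleftrightarrow>
      (\<exists>r. poly (P v) r = 0 \<and> (\<forall>i. i \<notin> fst ` set ps \<longrightarrow> v' i = (v(j := r)) i) \<and> on_tower ps v')"
    using Cons.IH[OF t(1)] by (auto simp: set_roots_of[OF t(3)])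
  also have "\<dots> \<longleftrightarrow> poly (P v) (v' j) = 0 \<and>
      (\<forall>i. i \<notin> insert j (fst ` set ps) \<longrightarrow> v' i = v i) \<and> on_tower ps v'"
    using j by (auto simp del: fun_upd_apply simp: fun_upd_def)
  also have "\<dots> \<longleftrightarrow> (\<forall>i. i \<notin> fst ` set (jP # ps) \<longrightarrow> v' i = v i) \<and> on_tower (jP # ps) v'"
  proof -
    have "P v = P v'" if "\<forall>i. i \<notin> insert j (fst ` set ps) \<longrightarrow> v' i = v i"
      using that t(2) S by (intro dep) (metis disjoint_iff insert_iff)
    then show ?thesis by (auto simp: on_tower_def)
  qed
  finally show ?case .
qed

lemma prod_list_concat: "prod_list (concat xss) = prod_list (map prod_list xss)"
  for xss :: "'b::comm_monoid_mult list list"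
  by (induction xss) auto

text \<open>An iterated norm: starting with the last storey, each use of \<open>norm_PF\<close>
  eliminates one coordinate.\<close>

lemma points_PF:
  assumes "tower S ps" "F \<in> PF"
  shows "(\<lambda>v. \<Prod>v'\<leftarrow>points ps v. F v') \<in> PF"
  using assms(1)
proof (induction ps arbitrary: S)
  case Nil
  show ?case using assms(2) by simp
next
  case (Cons jP ps)
  obtain j P where [simp]: "jP = (j, P)" by (cases jP)
  obtain e where t: "tower (insert j S) ps" "P \<in> SP" "\<And>v. degree (P v) = e" "\<And>v. lead_coeff (P v) = 1"
    using Cons.prems by auto
  obtain N where N: "N \<in> PF" "\<And>v rs. P v = root_prod rs \<Longrightarrow>
      N v = (\<Prod>r\<leftarrow>rs. \<Prod>v'\<leftarrow>points ps (v(j := r)). F v')"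
    using norm_PF[OF Cons.IH[OF t(1)] t(2,3), of j] by blast
  have "(\<lambda>v. \<Prod>v'\<leftarrow>points (jP # ps) v. F v') = N"
    using N(2)[OF root_prod_roots_of[OF t(4), symmetric]]
    by (auto simp: fun_eq_iff map_concat prod_list_concat comp_def)
  then show ?case using N(1) by simp
qed

lemma length_points:
  assumes "tower S ps" obtains n where "n > 0" "\<And>v. length (points ps v) = n"
proof -
  have "\<exists>n>0. \<forall>v. length (points ps v) = n"
    using assms
  proof (induction ps arbitrary: S)
    case (Cons jP ps)
    obtain j P where [simp]: "jP = (j, P)" by (cases jP)
    obtain e where t: "tower (insert j S) ps" "e > 0" "\<And>v. degree (P v) = e" "\<And>v. lead_coeff (P v) = 1"
      using Cons.prems by auto
    obtain n where n: "n > 0" "\<And>v. length (points ps v) = n" using Cons.IH[OF t(1)] by blast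
    have "length (roots_of (P v)) = e" for v using length_roots_of[OF t(4)] t(3) by simp
    then have "length (points (jP # ps) v) = e * n" for v
      by (simp add: length_concat comp_def n(2) sum_list_triv)
    then show ?case using n(1) t(2) by (intro exI[of _ "e * n"]) simp
  qed (intro exI[of _ 1], simp)
  then show ?thesis using that by blast
qed

lemma points_cong:
  assumes "tower S ps" "\<And>i. i \<in> S \<Longrightarrow> v i = w i"
    and "\<And>v w. (\<And>i. i \<in> S \<union> fst ` set ps \<Longrightarrow> v i = w i) \<Longrightarrow> \<theta> v = \<theta> w"
  shows "map \<theta> (points ps v) = map \<theta> (points ps w)"
  using assms
proof (induction ps arbitrary: S v w)
  case Nil
  have "\<theta> v = \<theta> w" by (rule Nil.prems(3)) (simp add: Nil.prems(2))
  then show ?case by simp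
next
  case (Cons jP ps)
  obtain j P where [simp]: "jP = (j, P)" by (cases jP)
  have t: "tower (insert j S) ps" using Cons.prems(1) by simp
  have "P v = P w" using tower_dep[of S j P ps v w] Cons.prems(1,2) by simp
  moreover have "map \<theta> (points ps (v(j := r))) = map \<theta> (points ps (w(j := r)))" for r
  proof (rule Cons.IH[OF t])
    show "(v(j := r)) i = (w(j := r)) i" if "i \<in> insert j S" for i
      using that Cons.prems(2) by (cases "i = j") simp_all
    show "\<theta> v = \<theta> w" if "\<And>i. i \<in> insert j S \<union> fst ` set ps \<Longrightarrow> v i = w i" for v w
      by (rule Cons.prems(3), rule that) auto
  qed
  ultimately show ?case by (simp add: map_concat comp_def)
qed

lemma distinct_points:
  assumes "tower S ps"
    and "\<And>v' j P. v' \<in> set (points ps v) \<Longrightarrow> (j, P) \<in> set ps \<Longrightarrow> distinct (roots_of (P v'))"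
  shows "distinct (points ps v)"
  using assms
proof (induction ps arbitrary: S v)
  case (Cons jP ps)
  obtain j P where [simp]: "jP = (j, P)" by (cases jP)
  have t: "tower (insert j S) ps" "j \<notin> S" using Cons.prems(1) by simp_all
  have dep: "P v = P w" if "\<And>i. i \<in> S \<Longrightarrow> v i = w i" for v w
    using tower_dep[of S j P ps v w] Cons.prems(1) that by simp
  have j: "j \<notin> fst ` set ps" and S: "fst ` set ps \<inter> S = {}"
    using tower_disjoint[OF t(1)] by auto
  have ne: "points ps w \<noteq> []" for w using length_points[OF t(1)] by (metis length_0_conv less_irrefl)
  have vj: "v' j = r" if "v' \<in> set (points ps (v(j := r)))" for v' r
    using that j unfolding set_points[OF t(1)] by simp
  have mem: "v' \<in> set (points (jP # ps) v)"
    if "r \<in> set (roots_of (P v))" "v' \<in> set (points ps (v(j := r)))" for r v'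
    using that unfolding \<open>jP = (j, P)\<close> points.simps set_concat set_map by blast
  have dist: "distinct (points ps (v(j := r)))" if r: "r \<in> set (roots_of (P v))" for r
  proof (rule Cons.IH[OF t(1)])
    show "distinct (roots_of (Q v'))" if "v' \<in> set (points ps (v(j := r)))" "(i, Q) \<in> set ps" for v' i Q
      using that(2) by (intro Cons.prems(2)[OF mem[OF r that(1)], of i Q]) simp
  qed
  show ?case
  proof (cases "roots_of (P v) = []")
    case False
    then obtain r where r: "r \<in> set (roots_of (P v))" by (meson list.set_sel(1))
    obtain v' where v': "v' \<in> set (points ps (v(j := r)))" using ne by (meson list.set_sel(1))
    then have "v' \<in> set (points (jP # ps) v)" by (rule mem[OF r])
    then have "distinct (roots_of (P v'))" using Cons.prems(2)[of v' j P] by simp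
    moreover have "P v' = P v"
    proof (rule dep)
      fix i assume "i \<in> S"
      then have "i \<notin> fst ` set ps" "i \<noteq> j" using S t(2) by auto
      then show "v' i = v i" using v' unfolding set_points[OF t(1)] by simp
    qed
    ultimately have "distinct (roots_of (P v))" by simp
    then have "distinct (map (\<lambda>r. points ps (v(j := r))) (roots_of (P v)))"
      unfolding distinct_map using ne vj by (auto intro!: inj_onI) (metis list.set_sel(1))
    then show ?thesis
      using dist vj by (auto intro!: distinct_concat) blast
  qed simp
qed simp

lemma distinct_concat_mapD:
  assumes "distinct (concat (map f rs))" "\<And>r. f r \<noteq> []"
  shows "distinct rs" "r \<in> set rs \<Longrightarrow> distinct (f r)"
proof -
  have "distinct rs \<and> (\<forall>r\<in>set rs. distinct (f r))"
    using assms(1)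
  proof (induction rs)
    case (Cons r rs)
    then have "set (f r) \<inter> (\<Union>x\<in>set rs. set (f x)) = {}" by simp
    moreover obtain y where "y \<in> set (f r)" using assms(2) by (meson list.set_sel(1))
    ultimately have "r \<notin> set rs" by blast
    then show ?case using Cons by simp
  qed simp
  then show "distinct rs" "r \<in> set rs \<Longrightarrow> distinct (f r)" by blast+
qed

text \<open>Converse direction to \<open>distinct_points\<close>. It later converts distinctness of
  the specialised points into squarefreeness of the specialised polynomials.\<close>

lemma distinct_points_roots:
  assumes "tower S ps" "distinct (points ps v)" "v' \<in> set (points ps v)" "(j, P) \<in> set ps"
  shows "distinct (roots_of (P v'))"
  using assms
proof (induction ps arbitrary: S v)
  case (Cons jP ps)
  obtain j' P' where [simp]: "jP = (j', P')" by (cases jP)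
  have t: "tower (insert j' S) ps" "j' \<notin> S" using Cons.prems(1) by simp_all
  have dep: "P' v = P' w" if "\<And>i. i \<in> S \<Longrightarrow> v i = w i" for v w
    using tower_dep[of S j' P' ps v w] Cons.prems(1) that by simp
  have S: "fst ` set ps \<inter> S = {}"
    using tower_disjoint[OF t(1)] by auto
  obtain r where r: "r \<in> set (roots_of (P' v))" "v' \<in> set (points ps (v(j' := r)))"
    using Cons.prems(3) by auto
  have dist: "distinct (concat (map (\<lambda>r. points ps (v(j' := r))) (roots_of (P' v))))"
    using Cons.prems(2) by simp
  have ne: "points ps w \<noteq> []" for w using length_points[OF t(1)] by (metis length_0_conv less_irrefl)
  show ?case
  proof (cases "(j, P) = (j', P')")
    case True
    have "P' v' = P' v"
    proof (rule dep)
      fix i assume "i \<in> S"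
      then have "i \<notin> fst ` set ps" "i \<noteq> j'" using S t(2) by auto
      then show "v' i = v i" using r(2) unfolding set_points[OF t(1)] by simp
    qed
    moreover have "distinct (roots_of (P' v))"
      by (rule distinct_concat_mapD(1)[OF dist]) (rule ne)
    ultimately show ?thesis using True by simp
  next
    case False
    then have "(j, P) \<in> set ps" using Cons.prems(4) by auto
    moreover have "distinct (points ps (v(j' := r)))"
      by (rule distinct_concat_mapD(2)[OF dist ne r(1)])
    ultimately show ?thesis using Cons.IH[OF t(1)] r(2) by blast
  qed
qed simp

section \<open>Evaluation of polynomials in several variables\<close>

definition eval_monom :: "(nat \<Rightarrow> 'b::comm_semiring_1) \<Rightarrow> (nat \<Rightarrow>\<^sub>0 nat) \<Rightarrow> 'b" where
  "eval_monom t m = (\<Prod>i\<in>Poly_Mapping.keys m. t i ^ Poly_Mapping.lookup m i)"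

text \<open>Evaluation at points of the closure. It extends \<open>mpoly_eval\<close> from points of
  k (\<open>eval_ac_to_ac\<close>) and allows formal polynomials to be compared with functions in
  \<open>PF\<close>.\<close>

definition eval_ac :: "(nat \<Rightarrow> 'a alg_closure) \<Rightarrow> 'a::field mpoly \<Rightarrow> 'a alg_closure" where
  "eval_ac t p = (\<Sum>m\<in>Poly_Mapping.keys p. to_ac (Poly_Mapping.lookup p m) * eval_monom t m)"

lemma eval_monom_superset:
  assumes "finite A" "Poly_Mapping.keys m \<subseteq> A"
  shows "eval_monom t m = (\<Prod>i\<in>A. t i ^ Poly_Mapping.lookup m i)"
  unfolding eval_monom_def using assms
  by (intro prod.mono_neutral_left) (auto simp: in_keys_iff)

lemma eval_monom_add: "eval_monom t (m + m') = eval_monom t m * eval_monom t m'"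
proof -
  let ?A = "Poly_Mapping.keys m \<union> Poly_Mapping.keys m'"
  have "eval_monom t (m + m') = (\<Prod>i\<in>?A. t i ^ Poly_Mapping.lookup (m + m') i)"
    by (rule eval_monom_superset) (simp_all add: Poly_Mapping.keys_add)
  also have "\<dots> = (\<Prod>i\<in>?A. t i ^ Poly_Mapping.lookup m i) * (\<Prod>i\<in>?A. t i ^ Poly_Mapping.lookup m' i)"
    by (simp add: lookup_add power_add prod.distrib)
  also have "\<dots> = eval_monom t m * eval_monom t m'"
    by (simp add: eval_monom_superset[of ?A])
  finally show ?thesis .
qed

lemma eval_ac_superset:
  assumes "finite A" "Poly_Mapping.keys p \<subseteq> A"
  shows "eval_ac t p = (\<Sum>m\<in>A. to_ac (Poly_Mapping.lookup p m) * eval_monom t m)"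
  unfolding eval_ac_def using assms
  by (intro sum.mono_neutral_left) (auto simp: in_keys_iff)

lemma eval_ac_add: "eval_ac t (p + q) = eval_ac t p + eval_ac t q"
proof -
  let ?A = "Poly_Mapping.keys p \<union> Poly_Mapping.keys q"
  have "eval_ac t (p + q) = (\<Sum>m\<in>?A. to_ac (Poly_Mapping.lookup (p + q) m) * eval_monom t m)"
    by (rule eval_ac_superset) (simp_all add: Poly_Mapping.keys_add)
  also have "\<dots> = eval_ac t p + eval_ac t q"
    by (simp add: eval_ac_superset[of ?A] lookup_add distrib_right sum.distrib)
  finally show ?thesis .
qed

lemma eval_ac_sum: "eval_ac t (sum f A) = (\<Sum>a\<in>A. eval_ac t (f a))"
  by (induction A rule: infinite_finite_induct) (simp_all add: eval_ac_add, simp_all add: eval_ac_def)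

lemma eval_ac_single: "eval_ac t (Poly_Mapping.single m c) = to_ac c * eval_monom t m"
  by (simp add: eval_ac_def)

lemma poly_mapping_eq_sum_singles:
  "p = (\<Sum>m\<in>Poly_Mapping.keys p. Poly_Mapping.single m (Poly_Mapping.lookup p m))"
  by (rule poly_mapping_eqI) (simp add: lookup_sum lookup_single when_def in_keys_iff)

lemma rhom_eval_ac: "rhom (eval_ac t)"
proof
  show "eval_ac t (p + q) = eval_ac t p + eval_ac t q" for p q by (rule eval_ac_add)
  show "eval_ac t 1 = 1"
    unfolding single_one[symmetric] eval_ac_single by (simp add: eval_monom_def)
  show "eval_ac t (p * q) = eval_ac t p * eval_ac t q" for p q
  proof -
    let ?s = "\<lambda>p m. Poly_Mapping.single m (Poly_Mapping.lookup p m)"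
    have "p * q = (\<Sum>m\<in>Poly_Mapping.keys p. ?s p m) * (\<Sum>m\<in>Poly_Mapping.keys q. ?s q m)"
      by (simp flip: poly_mapping_eq_sum_singles)
    also have "\<dots> = (\<Sum>m\<in>Poly_Mapping.keys p. \<Sum>m'\<in>Poly_Mapping.keys q.
        Poly_Mapping.single (m + m') (Poly_Mapping.lookup p m * Poly_Mapping.lookup q m'))"
      by (simp add: sum_product mult_single)
    finally have "eval_ac t (p * q) = (\<Sum>m\<in>Poly_Mapping.keys p. \<Sum>m'\<in>Poly_Mapping.keys q.
        (to_ac (Poly_Mapping.lookup p m) * eval_monom t m) * (to_ac (Poly_Mapping.lookup q m') * eval_monom t m'))"
      by (simp add: eval_ac_sum eval_ac_single eval_monom_add mult_ac)
    then show ?thesis by (simp add: eval_ac_def sum_product)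
  qed
qed

lemma eval_ac_to_ac: "eval_ac (\<lambda>i. to_ac (t i)) p = to_ac (mpoly_eval t p)"
  by (simp add: eval_ac_def mpoly_eval_def eval_monom_def to_ac_sum to_ac_prod)

lemma eval_ac_PF: "(\<lambda>v. eval_ac (\<lambda>i. v (f i)) p) \<in> PF"
  unfolding eval_ac_def eval_monom_def
  by (intro PF_sum PF_mult PF_const PF_prod PF_power PF_coord)

text \<open>Kronecker substitution \<open>z ^ (B ^ i)\<close> for the \<open>i\<close>-th variable, where \<open>B\<close> gives distinct weights to
  the exponent vectors that occur.\<close>

lemma eval_ac_nonzero:
  fixes p :: "'a::field mpoly"
  assumes "p \<noteq> 0" obtains t where "eval_ac t p \<noteq> 0"
proof -
  let ?M = "Poly_Mapping.keys p"
  define I where "I = (\<Union>m\<in>?M. Poly_Mapping.keys m)"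
  have fin: "finite I" by (simp add: I_def)
  \<comment> \<open>The difference of two exponent vectors, read as an integer polynomial. Its value
    at \<open>B\<close> is the difference of their weights, so \<open>B\<close> only has to avoid
    the roots of finitely many nonzero polynomials.\<close>
  define d where "d m m' = (\<Sum>i\<in>I. monom (int (Poly_Mapping.lookup m i) - int (Poly_Mapping.lookup m' i)) i)"
    for m m' :: "nat \<Rightarrow>\<^sub>0 nat"
  have cd: "coeff (d m m') i = int (Poly_Mapping.lookup m i) - int (Poly_Mapping.lookup m' i)"
    if "i \<in> I" for m m' i
    using that fin by (simp add: d_def coeff_sum)
  have d0: "d m m' \<noteq> 0" if "m \<in> ?M" "m' \<in> ?M" "m \<noteq> m'" for m m'
  proof
    assume "d m m' = 0"
    then have "Poly_Mapping.lookup m i = Poly_Mapping.lookup m' i" if "i \<in> I" for i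
      using cd[OF that, of m m'] by simp
    moreover have "Poly_Mapping.lookup m i = Poly_Mapping.lookup m' i" if "i \<notin> I" for i
    proof -
      have "i \<notin> Poly_Mapping.keys m" "i \<notin> Poly_Mapping.keys m'"
        using that \<open>m \<in> ?M\<close> \<open>m' \<in> ?M\<close> unfolding I_def by blast+
      then show ?thesis by (simp add: not_in_keys_iff_lookup_eq_zero)
    qed
    ultimately show False using that(3) by (metis poly_mapping_eqI)
  qed
  have "finite (\<Union>(m, m')\<in>{(m, m'). m \<in> ?M \<and> m' \<in> ?M \<and> m \<noteq> m'}. {z. poly (d m m') z = 0})"
    by (rule finite_UN_I, rule finite_subset[of _ "?M \<times> ?M"]) (auto intro!: poly_roots_finite dest: d0)
  then have "finite (int -` (\<Union>(m, m')\<in>{(m, m'). m \<in> ?M \<and> m' \<in> ?M \<and> m \<noteq> m'}. {z. poly (d m m') z = 0}))"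
    by (rule finite_vimageI) (simp add: inj_def)
  then obtain B :: nat where
    "B \<notin> int -` (\<Union>(m, m')\<in>{(m, m'). m \<in> ?M \<and> m' \<in> ?M \<and> m \<noteq> m'}. {z. poly (d m m') z = 0})"
    using ex_new_if_finite[OF infinite_UNIV_nat] by blast
  then have B: "poly (d m m') (int B) \<noteq> 0" if "m \<in> ?M" "m' \<in> ?M" "m \<noteq> m'" for m m'
    using that by auto
  define W where "W m = (\<Sum>i\<in>I. Poly_Mapping.lookup m i * B ^ i)" for m :: "nat \<Rightarrow>\<^sub>0 nat"
  have inj: "inj_on W ?M"
  proof (rule inj_onI)
    fix m m' assume m: "m \<in> ?M" "m' \<in> ?M" and eq: "W m = W m'"
    have "poly (d m m') (int B) = int (W m) - int (W m')"
      by (simp add: d_def W_def poly_sum poly_monom left_diff_distrib sum_subtractf)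
    then show "m = m'" using B[OF m] eq by auto
  qed
  define P where "P = (\<Sum>m\<in>?M. monom (to_ac (Poly_Mapping.lookup p m)) (W m))"
  obtain m0 where m0: "m0 \<in> ?M" using assms by fastforce
  have "coeff P (W m0) = (\<Sum>m\<in>?M. if m = m0 then to_ac (Poly_Mapping.lookup p m) else 0)"
    unfolding P_def coeff_sum coeff_monom
    by (rule sum.cong) (use inj m0 in \<open>auto simp: inj_on_def\<close>)
  then have "coeff P (W m0) \<noteq> 0" using m0 by (simp add: in_keys_iff)
  then have "P \<noteq> 0" by auto
  then obtain z where z: "poly P z \<noteq> 0"
    using poly_roots_finite[of P] infinite_UNIV_alg_closed[where 'b = "'a alg_closure"]
    by (metis (mono_tags, lifting) UNIV_eq_I mem_Collect_eq)
  have "eval_monom (\<lambda>i. z ^ (B ^ i)) m = z ^ W m" if "m \<in> ?M" for m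
  proof -
    have "eval_monom (\<lambda>i. z ^ (B ^ i)) m = (\<Prod>i\<in>I. (z ^ (B ^ i)) ^ Poly_Mapping.lookup m i)"
      using that fin by (intro eval_monom_superset) (auto simp: I_def)
    also have "\<dots> = z ^ W m"
      by (simp add: W_def power_sum mult.commute flip: power_mult)
    finally show ?thesis .
  qed
  then have "eval_ac (\<lambda>i. z ^ (B ^ i)) p = poly P z"
    by (simp add: eval_ac_def P_def poly_sum poly_monom)
  with z have "eval_ac (\<lambda>i. z ^ (B ^ i)) p \<noteq> 0" by simp
  then show ?thesis by (rule that)
qed

lemma mpolys_const: "Poly_Mapping.single 0 c \<in> mpolys n"
  by (auto simp: mpolys_def)

lemma mpolys_0: "(0 :: 'a::field mpoly) \<in> mpolys n" and mpolys_1: "(1 :: 'a::field mpoly) \<in> mpolys n"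
  using mpolys_const[of "0 :: 'a" n] mpolys_const[of "1 :: 'a" n] by simp_all

lemma mpolys_var: "i < n \<Longrightarrow> Poly_Mapping.single (Poly_Mapping.single i 1) 1 \<in> mpolys n"
  by (auto simp: mpolys_def)

lemma mpolys_add: "p \<in> mpolys n \<Longrightarrow> q \<in> mpolys n \<Longrightarrow> p + q \<in> mpolys n"
  using Poly_Mapping.keys_add[of p q] unfolding mpolys_def by blast

lemma mpolys_mult:
  assumes "p \<in> mpolys n" "q \<in> mpolys n" shows "p * q \<in> mpolys n"
  unfolding mpolys_def
proof (intro CollectI ballI)
  fix m assume "m \<in> Poly_Mapping.keys (p * q)"
  then obtain a b where "m = a + b" "a \<in> Poly_Mapping.keys p" "b \<in> Poly_Mapping.keys q"
    using Poly_Mapping.keys_mult[of p q] by auto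
  then show "Poly_Mapping.keys m \<subseteq> {..<n}"
    using assms Poly_Mapping.keys_add[of a b] unfolding mpolys_def by blast
qed

text \<open>The way back from functions to the formal polynomials that \<open>hilbertian\<close>
  speaks of. The map \<open>u\<close> connects each coordinate to one of the first \<open>n\<close>
  variables or sets it to 0.\<close>

lemma PF_as_mpoly:
  fixes F :: "('i \<Rightarrow> 'a::field alg_closure) \<Rightarrow> 'a alg_closure"
  assumes "F \<in> PF" "\<And>i. (\<lambda>t. u t i) = (\<lambda>t. 0) \<or> (\<exists>l<n. (\<lambda>t. u t i) = (\<lambda>t. t l))"
  obtains q where "q \<in> mpolys n" "\<And>t. eval_ac t q = F (u t)"
proof -
  have "\<exists>q\<in>mpolys n. \<forall>t. eval_ac t q = F (u t)"
    using assms(1)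
  proof (induction rule: PF.induct)
    case (PF_const c)
    show ?case
      by (rule bexI[OF _ mpolys_const[of c]]) (simp add: eval_ac_single eval_monom_def)
  next
    case (PF_coord i)
    from assms(2)[of i] show ?case
    proof
      assume "(\<lambda>t. u t i) = (\<lambda>t. 0)"
      then have "u t i = 0" for t by metis
      then show ?thesis
        by (intro bexI[OF _ mpolys_const[of 0]]) (simp add: eval_ac_def)
    next
      assume "\<exists>l<n. (\<lambda>t. u t i) = (\<lambda>t. t l)"
      then obtain l where l: "l < n" "\<And>t. u t i = t l" by metis
      show ?thesis
        by (rule bexI[OF _ mpolys_var[OF l(1)]]) (simp add: eval_ac_single eval_monom_def l(2))
    qed
  next
    case (PF_add F G)
    then show ?case by (metis eval_ac_add mpolys_add)
  next
    case (PF_mult F G)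
    then show ?case by (metis rhom.hom_mult[OF rhom_eval_ac] mpolys_mult)
  qed
  then show ?thesis using that by blast
qed

section \<open>Hilbert specialisation of a tower\<close>

lemma rhom_to_fract: "rhom (to_fract :: 'b::idom \<Rightarrow> _)"
  by unfold_locales simp_all

lemma clear_denominators:
  fixes a :: "'b::idom fract poly"
  obtains D a' where "D \<noteq> 0" "smult (to_fract D) a = map_poly to_fract a'"
proof -
  have "\<exists>D a'. D \<noteq> 0 \<and> smult (to_fract D) a = map_poly to_fract a'"
  proof (induction a)
    case 0
    show ?case by (intro exI[of _ 1] exI[of _ 0]) simp
  next
    case (pCons x c)
    then obtain D c' where D: "D \<noteq> 0" "smult (to_fract D) c = map_poly to_fract c'" by blast
    obtain p q where pq: "x = Fract p q" "q \<noteq> 0" by (cases x)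
    have "to_fract (q * D) * x = to_fract (p * D)"
      using pq D(1) by (simp add: to_fract_def eq_fract mult_ac)
    moreover have "smult (to_fract (q * D)) c = map_poly to_fract (smult q c')"
    proof -
      have "smult (to_fract (q * D)) c = smult (to_fract q) (map_poly to_fract c')"
        by (simp add: rhom.hom_mult[OF rhom_to_fract] flip: D(2))
      also have "\<dots> = map_poly to_fract (smult q c')"
        by (rule poly_eqI) (simp add: rhom.coeff_hom[OF rhom_to_fract] rhom.hom_mult[OF rhom_to_fract])
      finally show ?thesis .
    qed
    ultimately have "smult (to_fract (q * D)) (pCons x c) = map_poly to_fract (pCons (p * D) (smult q c'))"
      by (simp add: rhom.map_poly_hom_pCons[OF rhom_to_fract])
    then show ?case using D(1) pq(2) by (intro exI[of _ "q * D"] exI) auto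
  qed
  then show ?thesis using that by blast
qed

lemma map_poly_to_fract_eq_iff: "map_poly to_fract p = map_poly to_fract q \<longleftrightarrow> p = q"
  for p q :: "'b::idom poly"
  by (simp add: poly_eq_iff rhom.coeff_hom[OF rhom_to_fract])

lemma degree_map_poly_to_fract: "degree (map_poly to_fract p) = degree p"
  for p :: "'b::idom poly"
  by (rule degree_map_poly) simp

text \<open>At a multiple root the derivative vanishes too. As \<open>f\<close> is up to a unit the
  minimal polynomial of that root, it would divide the nonzero polynomial \<open>pderiv f\<close> of
  smaller degree.\<close>

lemma separable_poly_if_pderiv_nonzero:
  fixes f :: "'b::field poly"
  assumes f: "irreducible f" "pderiv f \<noteq> 0"
  shows "separable_poly f"
proof (rule ccontr)
  assume "\<not> separable_poly f"
  then obtain x where "[:- x, 1:] ^ 2 dvd map_poly to_ac f"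
    using f(1) by (auto simp: separable_poly_def rsquarefree_iff)
  then have x: "poly (map_poly to_ac f) x = 0" "poly (map_poly to_ac (pderiv f)) x = 0"
    unfolding double_root_iff rhom.map_poly_hom_pderiv[OF rhom_to_ac] by blast+
  obtain m :: "'b poly" where m: "irreducible m"
      "\<And>p. poly (map_poly to_ac p) x = 0 \<Longrightarrow> m dvd p"
    by (rule irreducible_poly_of[of x]) blast
  have "f dvd m"
    using irreducibleD'[OF f(1) m(2)[OF x(1)]] m(1) by (auto simp: irreducible_def)
  then have "f dvd pderiv f" using m(2)[OF x(2)] by (rule dvd_trans)
  then have le: "degree f \<le> degree (pderiv f)" using f(2) by (rule dvd_imp_degree_le)
  have "degree f \<noteq> 0"
  proof
    assume "degree f = 0"
    then obtain c where "f = [:c:]" by (rule degree_eq_zeroE)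
    then show False using f(2) by (simp add: pderiv_pCons)
  qed
  then have "degree (pderiv f) \<le> degree f - 1"
    by (intro degree_le) (auto simp: coeff_pderiv coeff_eq_0)
  then show False using le \<open>degree f \<noteq> 0\<close> by simp
qed

text \<open>\<open>TV\<close> are the parameters, \<open>CV\<close> is a conjugate of the primitive element, and \<open>YV r i\<close> is the \<open>i\<close>-th
  root of the \<open>r\<close>-th generic polynomial.\<close>

datatype pvar = TV nat | CV | YV nat nat

definition emb :: "(nat \<Rightarrow> 'b::zero) \<Rightarrow> pvar \<Rightarrow> 'b" where
  "emb t i = (case i of TV l \<Rightarrow> t l | _ \<Rightarrow> 0)"

text \<open>The cut at \<open>n\<close> ensures that a polynomial function composed with this
  embedding involves only the first \<open>n\<close> indeterminates and so comes from
  \<open>mpolys n\<close>.\<close>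

definition emb_below :: "nat \<Rightarrow> (nat \<Rightarrow> 'b::zero) \<Rightarrow> pvar \<Rightarrow> 'b" where
  "emb_below n t i = (case i of TV l \<Rightarrow> if l < n then t l else 0 | _ \<Rightarrow> 0)"

lemma emb_below_mpoly:
  assumes "F \<in> PF" obtains q where "q \<in> mpolys n" "\<And>t. eval_ac t q = F (emb_below n t)"
proof (rule PF_as_mpoly[OF assms, where u = "emb_below n" and n = n])
  show "(\<lambda>t. emb_below n t i) = (\<lambda>t. 0) \<or> (\<exists>l<n. (\<lambda>t. emb_below n t i) = (\<lambda>t. t l))" for i
  proof (cases i)
    case (TV l)
    then show ?thesis by (cases "l < n") (auto simp: emb_below_def)
  qed (simp_all add: emb_below_def)
qed (use that in blast)

text \<open>Hypothesis \<open>irr\<close> says that the solution set carries no zero divisors, which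
  yields irreducibility of the resolvent \<open>fp\<close>; \<open>v0\<close> witnesses that its
  discriminant is not identically zero. At a specialisation preserving both properties all values of
  \<theta> are conjugate, and since \<theta> separates the points, so are the points
  themselves.\<close>

theorem tower_hilbert:
  fixes ps :: "(pvar \<times> ((pvar \<Rightarrow> 'a::field alg_closure) \<Rightarrow> 'a alg_closure poly)) list"
  assumes hil: "hilbertian TYPE('a)" and inf: "infinite (UNIV :: 'a set)" and N: "N \<ge> 1"
    and tw: "tower (TV ` {..<N}) ps" and tv: "range TV \<inter> fst ` set ps = {}"
    and irr: "\<And>h1 h2. h1 \<in> PF \<Longrightarrow> h2 \<in> PF \<Longrightarrow> (\<And>v. on_tower ps v \<Longrightarrow> h1 v * h2 v = 0) \<Longrightarrow>
      (\<forall>v. on_tower ps v \<longrightarrow> h1 v = 0) \<or> (\<forall>v. on_tower ps v \<longrightarrow> h2 v = 0)"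
    and v0: "distinct (points ps v0)"
  obtains t :: "nat \<Rightarrow> 'a" where "distinct (points ps (emb (\<lambda>l. to_ac (t l))))"
    "\<And>v w. v \<in> set (points ps (emb (\<lambda>l. to_ac (t l)))) \<Longrightarrow> w \<in> set (points ps (emb (\<lambda>l. to_ac (t l)))) \<Longrightarrow>
       \<exists>\<sigma>\<in>gal. \<forall>j\<in>fst ` set ps. \<sigma> (v j) = w j"
proof -
  define S where "S = TV ` {..<N}"
  define I where "I = fst ` set ps"
  have tw: "tower S ps" using tw by (simp add: S_def)
  have finI: "finite I" by (simp add: I_def)
  have IS: "I \<inter> S = {}" unfolding I_def by (rule tower_disjoint[OF tw])
  obtain n where n: "n > 0" "\<And>v. length (points ps v) = n" by (rule length_points[OF tw]) blast
  obtain e :: "pvar \<Rightarrow> nat" where e: "inj_on e I"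
    using finite_imp_inj_to_nat_seg[OF finI] by blast
  obtain u :: 'a where u: "\<And>v w i. v \<in> set (points ps v0) \<Longrightarrow> w \<in> set (points ps v0) \<Longrightarrow>
      (\<Sum>i\<in>I. to_ac (u ^ e i) * v i) = (\<Sum>i\<in>I. to_ac (u ^ e i) * w i) \<Longrightarrow> i \<in> I \<Longrightarrow> v i = w i"
    using separating_linear_form[OF inf _ finI e, of "set (points ps v0)"] by blast
  define \<theta> where "\<theta> v = (\<Sum>i\<in>I. to_ac (u ^ e i) * v i)" for v
  have \<theta>PF: "\<theta> \<in> PF" unfolding \<theta>_def by (intro PF_sum PF_mult PF_const PF_coord)
  have \<theta>cong: "\<theta> v = \<theta> w" if "\<And>i. i \<in> S \<union> fst ` set ps \<Longrightarrow> v i = w i" for v w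
    unfolding \<theta>_def I_def using that by (intro sum.cong) simp_all
  have on: "v' i = v i" if "v' \<in> set (points ps v)" "i \<notin> I" for v' v i
    using that unfolding set_points[OF tw] I_def by blast
  have dist0: "distinct (map \<theta> (points ps v0))"
    unfolding distinct_map
  proof (intro conjI v0 inj_onI ext)
    fix v w i assume vw: "v \<in> set (points ps v0)" "w \<in> set (points ps v0)" and eq: "\<theta> v = \<theta> w"
    show "v i = w i"
      using u[OF vw eq[unfolded \<theta>_def]] on[OF vw(1)] on[OF vw(2)] by (cases "i \<in> I") simp_all
  qed
  define fp where "fp v = root_prod (map \<theta> (points ps v))" for v
  have cong: "map \<theta> (points ps v) = map \<theta> (points ps w)" if "\<And>i. i \<in> S \<Longrightarrow> v i = w i" for v w
    by (rule points_cong[OF tw that]) (assumption, rule \<theta>cong)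
  have fpcong: "fp v = fp w" if "\<And>i. i \<in> S \<Longrightarrow> v i = w i" for v w
    unfolding fp_def using cong[OF that] by simp
  have fpdeg: "degree (fp v) = n" for v
    unfolding fp_def using conjunct1[OF root_prod_monic[of "map \<theta> (points ps v)"]] by (simp add: n(2))
  have fplead: "coeff (fp v) n = 1" for v
    using conjunct2[OF root_prod_monic[of "map \<theta> (points ps v)"]] unfolding fp_def[symmetric] fpdeg .
  have fpSP: "fp \<in> SP"
  proof (rule SP_by_values[OF inf])
    show "degree (fp v) \<le> n" for v by (simp add: fpdeg)
    have "poly (fp v) (to_ac c) = (\<Prod>v'\<leftarrow>points ps v. to_ac c - \<theta> v')" for v c
      unfolding fp_def poly_root_prod by (simp add: comp_def)
    then show "(\<lambda>v. poly (fp v) (to_ac c)) \<in> PF" for c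
      using points_PF[OF tw PF_diff[OF PF_const[of c] \<theta>PF]] by simp
  qed
  \<comment> \<open>The factor uses \<open>fp v'\<close> rather than \<open>fp v\<close>, so that it
    is a polynomial function of the point \<open>v'\<close> as in \<open>points_PF\<close>. The two
    agree because points share their parameters.\<close>
  define disc where "disc v = (\<Prod>v'\<leftarrow>points ps v. poly (pderiv (fp v')) (\<theta> v'))" for v
  have discPF: "disc \<in> PF"
    unfolding disc_def by (rule points_PF[OF tw SP_poly[OF SP_pderiv[OF fpSP] \<theta>PF]])
  have disc_iff: "disc v \<noteq> 0 \<longleftrightarrow> distinct (map \<theta> (points ps v))" for v
  proof -
    have "fp v' = fp v" if "v' \<in> set (points ps v)" for v'
      using on[OF that] IS by (intro fpcong) blast
    then have "map (\<lambda>v'. poly (pderiv (fp v')) (\<theta> v')) (points ps v) =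
        map (\<lambda>v'. poly (pderiv (fp v)) (\<theta> v')) (points ps v)"
      by (intro map_cong) simp_all
    then have "disc v = (\<Prod>r\<leftarrow>map \<theta> (points ps v). poly (pderiv (fp v)) r)"
      by (simp only: disc_def map_map comp_def)
    then show ?thesis unfolding fp_def by (simp only: distinct_iff_disc)
  qed
  have "\<exists>q. q \<in> mpolys N \<and> (\<forall>t. eval_ac t q = coeff (fp (emb_below N t)) i)" for i
    using emb_below_mpoly[OF SP_coeff[OF fpSP, of i], of N] by metis
  then obtain q where q: "\<And>i. q i \<in> mpolys N" "\<And>i t. eval_ac t (q i) = coeff (fp (emb_below N t)) i"
    by metis
  \<comment> \<open>The resolvent as a formal polynomial over k[T]. The top coefficient is entered
    as 1 and not as \<open>q n\<close>, so that \<open>fh\<close> is visibly monic of degree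
    \<open>n\<close>.\<close>
  define fh where "fh = (\<Sum>i<n. monom (q i) i) + monom 1 n"
  have fhc: "coeff fh i = (if i < n then q i else if i = n then 1 else 0)" for i
    by (simp add: fh_def coeff_sum)
  have fhdeg: "degree fh = n"
    by (rule antisym[OF degree_le le_degree]) (simp_all add: fhc)
  have fh_eval: "map_poly (eval_ac t) fh = fp v" if "\<And>l. l < N \<Longrightarrow> v (TV l) = t l" for t v
  proof -
    have "map_poly (eval_ac t) fh = fp (emb_below N t)"
    proof (rule poly_eqI)
      show "coeff (map_poly (eval_ac t) fh) i = coeff (fp (emb_below N t)) i" for i
        unfolding rhom.coeff_hom[OF rhom_eval_ac] fhc
        by (simp add: q(2) fplead rhom.hom_1[OF rhom_eval_ac] rhom.hom_0[OF rhom_eval_ac] coeff_eq_0 fpdeg)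
    qed
    also have "\<dots> = fp v"
      by (rule fpcong) (auto simp: S_def emb_below_def that)
    finally show ?thesis .
  qed
  define val where "val v = eval_ac (\<lambda>l. v (TV l))" for v :: "pvar \<Rightarrow> 'a alg_closure"
  have homv: "rhom (val v)" for v unfolding val_def by (rule rhom_eval_ac)
  have valfh: "map_poly (val v) fh = fp v" for v unfolding val_def by (rule fh_eval) simp
  have hPF: "(\<lambda>v. poly (map_poly (val v) a) (\<theta> v)) \<in> PF" for a
  proof (rule SP_poly[OF SPI \<theta>PF])
    show "degree (map_poly (val v) a) \<le> degree a" for v by (rule rhom.degree_map_poly_hom_le[OF homv])
    show "(\<lambda>v. coeff (map_poly (val v) a) i) \<in> PF" for i
      unfolding rhom.coeff_hom[OF homv] unfolding val_def by (rule eval_ac_PF)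
  qed
  \<comment> \<open>Choose parameters where neither the discriminant nor the leading coefficient of
    \<open>a\<close> vanishes. There \<open>a\<close> has \<open>n\<close> distinct roots, the
    values of \<theta>, so it takes up the whole degree.\<close>
  have half: "degree b = 0"
    if ab: "smult D fh = a * b" "D \<noteq> 0" and
      zero: "\<forall>v. on_tower ps v \<longrightarrow> poly (map_poly (val v) a) (\<theta> v) = 0" for a b D
  proof -
    have "fh \<noteq> 0" using fhdeg n(1) by auto
    then have ab0: "a \<noteq> 0" "b \<noteq> 0" using ab by auto
    have deg: "degree a + degree b = n"
      using arg_cong[OF ab(1), of degree] ab(2) ab0 by (simp add: degree_mult_eq fhdeg)
    have lcPF: "(\<lambda>v. val v (lead_coeff a)) \<in> PF" unfolding val_def by (rule eval_ac_PF)
    obtain v where v: "disc v \<noteq> 0" "val v (lead_coeff a) \<noteq> 0"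
    proof -
      obtain t1 where t1: "eval_ac t1 (lead_coeff a) \<noteq> 0"
        using eval_ac_nonzero[of "lead_coeff a"] ab0 by auto
      have "val (emb t1) (lead_coeff a) \<noteq> 0" using t1 by (simp add: val_def emb_def)
      moreover have LPs: "disc \<in> LP" "(\<lambda>v. val v (lead_coeff a)) \<in> LP"
        by (rule PF_imp_LP[OF discPF], rule PF_imp_LP[OF lcPF])
      moreover have "disc v0 \<noteq> 0" using dist0 disc_iff by blast
      ultimately have "\<not> (\<forall>v. disc v * val v (lead_coeff a) = 0)"
        using LP_domain[of disc "\<lambda>v. val v (lead_coeff a)" v0 "emb t1"] by blast
      then show ?thesis using that by auto
    qed
    let ?A = "map_poly (val v) a"
    have "coeff ?A (degree a) \<noteq> 0" using v(2) by (simp add: rhom.coeff_hom[OF homv])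
    then have A0: "?A \<noteq> 0" by auto
    have "set (map \<theta> (points ps v)) \<subseteq> {x. poly ?A x = 0}"
    proof
      fix x assume "x \<in> set (map \<theta> (points ps v))"
      then obtain v' where v': "v' \<in> set (points ps v)" "x = \<theta> v'" by auto
      then have "on_tower ps v'" unfolding set_points[OF tw] by blast
      then have "poly (map_poly (val v') a) x = 0" using zero v'(2) by simp
      moreover have "v' (TV l) = v (TV l)" for l
        using tv by (intro on[OF v'(1)]) (auto simp: I_def)
      then have "val v' = val v" by (simp add: val_def)
      ultimately show "x \<in> {x. poly ?A x = 0}" by simp
    qed
    then have "card (set (map \<theta> (points ps v))) \<le> card {x. poly ?A x = 0}"
      by (rule card_mono[OF poly_roots_finite[OF A0]])
    also have "\<dots> \<le> degree ?A" by (rule card_poly_roots_bound[OF A0])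
    also have "\<dots> \<le> degree a" by (rule rhom.degree_map_poly_hom_le[OF homv])
    also have "card (set (map \<theta> (points ps v))) = n"
      using v(1) distinct_card[of "map \<theta> (points ps v)"] by (simp add: disc_iff n(2) del: set_map)
    finally show ?thesis using deg by simp
  qed
  define f where "f = map_poly to_fract fh"
  have fdeg: "degree f = n" by (simp add: f_def degree_map_poly_to_fract fhdeg)
  \<comment> \<open>Clearing denominators costs a constant factor and leaves the degrees alone. The
    factors may involve all indeterminates, so this serves both
    \<open>irreducible_over (ratfuns N)\<close> and irreducibility over the full fraction field,
    from which separability is deduced.\<close>
  have f_factor: "degree a = 0 \<or> degree b = 0" if fab: "f = a * b" for a b
  proof -
    obtain D a' where a': "D \<noteq> 0" "smult (to_fract D) a = map_poly to_fract a'"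
      by (rule clear_denominators)
    obtain D2 b' where b': "D2 \<noteq> 0" "smult (to_fract D2) b = map_poly to_fract b'"
      by (rule clear_denominators)
    have dega: "degree a = degree a'"
      using arg_cong[OF a'(2), of degree] a'(1) by (simp add: degree_map_poly_to_fract)
    have degb: "degree b = degree b'"
      using arg_cong[OF b'(2), of degree] b'(1) by (simp add: degree_map_poly_to_fract)
    have "map_poly to_fract (a' * b') = map_poly to_fract (smult (D * D2) fh)"
    proof -
      have "map_poly to_fract (a' * b') = smult (to_fract D) a * smult (to_fract D2) b"
        by (simp only: rhom.hom_mult[OF rhom.map_poly_hom[OF rhom_to_fract]] a'(2) b'(2))
      also have "\<dots> = smult (to_fract (D * D2)) f"
        by (simp add: fab mult.commute)
      also have "\<dots> = map_poly to_fract (smult (D * D2) fh)"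
        unfolding f_def
        by (rule poly_eqI) (simp add: rhom.coeff_hom[OF rhom_to_fract] rhom.hom_mult[OF rhom_to_fract])
      finally show ?thesis .
    qed
    then have eq: "smult (D * D2) fh = a' * b'" by (simp only: map_poly_to_fract_eq_iff)
    have D0: "D * D2 \<noteq> 0" using a'(1) b'(1) by simp
    have "poly (map_poly (val v) a') (\<theta> v) * poly (map_poly (val v) b') (\<theta> v) = 0"
      if v: "on_tower ps v" for v
    proof -
      have "v \<in> set (points ps v)" using v by (simp add: set_points[OF tw])
      then have "poly (fp v) (\<theta> v) = 0"
        unfolding fp_def poly_root_prod_eq_0_iff by simp
      moreover have "map_poly (val v) a' * map_poly (val v) b' = smult (val v (D * D2)) (fp v)"
      proof -
        have "map_poly (val v) a' * map_poly (val v) b' = map_poly (val v) (smult (D * D2) fh)"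
          by (simp only: eq rhom.hom_mult[OF rhom.map_poly_hom[OF homv]])
        also have "\<dots> = smult (val v (D * D2)) (map_poly (val v) fh)"
          by (rule poly_eqI) (simp add: rhom.coeff_hom[OF homv] rhom.hom_mult[OF homv])
        finally show ?thesis by (simp only: valfh)
      qed
      ultimately show ?thesis by (metis mult_zero_right poly_mult poly_smult)
    qed
    then have "(\<forall>v. on_tower ps v \<longrightarrow> poly (map_poly (val v) a') (\<theta> v) = 0) \<or>
        (\<forall>v. on_tower ps v \<longrightarrow> poly (map_poly (val v) b') (\<theta> v) = 0)"
      by (rule irr[OF hPF hPF])
    then show ?thesis
      unfolding dega degb
    proof
      assume "\<forall>v. on_tower ps v \<longrightarrow> poly (map_poly (val v) a') (\<theta> v) = 0"
      then have "degree b' = 0" by (rule half[OF eq D0])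
      then show "degree a' = 0 \<or> degree b' = 0" ..
    next
      assume "\<forall>v. on_tower ps v \<longrightarrow> poly (map_poly (val v) b') (\<theta> v) = 0"
      then have "degree a' = 0" by (rule half[OF trans[OF eq mult.commute] D0])
      then show "degree a' = 0 \<or> degree b' = 0" ..
    qed
  qed
  have f_over: "f \<in> polys_over (ratfuns N)"
  proof -
    have "coeff fh i \<in> mpolys N" for i
      by (simp add: fhc q(1) mpolys_0 mpolys_1)
    then have "\<exists>p r. coeff f i = Fract p r \<and> p \<in> mpolys N \<and> r \<in> mpolys N \<and> r \<noteq> 0" for i
      unfolding f_def rhom.coeff_hom[OF rhom_to_fract] to_fract_def
      using mpolys_1 zero_neq_one by metis
    then show ?thesis
      unfolding polys_over_def ratfuns_def by blast
  qed
  have irr_f: "irreducible_over (ratfuns N) f"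
    unfolding irreducible_over_def using f_over fdeg n(1) f_factor by auto
  have "irreducible f"
  proof (rule irreducibleI)
    show f0: "f \<noteq> 0" using fdeg n(1) by auto
    show "\<not> is_unit f" using fdeg n(1) f0 by (simp add: is_unit_iff_degree)
    show "is_unit a \<or> is_unit b" if ab: "f = a * b" for a b
      using f_factor[OF ab] f0 ab by (auto simp: is_unit_iff_degree)
  qed
  moreover have "pderiv f \<noteq> 0"
  proof
    assume "pderiv f = 0"
    then have "map_poly to_fract (pderiv fh) = map_poly to_fract 0"
      by (simp add: f_def rhom.map_poly_hom_pderiv[OF rhom_to_fract])
    then have "pderiv fh = 0" by (simp only: map_poly_to_fract_eq_iff)
    then have "map_poly (val v) (pderiv fh) = 0" for v by simp
    then have pd0: "pderiv (fp v) = 0" for v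
      by (simp add: rhom.map_poly_hom_pderiv[OF homv] valfh)
    obtain v' vs where "points ps v0 = v' # vs" using n by (metis length_0_conv less_irrefl list.exhaust)
    then have "disc v0 = 0" by (simp add: disc_def pd0)
    then show False using dist0 disc_iff by blast
  qed
  ultimately have sep_f: "separable_poly f" by (rule separable_poly_if_pderiv_nonzero)
  \<comment> \<open>The discriminant as a polynomial in the \<open>N\<close> parameters. Requiring
    \<open>g\<close> to be nonzero at \<open>t\<close> keeps the points over \<open>t\<close>
    distinct.\<close>
  obtain g where g: "g \<in> mpolys N" "\<And>t. eval_ac t g = disc (emb_below N t)"
    by (rule emb_below_mpoly[OF discPF]) blast
  have disccong: "disc v \<noteq> 0 \<longleftrightarrow> disc w \<noteq> 0" if "\<And>i. i \<in> S \<Longrightarrow> v i = w i" for v w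
  proof -
    have "map \<theta> (points ps v) = map \<theta> (points ps w)" by (rule cong) (rule that)
    then show ?thesis by (simp only: disc_iff)
  qed
  have "g \<noteq> 0"
  proof
    assume "g = 0"
    then have "disc (emb_below N (\<lambda>l. v0 (TV l))) = 0"
      using g(2)[of "\<lambda>l. v0 (TV l)"] by (simp add: rhom.hom_0[OF rhom_eval_ac])
    moreover have "disc v0 \<noteq> 0" using dist0 disc_iff by blast
    moreover have "disc (emb_below N (\<lambda>l. v0 (TV l))) \<noteq> 0 \<longleftrightarrow> disc v0 \<noteq> 0"
      by (rule disccong) (auto simp: S_def emb_below_def)
    ultimately show False by blast
  qed
  have "\<exists>t. mpoly_eval t g \<noteq> 0 \<and> (\<forall>i<1::nat. \<exists>h. specializes_to N t f h \<and> irreducible h)"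
    using hil[unfolded hilbertian_def, rule_format, OF N order.refl g(1), of "\<lambda>_. f"] irr_f sep_f \<open>g \<noteq> 0\<close>
    by blast
  then obtain t h where t: "mpoly_eval t g \<noteq> 0" "specializes_to N t f h" "irreducible h" by auto
  define T where "T l = to_ac (t l)" for l
  have evT: "eval_ac T p = to_ac (mpoly_eval t p)" for p
    unfolding T_def by (rule eval_ac_to_ac)
  have "disc (emb T) \<noteq> 0 \<longleftrightarrow> disc (emb_below N T) \<noteq> 0"
    by (rule disccong) (auto simp: S_def emb_def emb_below_def)
  also have "disc (emb_below N T) \<noteq> 0" using t(1) by (simp add: evT flip: g(2))
  finally have distT: "distinct (map \<theta> (points ps (emb T)))" by (simp only: disc_iff)
  \<comment> \<open>\<open>ratfun_value\<close> admits any representation p / r with r(t) nonzero.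
    Cross-multiplication with the denominator 1 shows that the value is always that of
    \<open>coeff fh j\<close>.\<close>
  have hT: "map_poly to_ac h = fp (emb T)"
  proof (rule poly_eqI)
    fix j
    obtain p r where pr: "coeff f j = Fract p r" "mpoly_eval t r \<noteq> 0"
        "coeff h j = mpoly_eval t p / mpoly_eval t r"
      using t(2) unfolding specializes_to_def ratfun_value_def by blast
    have r0: "r \<noteq> 0" using pr(2) by (auto simp: mpoly_eval_def)
    have "Fract (coeff fh j) 1 = Fract p r"
      using pr(1) by (simp add: f_def rhom.coeff_hom[OF rhom_to_fract] to_fract_def)
    then have "p = coeff fh j * r" using r0 by (simp add: eq_fract)
    then have "to_ac (mpoly_eval t p) = to_ac (mpoly_eval t (coeff fh j)) * to_ac (mpoly_eval t r)"
      by (simp add: rhom.hom_mult[OF rhom_eval_ac] flip: evT)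
    then have "to_ac (coeff h j) = to_ac (mpoly_eval t (coeff fh j))"
      using pr(2) by (simp add: pr(3))
    also have "\<dots> = coeff (map_poly (eval_ac T) fh) j"
      by (simp add: rhom.coeff_hom[OF rhom_eval_ac] evT)
    also have "map_poly (eval_ac T) fh = fp (emb T)" by (rule fh_eval) (simp add: emb_def)
    finally show "coeff (map_poly to_ac h) j = coeff (fp (emb T)) j"
      by (simp add: rhom.coeff_hom[OF rhom_to_ac])
  qed
  show ?thesis
  proof (rule that[of t, folded T_def])
    show "distinct (points ps (emb T))" using distT by (simp add: distinct_map)
    fix v w assume v: "v \<in> set (points ps (emb T))" and w: "w \<in> set (points ps (emb T))"
    have "poly (map_poly to_ac h) (\<theta> v) = 0" "poly (map_poly to_ac h) (\<theta> w) = 0"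
      unfolding hT fp_def poly_root_prod_eq_0_iff using v w by simp_all
    then obtain \<sigma> where s: "\<sigma> \<in> gal" "\<sigma> (\<theta> v) = \<theta> w"
      by (rule gal_transitive_on_roots[OF t(3)])
    \<comment> \<open>The parameters \<open>T\<close> lie in k and are fixed by \<sigma>, so the
      moved tuple is again a point over them; having the same \<theta>-value as \<open>w\<close> it
      must be \<open>w\<close>.\<close>
    let ?v = "\<lambda>i. \<sigma> (v i)"
    have "on_tower ps v" using v unfolding set_points[OF tw] by blast
    then have "on_tower ps ?v" by (rule on_tower_gal[OF tw s(1)])
    moreover have "\<sigma> (v i) = emb T i" if "i \<notin> fst ` set ps" for i
    proof -
      have "v i = emb T i" using that by (intro on[OF v]) (simp add: I_def)
      then show ?thesis by (cases i) (simp_all add: emb_def T_def s(1) rhom.hom_0[OF rhom_gal])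
    qed
    ultimately have "?v \<in> set (points ps (emb T))" unfolding set_points[OF tw] by blast
    moreover have "\<theta> ?v = \<theta> w" using PF_gal[OF \<theta>PF s(1), of v] s(2) by simp
    ultimately have "?v = w" using distT w by (auto simp: distinct_map inj_on_def)
    then show "\<exists>\<sigma>\<in>gal. \<forall>j\<in>fst ` set ps. \<sigma> (v j) = w j" using s(1) by (metis (no_types))
  qed
qed

section \<open>Independent generic polynomials\<close>

lemma tower_append: "tower S (xs @ ys) \<longleftrightarrow> tower S xs \<and> tower (S \<union> fst ` set xs) ys"
  by (induction xs arbitrary: S) (auto simp: Un_insert_left Un_insert_right)

section \<open>Successive division of a monic polynomial by linear factors\<close>

lemma synthetic_div_mult:
  fixes q :: "'b::idom poly"
  shows "synthetic_div ([:- c, 1:] * q) c = q"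
proof -
  have "[:- c, 1:] * synthetic_div ([:- c, 1:] * q) c = [:- c, 1:] * q"
    using synthetic_div_correct'[of c "[:- c, 1:] * q"] by simp
  then show ?thesis by (simp only: mult_cancel_left) simp
qed

lemma lead_coeff_synthetic_div:
  fixes p :: "'b::idom poly"
  assumes "degree p > 0" shows "lead_coeff (synthetic_div p c) = lead_coeff p"
proof -
  have d: "degree (synthetic_div p c) = degree p - 1" by (rule degree_synthetic_div)
  have "degree (poly_shift (degree p) p) = 0"
    by (rule antisym[OF degree_le]) (auto simp: coeff_poly_shift coeff_eq_0)
  then obtain a where a: "poly_shift (degree p) p = [:a:]" by (rule degree_eq_zeroE)
  have "a = lead_coeff p" using arg_cong[OF a, of "\<lambda>q. coeff q 0"] by (simp add: coeff_poly_shift)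
  then show ?thesis using assms unfolding d coeff_synthetic_div by (simp add: a)
qed

text \<open>The Cauchy moduli of \<open>p\<close>: each stage divides by X - x i and drops the
  remainder. The result is monic of degree n - i for every \<open>x\<close>, root or not, as the
  definition of \<open>tower\<close> demands for all arguments.\<close>

fun divided :: "'b::comm_ring_1 poly \<Rightarrow> (nat \<Rightarrow> 'b) \<Rightarrow> nat \<Rightarrow> 'b poly" where
  "divided p x 0 = p"
| "divided p x (Suc i) = synthetic_div (divided p x i) (x i)"

lemma divided_cong: "(\<And>l. l < i \<Longrightarrow> x l = x' l) \<Longrightarrow> divided p x i = divided p x' i"
  by (induction i) simp_all

lemma divided_monic:
  fixes p :: "'b::idom poly"
  assumes "degree p = n" "lead_coeff p = 1" "i \<le> n"
  shows "degree (divided p x i) = n - i \<and> lead_coeff (divided p x i) = 1"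
  using assms(3)
proof (induction i)
  case (Suc i)
  then have c: "degree (divided p x i) = n - i \<and> lead_coeff (divided p x i) = 1" by (intro Suc.IH) simp
  note IH = conjunct1[OF c] conjunct2[OF c]
  have "degree (divided p x i) > 0" using Suc.prems by (simp add: IH(1))
  then have "lead_coeff (divided p x (Suc i)) = 1"
    by (simp only: divided.simps lead_coeff_synthetic_div IH(2))
  moreover have "degree (divided p x (Suc i)) = n - Suc i"
    by (simp add: degree_synthetic_div IH(1))
  ultimately show ?case by blast
qed (use assms in simp)

lemma divided_factor:
  fixes p :: "'b::idom poly"
  assumes "\<And>l. l < i \<Longrightarrow> poly (divided p x l) (x l) = 0"
  shows "p = (\<Prod>l<i. [:- x l, 1:]) * divided p x i"
  using assms
proof (induction i)
  case (Suc i)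
  have "[:- x i, 1:] * synthetic_div (divided p x i) (x i) = divided p x i"
    using synthetic_div_correct'[of "x i" "divided p x i"] Suc.prems[of i] by simp
  moreover have "p = (\<Prod>l<i. [:- x l, 1:]) * divided p x i" using Suc by simp
  ultimately show ?case by (simp only: prod.lessThan_Suc divided.simps mult.assoc)
qed simp

text \<open>It replaces the symmetric condition that \<open>x\<close> lists all roots with
  multiplicity by triangular equations, each monic in the next unknown.\<close>

lemma divided_roots_iff:
  fixes p :: "'b::idom poly"
  assumes "degree p = n" "lead_coeff p = 1"
  shows "(\<forall>i<n. poly (divided p x i) (x i) = 0) \<longleftrightarrow> p = (\<Prod>l<n. [:- x l, 1:])"
proof
  assume "\<forall>i<n. poly (divided p x i) (x i) = 0"
  then have "p = (\<Prod>l<n. [:- x l, 1:]) * divided p x n" by (intro divided_factor) blast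
  moreover have "divided p x n = 1"
  proof -
    note dm = divided_monic[OF assms order.refl, of x]
    have "degree (divided p x n) = 0" using conjunct1[OF dm] by simp
    then obtain c where "divided p x n = [:c:]" by (rule degree_eq_zeroE)
    then show ?thesis using conjunct2[OF dm] by simp
  qed
  ultimately show "p = (\<Prod>l<n. [:- x l, 1:])" by simp
next
  assume p: "p = (\<Prod>l<n. [:- x l, 1:])"
  have split: "(\<Prod>l\<in>{i..<n}. [:- x l, 1:]) = [:- x i, 1:] * (\<Prod>l\<in>{Suc i..<n}. [:- x l, 1:])" if "i < n" for i
    using that by (simp add: prod.atLeast_Suc_lessThan del: mult_pCons_left)
  have "divided p x i = (\<Prod>l\<in>{i..<n}. [:- x l, 1:])" if "i \<le> n" for i
    using that
  proof (induction i)
    case 0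
    show ?case by (simp add: p atLeast0LessThan)
  next
    case (Suc i)
    then show ?case using split[of i] by (simp only: divided.simps synthetic_div_mult Suc_le_lessD less_imp_le)
  qed
  then show "\<forall>i<n. poly (divided p x i) (x i) = 0"
    using split by (simp del: mult_pCons_left)
qed

lemma SP_divided:
  assumes "P \<in> SP" shows "(\<lambda>v. divided (P v) (\<lambda>i. v (f i)) i) \<in> SP"
  by (induction i) (simp_all add: assms SP_synthetic_div PF_coord)

lemma monic_poly_altdef:
  fixes c :: "nat \<Rightarrow> 'b::comm_ring_1" and n :: nat
  defines "p \<equiv> monom 1 n + (\<Sum>i<n. monom (c i) i)"
  shows "coeff p i = (if i < n then c i else if i = n then 1 else 0)"
    and "degree p = n" and "lead_coeff p = 1"
proof -
  show c: "coeff p i = (if i < n then c i else if i = n then 1 else 0)" for i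
    by (simp add: p_def coeff_sum)
  show d: "degree p = n"
    by (rule antisym[OF degree_le le_degree]) (simp_all add: c)
  show "lead_coeff p = 1" unfolding d by (simp add: c)
qed

lemma prod_linear_monic:
  fixes x :: "nat \<Rightarrow> 'b::idom"
  shows "degree (\<Prod>l<n. [:- x l, 1:]) = n" "coeff (\<Prod>l<n. [:- x l, 1:]) n = 1"
proof -
  show d: "degree (\<Prod>l<n. [:- x l, 1:]) = n" by (simp add: degree_prod_eq_sum_degree)
  have "lead_coeff (\<Prod>l<n. [:- x l, 1:]) = 1" by (simp add: lead_coeff_prod)
  then show "coeff (\<Prod>l<n. [:- x l, 1:]) n = 1" unfolding d .
qed

lemma monic_factorization:
  fixes p :: "'b::alg_closed_field poly"
  assumes "degree p = n" "lead_coeff p = 1"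
  shows "\<exists>x. p = (\<Prod>i<n. [:- x i, 1:]) \<and> (rsquarefree p \<longrightarrow> inj_on x {..<n})"
proof -
  let ?rs = "roots_of p"
  have len: "length ?rs = n" using length_roots_of[OF assms(2)] assms(1) by simp
  have "map (\<lambda>i. [:- ?rs ! i, 1:]) [0..<n] = map (\<lambda>a. [:- a, 1:]) ?rs"
    by (rule nth_equalityI) (simp_all add: len)
  then have "root_prod ?rs = (\<Prod>i\<leftarrow>[0..<n]. [:- ?rs ! i, 1:])" by simp
  also have "\<dots> = (\<Prod>i<n. [:- ?rs ! i, 1:])"
    by (simp only: prod.distinct_set_conv_list[symmetric, OF distinct_upt] set_upt atLeast0LessThan)
  finally have "p = (\<Prod>i<n. [:- ?rs ! i, 1:])" by (simp only: root_prod_roots_of[OF assms(2)])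
  moreover have "inj_on (\<lambda>i. ?rs ! i) {..<n}" if "rsquarefree p"
  proof -
    have "rsquarefree (root_prod ?rs)" using that by (simp only: root_prod_roots_of[OF assms(2)])
    then have "distinct ?rs" by (simp only: rsquarefree_root_prod_iff)
    then show ?thesis by (intro inj_onI) (simp add: nth_eq_iff_index_eq len)
  qed
  ultimately show ?thesis by blast
qed

text \<open>The coefficients lie in k[b] through fixed polynomials \<tau>, so conjugating the
  polynomial amounts to conjugating \<open>b\<close> (\<open>gal_spec_poly\<close>).\<close>

definition spec_poly :: "nat \<Rightarrow> (nat \<Rightarrow> 'a::field poly) \<Rightarrow> 'a alg_closure \<Rightarrow> 'a alg_closure poly" where
  "spec_poly n \<tau> b = monom 1 n + (\<Sum>i<n. monom (poly (map_poly to_ac (\<tau> i)) b) i)"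

lemma coeff_spec_poly:
  "coeff (spec_poly n \<tau> b) i = (if i < n then poly (map_poly to_ac (\<tau> i)) b else if i = n then 1 else 0)"
  unfolding spec_poly_def by (rule monic_poly_altdef(1))

lemma spec_poly_monic: "degree (spec_poly n \<tau> b) = n" "lead_coeff (spec_poly n \<tau> b) = 1"
  unfolding spec_poly_def by (rule monic_poly_altdef)+

lemma spec_poly_over:
  assumes F: "subring_over F" and "b \<in> F" shows "spec_poly n \<tau> b \<in> polys_over F"
proof -
  have "coeff (spec_poly n \<tau> b) i \<in> F" for i
    unfolding coeff_spec_poly
    by (simp add: subring_0[OF F] subring_1[OF F] poly_in_subring[OF F polys_over_map_to_ac[OF F] assms(2)])
  then show ?thesis by (simp add: polys_over_def)
qed

lemma gal_spec_poly:
  assumes "\<sigma> \<in> gal" shows "map_poly \<sigma> (spec_poly n \<tau> b) = spec_poly n \<tau> (\<sigma> b)"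
  by (rule poly_eqI) (simp add: rhom.coeff_hom[OF rhom_gal[OF assms]] coeff_spec_poly
      gal_poly_to_ac[OF assms] rhom.hom_1[OF rhom_gal[OF assms]] rhom.hom_0[OF rhom_gal[OF assms]])

text \<open>The tower consists of a conjugate of \<open>C\<close> followed, for each
  \<open>r\<close>, by the roots of the r-th polynomial in order. Its points are therefore the pairs
  of a conjugate and a labelling of all the roots, and transitivity on points gives both
  independence from \<open>C\<close> and arbitrary simultaneous permutations. Distinctness of the
  elements \<beta> r (C) is what makes the \<open>m\<close> polynomials independent of each
  other.\<close>

theorem generic_polys:
  fixes C :: "'a::field alg_closure" and \<beta> :: "nat \<Rightarrow> 'a poly"
  assumes hil: "hilbertian TYPE('a)" and inf: "infinite (UNIV :: 'a set)"
    and C: "separable_element C" and m: "m \<ge> 1" and n: "n \<ge> 1"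
    and inj: "inj_on (\<lambda>r. poly (map_poly to_ac (\<beta> r)) C) {..<m}"
  shows "\<exists>\<tau>. (\<forall>\<sigma>\<in>gal. \<forall>r<m. rsquarefree (spec_poly n \<tau> (poly (map_poly to_ac (\<beta> r)) (\<sigma> C)))) \<and>
    (\<forall>\<sigma>\<in>gal. \<forall>\<sigma>'\<in>gal. \<forall>x x'.
       (\<forall>r<m. spec_poly n \<tau> (poly (map_poly to_ac (\<beta> r)) (\<sigma> C)) = (\<Prod>i<n. [:- x r i, 1:])) \<longrightarrow>
       (\<forall>r<m. spec_poly n \<tau> (poly (map_poly to_ac (\<beta> r)) (\<sigma>' C)) = (\<Prod>i<n. [:- x' r i, 1:])) \<longrightarrow>
       (\<exists>\<rho>\<in>gal. \<rho> (\<sigma> C) = \<sigma>' C \<and> (\<forall>r<m. \<forall>i<n. \<rho> (x r i) = x' r i)))"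
proof -
  define N where "N = m * n"
  have N: "N \<ge> 1" using m n by (simp add: N_def)
  have idx: "l * n + i < N" if "l < m" "i < n" for l i
  proof -
    have "l * n + i < Suc l * n" using that by simp
    also have "\<dots> \<le> m * n" using that by (intro mult_right_mono) simp_all
    finally show ?thesis by (simp add: N_def)
  qed
  obtain p where p: "irreducible p" "separable_poly p" "poly (map_poly to_ac p) C = 0"
    using C by (auto simp: separable_element_def)
  have p0: "p \<noteq> 0" using p(1) by (auto simp: irreducible_def)
  define Q where "Q = smult (inverse (to_ac (lead_coeff p))) (map_poly to_ac p)"
  have Q_root: "poly Q y = 0 \<longleftrightarrow> poly (map_poly to_ac p) y = 0" for y
    using p0 by (simp add: Q_def)
  have Q_lead: "lead_coeff Q = 1"
    using p0 by (simp add: Q_def rhom.coeff_hom[OF rhom_to_ac])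
  have Q_deg: "degree Q > 0"
    using degree_pos_if_root[of Q C] p(3) p0 by (simp add: Q_root) (simp add: Q_def)
  have Q_sq: "rsquarefree Q"
    using p(2) p0 unfolding separable_poly_def Q_def by (auto elim!: rsquarefree_dvd simp: smult_dvd_iff)
  have "Q = map_poly to_ac (smult (inverse (lead_coeff p)) p)"
    unfolding Q_def by (rule poly_eqI) (simp add: rhom.coeff_hom[OF rhom_to_ac])
  then have Q_SP: "(\<lambda>v :: pvar \<Rightarrow> 'a alg_closure. Q) \<in> SP"
    using SP_map_to_ac[of "smult (inverse (lead_coeff p)) p"] by simp
  define bv where "bv r y = poly (map_poly to_ac (\<beta> r)) y" for r y
  \<comment> \<open>The same N = m n parameters serve every \<open>r\<close>:
    \<open>TV (l * n + i)\<close> is the coefficient of the l-th power in the i-th coefficient, a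
    polynomial of degree below \<open>m\<close> in the value of \<beta> r. Such polynomials take
    arbitrary values at \<open>m\<close> distinct arguments.\<close>
  define gp where "gp r v = monom 1 n + (\<Sum>i<n. monom (\<Sum>l<m. v (TV (l * n + i)) * bv r (v CV) ^ l) i)"
    for r and v :: "pvar \<Rightarrow> 'a alg_closure"
  have gp_coeff: "coeff (gp r v) i =
      (if i < n then \<Sum>l<m. v (TV (l * n + i)) * bv r (v CV) ^ l else if i = n then 1 else 0)" for r v i
    unfolding gp_def by (rule monic_poly_altdef(1))
  have gp_deg: "degree (gp r v) = n" for r v unfolding gp_def by (rule monic_poly_altdef(2))
  have gp_lead: "lead_coeff (gp r v) = 1" for r v unfolding gp_def by (rule monic_poly_altdef(3))
  note gp_monic = gp_deg gp_lead
  have bvPF: "(\<lambda>v. bv r (v CV)) \<in> PF" for r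
    unfolding bv_def by (rule SP_poly[OF SP_map_to_ac PF_coord])
  have gpSP: "gp r \<in> SP" for r
    unfolding gp_def by (intro SP_add SP_sum SP_monom PF_1 PF_sum PF_mult PF_power PF_coord bvPF)
  define st where "st r i = (\<lambda>v. divided (gp r v) (\<lambda>i. v (YV r i)) i)" for r i
  have stSP: "st r i \<in> SP" for r i unfolding st_def by (rule SP_divided[OF gpSP])
  define row where "row r k = map (\<lambda>i. (YV r i, st r i)) [0..<k]" for r k
  define rows where "rows k = concat (map (\<lambda>r. row r n) [0..<k])" for k
  define ps where "ps = (CV, \<lambda>_. Q) # rows m"
  define S where "S = TV ` {..<N}"
  have fst_row: "fst ` set (row r k) = YV r ` {..<k}" for r k
    by (auto simp: row_def image_image)
  have fst_rows: "fst ` set (rows k) = {YV r i |r i. r < k \<and> i < n}" for k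
    unfolding rows_def set_concat set_map image_Union image_image
    by (auto simp: fst_row)
  have gp_dep: "gp r v = gp r w" if "v CV = w CV" "\<And>l. l < N \<Longrightarrow> v (TV l) = w (TV l)" for r v w
    unfolding gp_def using that idx by (intro arg_cong2[of _ _ _ _ "(+)"] sum.cong arg_cong2[of _ _ _ _ monom]) simp_all
  have tower_row: "tower S' (row r k)"
    if S': "insert CV S \<subseteq> S'" "YV r ` UNIV \<inter> S' = {}" and k: "k \<le> n" for S' r k
    using k
  proof (induction k)
    case 0
    show ?case by (simp add: row_def)
  next
    case (Suc k)
    have "row r (Suc k) = row r k @ [(YV r k, st r k)]" by (simp add: row_def)
    moreover have "tower (S' \<union> fst ` set (row r k)) [(YV r k, st r k)]"
    proof (simp only: tower.simps, intro conjI allI impI)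
      show "YV r k \<notin> S' \<union> fst ` set (row r k)" using S'(2) by (auto simp: fst_row)
      show "st r k \<in> SP" by (rule stSP)
      have mon: "degree (st r k v) = n - k" "lead_coeff (st r k v) = 1" for v
        using divided_monic[OF gp_monic Suc_leD[OF Suc.prems], of r v "\<lambda>i. v (YV r i)"]
        unfolding st_def by blast+
      show "\<exists>e>0. \<forall>v. degree (st r k v) = e" using mon(1) Suc.prems by (intro exI[of _ "n - k"]) simp
      show "lead_coeff (st r k v) = 1" for v by (rule mon(2))
      fix v w :: "pvar \<Rightarrow> 'a alg_closure" assume vw: "\<forall>i\<in>S' \<union> fst ` set (row r k). v i = w i"
      have "gp r v = gp r w" using vw S'(1) by (intro gp_dep) (auto simp: S_def)
      moreover have "v (YV r l) = w (YV r l)" if "l < k" for l using vw that by (auto simp: fst_row)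
      then have "divided (gp r w) (\<lambda>i. v (YV r i)) k = divided (gp r w) (\<lambda>i. w (YV r i)) k"
        by (rule divided_cong)
      ultimately show "st r k v = st r k w" unfolding st_def by simp
    qed simp
    ultimately show ?case using Suc by (simp add: tower_append)
  qed
  have tower_rows: "tower (insert CV S) (rows k)" for k
  proof (induction k)
    case 0
    show ?case by (simp add: rows_def)
  next
    case (Suc k)
    have "rows (Suc k) = rows k @ row k n" by (simp add: rows_def)
    moreover have "tower (insert CV S \<union> fst ` set (rows k)) (row k n)"
      by (rule tower_row) (auto simp: fst_rows S_def)
    ultimately show ?case using Suc by (simp only: tower_append)
  qed
  have tw: "tower S ps"
    unfolding ps_def tower.simps using Q_SP Q_lead Q_deg tower_rows by (auto simp: S_def)
  have tv: "range TV \<inter> fst ` set ps = {}"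
    using fst_rows[of m] by (auto simp: ps_def)
  have mem_ps: "(j, P) \<in> set ps \<longleftrightarrow> (j = CV \<and> P = (\<lambda>_. Q)) \<or> (\<exists>r<m. \<exists>i<n. j = YV r i \<and> P = st r i)" for j P
  proof -
    have "(j, P) \<in> set (rows m) \<longleftrightarrow> (\<exists>r\<in>{0..<m}. \<exists>i\<in>{0..<n}. (j, P) = (YV r i, st r i))"
      unfolding rows_def row_def
      by (simp only: set_concat set_map set_upt image_image UN_iff image_iff)
    then show ?thesis by (auto simp: ps_def)
  qed
  have on_tower_iff: "on_tower ps v \<longleftrightarrow> poly Q (v CV) = 0 \<and>
      (\<forall>r<m. gp r v = (\<Prod>i<n. [:- v (YV r i), 1:]))" for v
  proof -
    have "on_tower ps v \<longleftrightarrow> poly Q (v CV) = 0 \<and> (\<forall>r<m. \<forall>i<n. poly (st r i v) (v (YV r i)) = 0)"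
      unfolding on_tower_def by (auto simp: mem_ps)
    then show ?thesis
      unfolding st_def using divided_roots_iff[OF gp_monic] by simp
  qed
  define b where "b r = bv r C" for r
  define B where "B = b ` {..<m}"
  have binj: "inj_on b {..<m}" using inj unfolding inj_on_def b_def bv_def by blast
  have B: "finite B" "card B = m" unfolding B_def using binj by (simp_all add: card_image)
  txt \<open>All points over \<open>C\<close> are parametrised by free roots: the parameters are recovered from the
    coefficients of the polynomials by Lagrange interpolation at the distinct \<open>b r\<close>.\<close>
  define \<psi> where "\<psi> s i = (case i of
      TV k \<Rightarrow> if k < N then \<Sum>r<m. coeff (lagrange B (b r)) (k div n) * coeff (\<Prod>j<n. [:- s (YV r j), 1:]) (k mod n)
              else s (TV k)
    | CV \<Rightarrow> C | YV r j \<Rightarrow> s (YV r j))" for s :: "pvar \<Rightarrow> 'a alg_closure" and i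
  have \<psi>LP: "(\<lambda>s. \<psi> s i) \<in> LP" for i
  proof -
    have lin: "(\<lambda>s. coeff [:- s (YV r j), 1:] k) \<in> LP" for r j k
    proof (cases k)
      case 0
      then show ?thesis using LP_diff[OF LP_const[of 0] LP_coord[of "YV r j"]] by simp
    next
      case (Suc k')
      then show ?thesis by (simp add: LP_const)
    qed
    have "(\<lambda>s. coeff (\<Prod>j<n. [:- s (YV r j), 1:]) k) \<in> LP" for r k
      by (rule LP_poly_prod) (simp, rule lin)
    then have "(\<lambda>s. \<Sum>r<m. coeff (lagrange B (b r)) k * coeff (\<Prod>j<n. [:- s (YV r j), 1:]) l) \<in> LP" for k l
      by (intro LP_sum LP_mult LP_const)
    then have "(\<lambda>s. \<psi> s (TV k)) \<in> LP" for k
      by (cases "k < N") (simp_all add: \<psi>_def LP_coord)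
    moreover have "(\<lambda>s. \<psi> s CV) \<in> LP" "(\<lambda>s. \<psi> s (YV r j)) \<in> LP" for r j
      by (simp_all add: \<psi>_def LP_const LP_coord)
    ultimately show ?thesis by (cases i) simp_all
  qed
  have \<psi>on: "on_tower ps (\<psi> s)" for s
    unfolding on_tower_iff
  proof (intro conjI allI impI poly_eqI)
    show "poly Q (\<psi> s CV) = 0" using p(3) by (simp add: \<psi>_def Q_root)
    fix r i assume r: "r < m"
    define e where "e r i = coeff (\<Prod>j<n. [:- s (YV r j), 1:]) i" for r i
    have main: "(\<Sum>l<m. \<psi> s (TV (l * n + i)) * b r ^ l) = e r i" if i: "i < n"
    proof -
      have "(\<Sum>l<m. \<psi> s (TV (l * n + i)) * b r ^ l) =
          (\<Sum>l<m. (\<Sum>r'<m. coeff (lagrange B (b r')) l * e r' i) * b r ^ l)"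
        using idx i by (intro sum.cong) (simp_all add: \<psi>_def e_def)
      also have "\<dots> = (\<Sum>r'<m. e r' i * (\<Sum>l<m. coeff (lagrange B (b r')) l * b r ^ l))"
        by (simp add: sum_distrib_left sum_distrib_right mult_ac) (rule sum.swap)
      also have "\<dots> = (\<Sum>r'<m. e r' i * poly (lagrange B (b r')) (b r))"
      proof (rule sum.cong[OF refl])
        fix r' assume "r' \<in> {..<m}"
        then have "degree (lagrange B (b r')) \<le> m - 1"
          using degree_lagrange[OF B(1), of "b r'"] B(2) by (auto simp: B_def)
        then have "poly (lagrange B (b r')) (b r) = (\<Sum>l\<le>m - 1. coeff (lagrange B (b r')) l * b r ^ l)"
          by (rule poly_altdef_le)
        also have "{..m - 1} = {..<m}" using m by auto
        finally show "e r' i * (\<Sum>l<m. coeff (lagrange B (b r')) l * b r ^ l) = e r' i * poly (lagrange B (b r')) (b r)"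
          by simp
      qed
      also have "\<dots> = (\<Sum>r'<m. if r' = r then e r' i else 0)"
      proof (rule sum.cong[OF refl])
        fix r' assume r': "r' \<in> {..<m}"
        have "b r = b r' \<longleftrightarrow> r = r'" using inj_on_eq_iff[OF binj, of r r'] r r' by simp
        then show "e r' i * poly (lagrange B (b r')) (b r) = (if r' = r then e r' i else 0)"
          using poly_lagrange[OF B(1), of "b r'" "b r"] r r' by (auto simp: B_def)
      qed
      also have "\<dots> = e r i" using r by simp
      finally show ?thesis .
    qed
    have "\<psi> s CV = C" "\<And>j. \<psi> s (YV r j) = s (YV r j)" by (simp_all add: \<psi>_def)
    then show "coeff (gp r (\<psi> s)) i = coeff (\<Prod>i<n. [:- \<psi> s (YV r i), 1:]) i"
      using main prod_linear_monic[where n = n and x = "\<lambda>j. s (YV r j)"]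
      by (simp add: gp_coeff b_def[symmetric] e_def coeff_eq_0)
  qed
  have \<psi>surj: "\<psi> v = v" if v: "on_tower ps v" "v CV = C" for v
  proof
    fix i
    show "\<psi> v i = v i"
    proof (cases i)
      case (TV k)
      show ?thesis
      proof (cases "k < N")
        case True
        define l j where "l = k div n" and "j = k mod n"
        have lj: "l < m" "j < n" "k = l * n + j"
          using True n by (simp_all add: l_def j_def N_def less_mult_imp_div_less)
        define tp where "tp = (\<Sum>l<m. monom (v (TV (l * n + j))) l)"
        have tpc: "coeff tp l = (if l < m then v (TV (l * n + j)) else 0)" for l
          by (simp add: tp_def coeff_sum)
        have "degree tp \<le> m - 1" using m by (intro degree_le) (auto simp: tpc)
        then have tpd: "degree tp < card B" using m B(2) by simp
        have val: "poly tp (b r) = coeff (\<Prod>j<n. [:- v (YV r j), 1:]) j" if r: "r < m" for r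
        proof -
          have "poly tp (b r) = (\<Sum>l<m. v (TV (l * n + j)) * b r ^ l)"
            by (simp add: tp_def poly_sum poly_monom)
          also have "\<dots> = coeff (gp r v) j" using lj(2) v(2) by (simp add: gp_coeff b_def)
          finally show ?thesis using v(1) r unfolding on_tower_iff by simp
        qed
        have "tp = (\<Sum>a\<in>B. smult (poly tp a) (lagrange B a))"
          by (rule lagrange_interpolation[OF B(1) tpd])
        also have "\<dots> = (\<Sum>r<m. smult (poly tp (b r)) (lagrange B (b r)))"
          unfolding B_def using binj by (simp add: sum.reindex)
        finally have eq: "tp = (\<Sum>r<m. smult (poly tp (b r)) (lagrange B (b r)))" .
        have "coeff tp l = (\<Sum>r<m. poly tp (b r) * coeff (lagrange B (b r)) l)"
          using arg_cong[OF eq, of "\<lambda>q. coeff q l"] by (simp only: coeff_sum coeff_smult)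
        also have "\<dots> = \<psi> v i"
          using True by (simp add: \<psi>_def TV val l_def[symmetric] j_def[symmetric] mult.commute)
        finally show ?thesis using lj TV by (simp add: tpc)
      qed (simp add: \<psi>_def TV)
    qed (simp_all add: \<psi>_def v(2))
  qed
  have orbit: "\<exists>\<sigma>\<in>gal. \<sigma> y = C" if "poly Q y = 0" for y
    using gal_transitive_on_roots[OF p(1), of y C] that p(3) by (metis Q_root)
  \<comment> \<open>The parametrisation only reaches points over \<open>C\<close> itself. Other
    points are moved there by an automorphism, with which \<open>h\<close> commutes because its
    constants lie in k.\<close>
  have vanish: "h v = 0" if h: "h \<in> PF" "\<And>s. h (\<psi> s) = 0" and v: "on_tower ps v" for h v
  proof -
    obtain \<sigma> where s: "\<sigma> \<in> gal" "\<sigma> (v CV) = C" using orbit v unfolding on_tower_iff by blast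
    have "on_tower ps (\<lambda>i. \<sigma> (v i))" by (rule on_tower_gal[OF tw s(1) v])
    then have "h (\<lambda>i. \<sigma> (v i)) = 0" using \<psi>surj[of "\<lambda>i. \<sigma> (v i)"] s(2) h(2)[of "\<lambda>i. \<sigma> (v i)"] by simp
    then have "\<sigma> (h v) = \<sigma> 0" by (simp add: PF_gal[OF h(1) s(1)] rhom.hom_0[OF rhom_gal[OF s(1)]])
    then show ?thesis by (simp only: gal_inj[OF s(1)])
  qed
  have irr: "(\<forall>v. on_tower ps v \<longrightarrow> h1 v = 0) \<or> (\<forall>v. on_tower ps v \<longrightarrow> h2 v = 0)"
    if h: "h1 \<in> PF" "h2 \<in> PF" "\<And>v. on_tower ps v \<Longrightarrow> h1 v * h2 v = 0" for h1 h2
  proof (cases "\<forall>s. h1 (\<psi> s) = 0")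
    case True
    then show ?thesis using vanish[OF h(1)] by blast
  next
    case False
    then obtain s where s: "h1 (\<psi> s) \<noteq> 0" by blast
    have "h2 (\<psi> w) = 0" for w
      by (rule LP_domain[OF LP_PF[OF h(1) \<psi>LP] LP_PF[OF h(2) \<psi>LP], where u = s]) (use h(3) \<psi>on s in auto)
    then show ?thesis using vanish[OF h(2)] by blast
  qed
  obtain x0 :: "nat \<Rightarrow> 'a" where x0: "inj x0"
    using infinite_countable_subset[OF inf] by blast
  txt \<open>At \<open>v0\<close> all the generic polynomials specialise to the same separable polynomial over \<open>k\<close>.\<close>
  define p0' where "p0' = (\<Prod>l<n. [:- to_ac (x0 l), 1:])"
  define v0 :: "pvar \<Rightarrow> 'a alg_closure" where "v0 = emb (\<lambda>k. if k < n then coeff p0' k else 0)"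
  have p0sq: "rsquarefree p0'"
  proof -
    have injx: "inj_on (\<lambda>l. to_ac (x0 l)) {..<n}"
      using x0 by (intro inj_onI) (simp add: inj_eq)
    have "p0' = (\<Prod>a\<in>(\<lambda>l. to_ac (x0 l)) ` {..<n}. [:- a, 1:])"
      unfolding p0'_def prod.reindex[OF injx] comp_def ..
    then show ?thesis by (simp add: rsquarefree_prod_linear)
  qed
  have "distinct (points ps v0)"
  proof (rule distinct_points[OF tw])
    fix v j P assume v: "v \<in> set (points ps v0)" and jP: "(j, P) \<in> set ps"
    have on: "on_tower ps v" and same: "\<And>k. v (TV k) = v0 (TV k)"
      using v tv unfolding set_points[OF tw] by blast+
    have mon: "lead_coeff (P v) = 1" by (rule tower_monic[OF tw jP])
    \<comment> \<open>As \<open>v0\<close> vanishes on \<open>TV k\<close> for k \<ge> n, only the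
      terms with l = 0 survive, and these do not involve the value of \<beta> r.\<close>
    have gp0: "gp r v = p0'" for r
    proof (rule poly_eqI)
      fix i
      have "(\<Sum>l<m. v (TV (l * n + i)) * bv r (v CV) ^ l) = coeff p0' i" if i: "i < n"
      proof -
        have "(\<Sum>l<m. v (TV (l * n + i)) * bv r (v CV) ^ l) = (\<Sum>l<m. if l = 0 then coeff p0' i else 0)"
        proof (rule sum.cong[OF refl])
          fix l
          have "\<not> l * n + i < n" if "l \<noteq> 0" using that by (cases l) auto
          then show "v (TV (l * n + i)) * bv r (v CV) ^ l = (if l = 0 then coeff p0' i else 0)"
            using i by (simp add: same v0_def emb_def)
        qed
        then show ?thesis using m by simp
      qed
      then show "coeff (gp r v) i = coeff p0' i"
        using prod_linear_monic[where n = n and x = "\<lambda>l. to_ac (x0 l)", folded p0'_def]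
        by (simp add: gp_coeff coeff_eq_0)
    qed
    have "rsquarefree (P v)"
      using jP unfolding mem_ps
    proof (elim disjE exE conjE)
      show ?thesis if "P = (\<lambda>_. Q)" using Q_sq by (simp add: that)
      fix r i assume r: "r < m" "i < n" "j = YV r i" "P = st r i"
      have "poly (divided (gp r v) (\<lambda>i. v (YV r i)) l) (v (YV r l)) = 0" if "l < i" for l
        using on r(1,2) that divided_roots_iff[OF gp_monic, where x = "\<lambda>i. v (YV r i)", of r v]
        unfolding on_tower_iff by simp
      then have "gp r v = (\<Prod>l<i. [:- v (YV r l), 1:]) * st r i v"
        unfolding st_def by (rule divided_factor)
      then have "st r i v dvd p0'" using gp0 by (metis dvd_triv_right)
      then show ?thesis using rsquarefree_dvd[OF p0sq] r(4) by simp
    qed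
    then show "distinct (roots_of (P v))"
      using rsquarefree_root_prod_iff[of "roots_of (P v)"] by (simp only: root_prod_roots_of[OF mon])
  qed
  then obtain t where t: "distinct (points ps (emb (\<lambda>l. to_ac (t l))))"
    and trans: "\<And>v w. v \<in> set (points ps (emb (\<lambda>l. to_ac (t l)))) \<Longrightarrow>
       w \<in> set (points ps (emb (\<lambda>l. to_ac (t l)))) \<Longrightarrow> \<exists>\<sigma>\<in>gal. \<forall>j\<in>fst ` set ps. \<sigma> (v j) = w j"
    using tower_hilbert[OF hil inf N tw[unfolded S_def] tv irr] by blast
  define \<tau> where "\<tau> i = (\<Sum>l<m. monom (t (l * n + i)) l)" for i
  have \<tau>val: "poly (map_poly to_ac (\<tau> i)) z = (\<Sum>l<m. to_ac (t (l * n + i)) * z ^ l)" for i z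
  proof -
    have "map_poly to_ac (\<tau> i) = (\<Sum>l<m. monom (to_ac (t (l * n + i))) l)"
      unfolding \<tau>_def rhom.hom_sum[OF rhom.map_poly_hom[OF rhom_to_ac]] by (simp add: map_poly_monom)
    then show ?thesis by (simp add: poly_sum poly_monom)
  qed
  define pt where "pt y x i = (case i of TV k \<Rightarrow> to_ac (t k) | CV \<Rightarrow> y
      | YV r j \<Rightarrow> if r < m \<and> j < n then x r j else 0)" for y and x :: "nat \<Rightarrow> nat \<Rightarrow> 'a alg_closure" and i
  have gp_pt: "gp r (pt y x) = spec_poly n \<tau> (bv r y)" for r y x
    unfolding gp_def spec_poly_def by (simp add: pt_def \<tau>val)
  have pt_mem: "pt (\<sigma> C) x \<in> set (points ps (emb (\<lambda>l. to_ac (t l))))"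
    if s: "\<sigma> \<in> gal" and x: "\<And>r. r < m \<Longrightarrow> spec_poly n \<tau> (bv r (\<sigma> C)) = (\<Prod>i<n. [:- x r i, 1:])" for \<sigma> x
    unfolding set_points[OF tw]
  proof (intro conjI allI impI)
    fix i assume "i \<notin> fst ` set ps"
    then show "pt (\<sigma> C) x i = emb (\<lambda>l. to_ac (t l)) i"
      using fst_rows[of m] by (cases i) (auto simp: pt_def emb_def ps_def)
  next
    have "poly Q (\<sigma> C) = 0"
      using p(3) s by (simp add: Q_root rhom.hom_0[OF rhom_gal] flip: gal_poly_to_ac)
    moreover have "gp r (pt (\<sigma> C) x) = (\<Prod>i<n. [:- pt (\<sigma> C) x (YV r i), 1:])" if r: "r < m" for r
      unfolding gp_pt x[OF r] using r by (intro prod.cong) (simp_all add: pt_def)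
    ultimately show "on_tower ps (pt (\<sigma> C) x)"
      unfolding on_tower_iff by (simp add: pt_def)
  qed
  show ?thesis
    unfolding bv_def[symmetric]
  proof (intro exI[of _ \<tau>] conjI ballI allI impI)
    fix \<sigma> :: "'a alg_closure \<Rightarrow> 'a alg_closure" and r assume s: "\<sigma> \<in> gal" and r: "r < m"
    note mon = spec_poly_monic[of n \<tau>]
    have "\<exists>x. spec_poly n \<tau> (bv r (\<sigma> C)) = (\<Prod>i<n. [:- x i, 1:])" for r
      using monic_factorization[OF mon] by blast
    then obtain x where "spec_poly n \<tau> (bv r (\<sigma> C)) = (\<Prod>i<n. [:- x r i, 1:])" for r
      by metis
    then have "pt (\<sigma> C) x \<in> set (points ps (emb (\<lambda>l. to_ac (t l))))" by (intro pt_mem[OF s])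
    \<comment> \<open>The storey with index 0 carries the undivided polynomial, so distinctness of
      its roots is the claim about the full polynomial.\<close>
    moreover have "(YV r 0, st r 0) \<in> set ps" unfolding mem_ps using r n by force
    ultimately have "distinct (roots_of (st r 0 (pt (\<sigma> C) x)))"
      by (rule distinct_points_roots[OF tw t])
    then have "distinct (roots_of (spec_poly n \<tau> (bv r (\<sigma> C))))" by (simp add: st_def gp_pt)
    then show "rsquarefree (spec_poly n \<tau> (bv r (\<sigma> C)))"
      using rsquarefree_root_prod_iff by (metis root_prod_roots_of[OF mon(2)])
  next
    fix \<sigma> \<sigma>' :: "'a alg_closure \<Rightarrow> 'a alg_closure" and x x'
    assume s: "\<sigma> \<in> gal" "\<sigma>' \<in> gal"
      and x: "\<forall>r<m. spec_poly n \<tau> (bv r (\<sigma> C)) = (\<Prod>i<n. [:- x r i, 1:])"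
      and x': "\<forall>r<m. spec_poly n \<tau> (bv r (\<sigma>' C)) = (\<Prod>i<n. [:- x' r i, 1:])"
    obtain \<rho> where \<rho>: "\<rho> \<in> gal" "\<forall>j\<in>fst ` set ps. \<rho> (pt (\<sigma> C) x j) = pt (\<sigma>' C) x' j"
      using trans[OF pt_mem[OF s(1), of x] pt_mem[OF s(2), of x']] x x' by blast
    have "CV \<in> fst ` set ps" by (simp add: ps_def)
    then have "\<rho> (\<sigma> C) = \<sigma>' C" using \<rho>(2) by (auto simp: pt_def)
    moreover have "\<rho> (x r i) = x' r i" if ri: "r < m" "i < n" for r i
    proof -
      have "YV r i \<in> fst ` set ps" using fst_rows[of m] ri by (auto simp: ps_def)
      then have "\<rho> (pt (\<sigma> C) x (YV r i)) = pt (\<sigma>' C) x' (YV r i)" using \<rho>(2) by blast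
      then show ?thesis using ri by (simp add: pt_def)
    qed
    ultimately show "\<exists>\<rho>\<in>gal. \<rho> (\<sigma> C) = \<sigma>' C \<and> (\<forall>r<m. \<forall>i<n. \<rho> (x r i) = x' r i)"
      using \<rho>(1) by blast
  qed
qed

section \<open>Solving the embedding problem\<close>

text \<open>If k were finite, the product of all T - a with a in k would be a nonzero polynomial
  without a nonzero value on k. Taken as \<open>g\<close>, together with f = X, it contradicts the
  specialisation property.\<close>

lemma hilbertian_infinite:
  assumes hil: "hilbertian TYPE('a::field)" shows "infinite (UNIV :: 'a set)"
proof
  assume fin: "finite (UNIV :: 'a set)"
  define F :: "(unit \<Rightarrow> 'a alg_closure) \<Rightarrow> 'a alg_closure" where
    "F v = (\<Prod>a\<in>(UNIV :: 'a set). v () - to_ac a)" for v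
  have "F \<in> PF" unfolding F_def by (intro PF_prod PF_diff PF_coord PF_const)
  then obtain g where g: "g \<in> mpolys 1" "\<And>t. eval_ac t g = F (\<lambda>_. t 0)"
    by (rule PF_as_mpoly[where u = "\<lambda>t _. t 0" and n = 1]) auto
  obtain z :: "'a alg_closure" where z: "z \<notin> range to_ac"
    using ex_new_if_finite[OF infinite_UNIV_alg_closed finite_imageI[OF fin]] by blast
  have "F (\<lambda>_. z) \<noteq> 0" using z fin by (auto simp: F_def)
  then have g0: "g \<noteq> 0" using g(2)[of "\<lambda>_. z"] by (auto simp: rhom.hom_0[OF rhom_eval_ac])
  have gt: "mpoly_eval t g = 0" for t
  proof -
    have "to_ac (mpoly_eval t g) = F (\<lambda>_. to_ac (t 0))"
      using g(2)[of "\<lambda>l. to_ac (t l)"] by (simp add: eval_ac_to_ac)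
    also have "\<dots> = 0" using fin by (auto simp: F_def)
    finally show ?thesis by simp
  qed
  define f where "f = [:0, 1 :: 'a mpoly fract:]"
  have fract_eq: "(0 :: 'a mpoly fract) = Fract 0 1" "(1 :: 'a mpoly fract) = Fract 1 1"
    by (simp_all add: Zero_fract_def One_fract_def)
  have fract_mem: "Fract r 1 \<in> ratfuns 1" if "r \<in> mpolys 1" for r :: "'a mpoly"
    unfolding ratfuns_def using that mpolys_1 by (intro CollectI exI[of _ r] exI[of _ 1]) simp
  have "(0 :: 'a mpoly fract) \<in> ratfuns 1" "(1 :: 'a mpoly fract) \<in> ratfuns 1"
    unfolding fract_eq by (rule fract_mem[OF mpolys_0], rule fract_mem[OF mpolys_1])
  then have "f \<in> polys_over (ratfuns 1)"
    by (auto simp: f_def polys_over_def coeff_pCons split: nat.split)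
  moreover have "degree a = 0 \<or> degree b = 0" if "f = a * b" for a b
  proof -
    have "f \<noteq> 0" by (simp add: f_def)
    then have "degree a + degree b = degree f" using that by (auto simp: degree_mult_eq)
    then show ?thesis by (auto simp: f_def)
  qed
  ultimately have "irreducible_over (ratfuns 1) f" by (simp add: irreducible_over_def f_def)
  moreover have "separable_poly f"
    using rsquarefree_root_prod_iff[of "[0 :: 'a mpoly fract alg_closure]"]
    by (simp add: separable_poly_def f_def rhom.map_poly_hom_pCons[OF rhom_to_ac])
  ultimately have "\<exists>t. mpoly_eval t g \<noteq> 0"
    using hil[unfolded hilbertian_def, rule_format, OF order.refl order.refl g(1), of "\<lambda>_. f"] g0
    by blast
  then show False using gt by blast
qed

lemma subring_over_equalizer:
  assumes "\<sigma> \<in> gal" "\<tau> \<in> gal" shows "subring_over {y. \<sigma> y = \<tau> y}"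
  unfolding subring_over_def
  using assms by (auto simp: rhom.hom_add[OF rhom_gal] rhom.hom_diff[OF rhom_gal] rhom.hom_mult[OF rhom_gal])

lemma subring_over_vimage:
  assumes "\<sigma> \<in> gal" "subring_over F" shows "subring_over {y. \<sigma> y \<in> F}"
  unfolding subring_over_def
  using assms by (auto simp: rhom.hom_add[OF rhom_gal] rhom.hom_diff[OF rhom_gal] rhom.hom_mult[OF rhom_gal]
      subring_add subring_diff subring_mult subring_to_ac)

lemma Aut_carrier: "carrier (Aut L) = field_auts L"
  by (simp add: Aut_def)

lemma Aut_mult:
  assumes "\<rho> \<in> field_auts L" "\<rho>' \<in> field_auts L" shows "\<rho> \<otimes>\<^bsub>Aut L\<^esub> \<rho>' = compose L \<rho> \<rho>'"
  using assms by (simp add: Aut_def BijGroup_def field_auts_def)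

lemma field_autsD:
  assumes "\<rho> \<in> field_auts L" shows "\<rho> ` L = L" "\<rho> \<in> extensional L"
  using assms unfolding field_auts_def Bij_def bij_betw_def by blast+

text \<open>After a base change the embedding problem is solved by letting \<open>G\<close> permute the roots of a
  generic polynomial of degree \<open>|G|\<close> through its regular representation, and \<open>L\<close> through \<open>\<alpha>\<close>.\<close>

lemma solution_after_base_change:
  fixes G :: "('g, 'm) monoid_scheme" and L :: "'a::field alg_closure set"
  assumes hil: "hilbertian TYPE('a)" and G: "group G" and fin: "finite (carrier G)"
    and L: "finite_separable_extension L" and \<alpha>: "\<alpha> \<in> hom G (Aut L)"
  shows "\<exists>w W s. separable_element w \<and> L \<subseteq> kadj w \<and> inj_on W (carrier G) \<and> W \<one>\<^bsub>G\<^esub> = w \<and>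
    (\<forall>g\<in>carrier G. s g \<in> gal \<and> s g w = W g \<and> W g \<in> kadj w) \<and>
    (\<forall>g\<in>carrier G. \<forall>h\<in>carrier G. s g (W h) = W (g \<otimes>\<^bsub>G\<^esub> h)) \<and>
    (\<forall>g\<in>carrier G. \<forall>y\<in>L. s g y = \<alpha> g y)"
proof -
  interpret group G by (rule G)
  have inf: "infinite (UNIV :: 'a set)" by (rule hilbertian_infinite[OF hil])
  have Lsub: "subring_over L"
    using L unfolding finite_separable_extension_def field_extension_iff_subring_over by blast
  obtain c where c: "separable_element c" "L = kadj c"
    by (rule finite_separable_extension_simple[OF inf L])
  have cL: "c \<in> L" unfolding c(2) by (rule mem_kadj)
  define n where "n = card (carrier G)"
  have n: "n \<ge> 1" using fin one_closed card_gt_0_iff[of "carrier G"] by (auto simp: n_def Suc_le_eq)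
  obtain en where en: "bij_betw en {..<n} (carrier G)"
    using ex_bij_betw_nat_finite[OF fin] by (auto simp: n_def atLeast0LessThan)
  define ix where "ix = inv_into {..<n} en"
  have ix: "ix g < n" "en (ix g) = g" if "g \<in> carrier G" for g
    using that en bij_betw_inv_into_right[OF en] bij_betwE[OF bij_betw_inv_into[OF en]]
    by (auto simp: ix_def)
  have inj1: "inj_on (\<lambda>r::nat. poly (map_poly to_ac (0 :: 'a poly)) c) {..<1}"
    by (simp add: inj_on_def)
  \<comment> \<open>One polynomial, with \<beta> = 0: its coefficients
    \<open>spec_poly n \<tau> 0\<close> lie in k, and what is gained is that its roots can be
    permuted freely while \<open>c\<close> is sent to any chosen conjugate.\<close>
  from generic_polys[where \<beta> = "\<lambda>_. 0", OF hil inf c(1) order.refl n inj1]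
  obtain \<tau> where sq: "\<forall>\<sigma>\<in>gal. \<forall>r<1::nat. rsquarefree (spec_poly n \<tau> (poly (map_poly to_ac 0) (\<sigma> c)))"
    and tr: "\<forall>\<sigma>\<in>gal. \<forall>\<sigma>'\<in>gal. \<forall>x x'.
       (\<forall>r<1. spec_poly n \<tau> (poly (map_poly to_ac 0) (\<sigma> c)) = (\<Prod>i<n. [:- x r i, 1:])) \<longrightarrow>
       (\<forall>r<1. spec_poly n \<tau> (poly (map_poly to_ac 0) (\<sigma>' c)) = (\<Prod>i<n. [:- x' r i, 1:])) \<longrightarrow>
       (\<exists>\<rho>\<in>gal. \<rho> (\<sigma> c) = \<sigma>' c \<and> (\<forall>r<1. \<forall>i<n. \<rho> (x r i) = x' (r::nat) i))"
    by (elim exE conjE)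
  define q where "q = spec_poly n \<tau> 0"
  have q_sq: "rsquarefree q" using bspec[OF sq gal_id] by (simp add: q_def)
  obtain x where x: "q = (\<Prod>i<n. [:- x i, 1:])" "rsquarefree q \<longrightarrow> inj_on x {..<n}"
    using monic_factorization[OF spec_poly_monic[of n \<tau> 0]] unfolding q_def by blast
  define x' where "x' g = x (ix g)" for g
  have x'en: "x' (en i) = x i" if "i < n" for i
    using bij_betw_inv_into_left[OF en] that by (simp add: x'_def ix_def)
  have x'inj: "inj_on x' (carrier G)"
  proof (rule inj_onI)
    fix g h assume gh: "g \<in> carrier G" "h \<in> carrier G" "x' g = x' h"
    then have "ix g = ix h" using inj_onD[OF mp[OF x(2) q_sq]] ix(1) by (simp add: x'_def)
    then show "g = h" using ix(2) gh by metis
  qed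
  have x'prod: "q = (\<Prod>g\<in>carrier G. [:- x' g, 1:])"
  proof -
    have "(\<Prod>g\<in>carrier G. [:- x' g, 1:]) = (\<Prod>i<n. [:- x' (en i), 1:])"
      by (rule prod.reindex_bij_betw[OF en, symmetric])
    also have "\<dots> = (\<Prod>i<n. [:- x i, 1:])" by (rule prod.cong) (simp_all add: x'en)
    finally show ?thesis by (simp add: x(1))
  qed
  have ex: "\<exists>\<sigma>\<in>gal. (\<forall>y\<in>L. \<sigma> y = \<alpha> g y) \<and> (\<forall>h\<in>carrier G. \<sigma> (x' h) = x' (g \<otimes>\<^bsub>G\<^esub> h))"
    if g: "g \<in> carrier G" for g
  proof -
    have "\<alpha> g \<in> field_auts L" using \<alpha> g by (auto simp: hom_def Aut_carrier)
    then obtain \<rho>0 where \<rho>0: "\<rho>0 \<in> gal" "\<And>y. y \<in> L \<Longrightarrow> \<rho>0 y = \<alpha> g y"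
      by (rule field_auts_extend[OF Lsub]) blast
    have "bij_betw (\<lambda>h. g \<otimes>\<^bsub>G\<^esub> h) (carrier G) (carrier G)"
      using g by (intro bij_betwI[where g = "\<lambda>h. inv\<^bsub>G\<^esub> g \<otimes>\<^bsub>G\<^esub> h"]) (auto simp flip: m_assoc)
    from bij_betw_trans[OF en this]
    have "bij_betw (\<lambda>i. g \<otimes>\<^bsub>G\<^esub> en i) {..<n} (carrier G)" by (simp add: comp_def)
    then have "(\<Prod>i<n. [:- x' (g \<otimes>\<^bsub>G\<^esub> en i), 1:]) = (\<Prod>h\<in>carrier G. [:- x' h, 1:])"
      by (rule prod.reindex_bij_betw)
    then have prod': "q = (\<Prod>i<n. [:- x' (g \<otimes>\<^bsub>G\<^esub> en i), 1:])" using x'prod by simp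
    obtain \<rho> where \<rho>: "\<rho> \<in> gal" "\<rho> c = \<rho>0 c" "\<And>i. i < n \<Longrightarrow> \<rho> (x i) = x' (g \<otimes>\<^bsub>G\<^esub> en i)"
      using bspec[OF bspec[OF tr gal_id] \<rho>0(1), THEN spec, THEN spec,
          of "\<lambda>_. x" "\<lambda>_ i. x' (g \<otimes>\<^bsub>G\<^esub> en i)"] x(1) prod'
      by (auto simp: q_def)
    have "\<rho> y = \<alpha> g y" if "y \<in> L" for y
      using gal_eq_on_kadj[OF \<rho>(1) \<rho>0(1) \<rho>(2)] \<rho>0(2)[OF that] that c(2) by simp
    moreover have "\<rho> (x' h) = x' (g \<otimes>\<^bsub>G\<^esub> h)" if "h \<in> carrier G" for h
      using \<rho>(3)[OF ix(1)[OF that]] ix(2)[OF that] by (simp add: x'_def)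
    ultimately show ?thesis using \<rho>(1) by blast
  qed
  then obtain s where s: "\<And>g. g \<in> carrier G \<Longrightarrow> s g \<in> gal"
      "\<And>g y. g \<in> carrier G \<Longrightarrow> y \<in> L \<Longrightarrow> s g y = \<alpha> g y"
      "\<And>g h. g \<in> carrier G \<Longrightarrow> h \<in> carrier G \<Longrightarrow> s g (x' h) = x' (g \<otimes>\<^bsub>G\<^esub> h)"
    by metis
  define R where "R = insert c (x' ` carrier G)"
  have sepR: "separable_element r" if "r \<in> R" for r
  proof -
    have "separable_element (x' g)" if g: "g \<in> carrier G" for g
    proof (rule separable_root_over_kadj[OF c(1) _ q_sq])
      show "q \<in> polys_over (kadj c)"
        unfolding q_def by (rule spec_poly_over[OF subring_over_kadj subring_0[OF subring_over_kadj]])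
      show "poly q (x' g) = 0" unfolding x'prod using fin g by (auto simp: poly_prod)
    qed
    then show ?thesis using that c(1) by (auto simp: R_def)
  qed
  have finR: "finite R" using fin by (simp add: R_def)
  from primitive_element[OF inf finR sepR]
  obtain w where w: "separable_element w" "R \<subseteq> kadj w"
      and w3: "\<forall>N. subring_over N \<and> R \<subseteq> N \<longrightarrow> w \<in> N" by blast
  have Lw: "L \<subseteq> kadj w"
    unfolding c(2) using w(2) by (intro kadj_least subring_over_kadj) (auto simp: R_def)
  \<comment> \<open>The automorphisms \<open>s g\<close> are chosen one by one and need not compose
    like \<open>G\<close> on the closure. On the orbit \<open>W\<close> they do, since
    \<open>w\<close> lies in each subring over k containing \<open>c\<close> and the labelled roots,
    where the composition law is known.\<close>
  define W where "W g = s g w" for g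
  have agree: "\<sigma> w = \<tau> w" if "\<sigma> \<in> gal" "\<tau> \<in> gal" "\<sigma> c = \<tau> c"
      "\<And>h. h \<in> carrier G \<Longrightarrow> \<sigma> (x' h) = \<tau> (x' h)" for \<sigma> \<tau>
  proof -
    have "R \<subseteq> {y. \<sigma> y = \<tau> y}" using that(3,4) by (auto simp: R_def)
    then show ?thesis using w3 subring_over_equalizer[OF that(1,2)] by blast
  qed
  have \<alpha>L: "\<alpha> g y \<in> L" if "g \<in> carrier G" "y \<in> L" for g y
  proof -
    have "\<alpha> g \<in> field_auts L" using \<alpha> that(1) by (auto simp: hom_def Aut_carrier)
    then show ?thesis using field_autsD(1) that(2) by blast
  qed
  have sW: "s g (W h) = W (g \<otimes>\<^bsub>G\<^esub> h)" if gh: "g \<in> carrier G" "h \<in> carrier G" for g h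
    unfolding W_def
  proof (rule agree[OF gal_comp[OF s(1) s(1)] s(1)])
    have "\<alpha> (g \<otimes>\<^bsub>G\<^esub> h) = compose L (\<alpha> g) (\<alpha> h)"
      using \<alpha> gh by (auto simp: hom_def Aut_carrier Aut_mult Pi_iff)
    then show "s g (s h c) = s (g \<otimes>\<^bsub>G\<^esub> h) c"
      using gh cL \<alpha>L[OF gh(2) cL] s(2) by (simp add: compose_eq)
    show "s g (s h (x' k)) = s (g \<otimes>\<^bsub>G\<^esub> h) (x' k)" if "k \<in> carrier G" for k
      using gh that by (simp add: s(3) m_assoc)
  qed (use gh in simp_all)
  \<comment> \<open>The chosen \<open>s\<close> at the unit need not be the identity of the closure.
    Idempotence of the unit and injectivity show that it fixes \<open>w\<close>.\<close>
  have W1: "W \<one>\<^bsub>G\<^esub> = w"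
  proof -
    have "s \<one>\<^bsub>G\<^esub> (W \<one>\<^bsub>G\<^esub>) = W \<one>\<^bsub>G\<^esub>"
      using sW[OF one_closed one_closed] by simp
    also have "W \<one>\<^bsub>G\<^esub> = s \<one>\<^bsub>G\<^esub> w" by (simp add: W_def)
    finally show ?thesis by (simp add: gal_inj[OF s(1)[OF one_closed]])
  qed
  show ?thesis
  proof (intro exI[of _ w] exI[of _ W] exI[of _ s] conjI)
    show "inj_on W (carrier G)"
    proof (rule inj_onI)
      fix g h assume gh: "g \<in> carrier G" "h \<in> carrier G" and eq: "W g = W h"
      have "x' \<one>\<^bsub>G\<^esub> \<in> kadj w" using w(2) by (auto simp: R_def)
      then have "s g (x' \<one>\<^bsub>G\<^esub>) = s h (x' \<one>\<^bsub>G\<^esub>)"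
        using gal_eq_on_kadj[OF s(1)[OF gh(1)] s(1)[OF gh(2)]] eq by (simp add: W_def)
      then have "x' g = x' h" using gh by (simp add: s(3))
      then show "g = h" using x'inj gh by (auto dest: inj_onD)
    qed
    show "\<forall>g\<in>carrier G. s g \<in> gal \<and> s g w = W g \<and> W g \<in> kadj w"
    proof
      fix g assume g: "g \<in> carrier G"
      have "R \<subseteq> {y. s g y \<in> kadj w}"
        using g w(2) Lw \<alpha>L[OF g cL] by (auto simp: R_def s(2,3) cL)
      then have "s g w \<in> kadj w"
        using w3 subring_over_vimage[OF s(1)[OF g] subring_over_kadj] by blast
      then show "s g \<in> gal \<and> s g w = W g \<and> W g \<in> kadj w" using s(1)[OF g] by (simp add: W_def)
    qed
    show "\<forall>g\<in>carrier G. \<forall>h\<in>carrier G. s g (W h) = W (g \<otimes>\<^bsub>G\<^esub> h)" using sW by blast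
    show "\<forall>g\<in>carrier G. \<forall>y\<in>L. s g y = \<alpha> g y" using s(2) by blast
  qed (rule w(1) Lw W1)+
qed

lemma obtain_third_index:
  assumes "i < (3::nat)" "j < 3" obtains k where "k < 3" "k \<noteq> i" "k \<noteq> j"
proof -
  have "card {i, j} \<le> 2" by (simp add: card_insert_if)
  then have "\<not> {..<3} \<subseteq> {i, j}" using card_mono[of "{i, j}" "{..<3::nat}"] by auto
  then show ?thesis using that by blast
qed

theorem corollary4p2:
  fixes G :: "('g, 'm) monoid_scheme"
    and L :: "'a::field alg_closure set"
    and \<alpha> :: "'g \<Rightarrow> 'a alg_closure \<Rightarrow> 'a alg_closure"
  assumes "hilbertian TYPE('a)"
    and "group G" and "finite (carrier G)"
    and "finite_separable_extension L"
    and "\<alpha> \<in> epi G (Aut L)"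
  shows "\<exists>(E :: 'a alg_closure set) \<beta>.
           finite_separable_extension E \<and> L \<subseteq> E \<and>
           \<beta> \<in> iso (Aut E) G \<and>
           (\<forall>\<sigma>\<in>carrier (Aut E). \<sigma> ` L = L \<and> \<alpha> (\<beta> \<sigma>) = restrict \<sigma> L)"
proof -
  interpret group G by (rule assms(2))
  note hil = assms(1) and fin = assms(3)
  have inf: "infinite (UNIV :: 'a set)" by (rule hilbertian_infinite[OF hil])
  have \<alpha>: "\<alpha> \<in> hom G (Aut L)" using assms(5) by (simp add: epi_def)
  from solution_after_base_change[OF hil assms(2) fin assms(4) \<alpha>]
  obtain w :: "'a alg_closure" and W s where w: "separable_element w" "L \<subseteq> kadj w"
    and Winj: "inj_on W (carrier G)" and W1: "W \<one>\<^bsub>G\<^esub> = w"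
    and s': "\<forall>g\<in>carrier G. s g \<in> gal \<and> s g w = W g \<and> W g \<in> kadj w"
    and sW': "\<forall>g\<in>carrier G. \<forall>h\<in>carrier G. s g (W h) = W (g \<otimes>\<^bsub>G\<^esub> h)"
    and sL': "\<forall>g\<in>carrier G. \<forall>y\<in>L. s g y = \<alpha> g y"
    by blast
  note s = bspec[OF s'] and sW = bspec[OF bspec[OF sW']] and sL = bspec[OF bspec[OF sL']]
  \<comment> \<open>Its roots are the orbit of \<open>w\<close> under \<open>G\<close>. The
    polynomial stands for the subfield fixed by \<open>G\<close>, of which only a generator
    \<open>b\<close> is needed below.\<close>
  define A where "A = (\<Prod>g\<in>carrier G. [:- W g, 1:])"
  have A_root: "poly A y = 0 \<longleftrightarrow> y \<in> W ` carrier G" for y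
    using fin by (auto simp: A_def poly_prod)
  have map_A: "map_poly \<sigma> A = (\<Prod>g\<in>carrier G. [:- \<sigma> (W g), 1:])" if "\<sigma> \<in> gal" for \<sigma>
    unfolding A_def rhom.hom_prod[OF rhom.map_poly_hom[OF rhom_gal[OF that]]]
    by (simp add: rhom.map_poly_hom_pCons[OF rhom_gal[OF that]] rhom.hom_minus[OF rhom_gal[OF that]]
        rhom.hom_1[OF rhom_gal[OF that]])
  define PS where "PS = (\<lambda>\<sigma>. map_poly \<sigma> A) ` (gal :: ('a alg_closure \<Rightarrow> 'a alg_closure) set)"
  have "finite PS"
  proof -
    have "PS \<subseteq> (\<lambda>v. \<Prod>g\<in>carrier G. [:- v g, 1:]) ` (\<Pi>\<^sub>E g\<in>carrier G. (\<lambda>\<sigma>. \<sigma> (W g)) ` gal)"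
    proof
      fix P assume "P \<in> PS"
      then obtain \<sigma> where \<sigma>: "\<sigma> \<in> gal" "P = map_poly \<sigma> A" by (auto simp: PS_def)
      have "P = (\<Prod>g\<in>carrier G. [:- restrict (\<lambda>g. \<sigma> (W g)) (carrier G) g, 1:])"
        unfolding \<sigma>(2) map_A[OF \<sigma>(1)] by (rule prod.cong) simp_all
      moreover have "restrict (\<lambda>g. \<sigma> (W g)) (carrier G) \<in> (\<Pi>\<^sub>E g\<in>carrier G. (\<lambda>\<sigma>. \<sigma> (W g)) ` gal)"
        using \<sigma>(1) by auto
      ultimately show "P \<in> (\<lambda>v. \<Prod>g\<in>carrier G. [:- v g, 1:]) ` (\<Pi>\<^sub>E g\<in>carrier G. (\<lambda>\<sigma>. \<sigma> (W g)) ` gal)"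
        by (rule image_eqI)
    qed
    then show ?thesis by (rule finite_subset) (intro finite_imageI finite_PiE fin finite_gal_orbit)
  qed
  then have "finite (\<Union>P\<in>PS - {A}. {z. poly (P - A) z = 0})"
    by (intro finite_UN_I poly_roots_finite) auto
  then have "finite (to_ac -` (\<Union>P\<in>PS - {A}. {z. poly (P - A) z = 0}))"
    by (rule finite_vimageI[OF _ inj_to_ac])
  \<comment> \<open>At \<open>u\<close> no conjugate of \<open>A\<close> other than \<open>A\<close>
    itself takes the value of \<open>A\<close>. An automorphism therefore fixes b = A(u) only if it
    fixes \<open>A\<close>, that is, permutes the orbit of \<open>w\<close>.\<close>
  then obtain u :: 'a where u: "u \<notin> to_ac -` (\<Union>P\<in>PS - {A}. {z. poly (P - A) z = 0})"
    using ex_new_if_finite[OF inf] by blast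
  define b where "b = poly A (to_ac u)"
  have \<sigma>b: "\<sigma> b = poly (map_poly \<sigma> A) (to_ac u)" if "\<sigma> \<in> gal" for \<sigma>
    using that by (simp add: b_def rhom.poly_hom[OF rhom_gal])
  have b_stab: "\<exists>g\<in>carrier G. \<sigma> w = W g" if \<sigma>: "\<sigma> \<in> gal" "\<sigma> b = b" for \<sigma>
  proof -
    have "map_poly \<sigma> A \<in> PS" using \<sigma>(1) by (simp add: PS_def)
    moreover have "poly (map_poly \<sigma> A - A) (to_ac u) = 0"
      using \<sigma> by (simp add: \<sigma>b flip: b_def)
    ultimately have "map_poly \<sigma> A = A" using u by auto
    then have "poly A (\<sigma> w) = \<sigma> (poly A w)" using rhom.poly_hom[OF rhom_gal[OF \<sigma>(1)], of A w] by simp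
    also have "poly A w = 0" using A_root W1 one_closed by blast
    finally have "\<sigma> w \<in> W ` carrier G"
      by (simp add: A_root rhom.hom_0[OF rhom_gal[OF \<sigma>(1)]])
    then show ?thesis using W1 by auto
  qed
  have s_b: "s g b = b" if g: "g \<in> carrier G" for g
  proof -
    have "map_poly (s g) A = (\<Prod>h\<in>carrier G. [:- W (g \<otimes>\<^bsub>G\<^esub> h), 1:])"
      using s[OF g] sW[OF g] by (simp add: map_A)
    also have "bij_betw (\<lambda>h. g \<otimes>\<^bsub>G\<^esub> h) (carrier G) (carrier G)"
      using g by (intro bij_betwI[where g = "\<lambda>h. inv\<^bsub>G\<^esub> g \<otimes>\<^bsub>G\<^esub> h"]) (auto simp flip: m_assoc)
    then have "(\<Prod>h\<in>carrier G. [:- W (g \<otimes>\<^bsub>G\<^esub> h), 1:]) = A"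
      unfolding A_def by (rule prod.reindex_bij_betw)
    finally show ?thesis using s[OF g] by (simp add: \<sigma>b flip: b_def)
  qed
  have kw: "subring_over (kadj w)" by (rule subring_over_kadj)
  have "[:- W g, 1:] \<in> polys_over (kadj w)" if "g \<in> carrier G" for g
    using s[OF that] subring_diff[OF kw subring_0[OF kw], of "W g"]
    by (simp add: polys_over_pCons[OF kw] polys_over_0[OF kw] subring_1[OF kw])
  then have "A \<in> polys_over (kadj w)" unfolding A_def by (rule polys_over_prod[OF kw])
  then have bw: "b \<in> kadj w" unfolding b_def by (rule poly_in_subring[OF kw _ subring_to_ac[OF kw]])
  define Ob where "Ob = (\<lambda>\<sigma>. \<sigma> b) ` gal"
  have finOb: "finite Ob" unfolding Ob_def by (rule finite_gal_orbit)
  have sepOb: "separable_element y" if "y \<in> Ob" for y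
    using that separable_gal[OF separable_kadj[OF w(1) bw]] by (auto simp: Ob_def)
  have bOb: "b \<in> Ob" unfolding Ob_def using gal_id by (rule rev_image_eqI) simp
  define m where "m = card Ob"
  have m: "m \<ge> 1" using finOb bOb card_gt_0_iff[of Ob] by (auto simp: m_def Suc_le_eq)
  obtain en where en: "bij_betw en {..<m} Ob"
    using ex_bij_betw_nat_finite[OF finOb] by (auto simp: m_def atLeast0LessThan)
  define ix where "ix = inv_into {..<m} en"
  have ix: "ix y < m" "en (ix y) = y" if "y \<in> Ob" for y
    using that bij_betw_inv_into_right[OF en] bij_betwE[OF bij_betw_inv_into[OF en]]
    by (auto simp: ix_def)
  have "separable_element r" if "r \<in> insert w Ob" for r using that w(1) sepOb by blast
  from primitive_element[OF inf finite.insertI[OF finOb] this]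
  \<comment> \<open>Containing the conjugates of \<open>b\<close>, k(C) supplies the polynomials
    \<beta> r with values \<open>en r\<close>; containing \<open>w\<close>, it makes every
    automorphism that fixes \<open>C\<close> fix \<open>w\<close> as well.\<close>
  obtain C where C: "separable_element C" "insert w Ob \<subseteq> kadj C" by blast
  have "\<exists>h. poly (map_poly to_ac h) C = en r" if "r < m" for r
  proof -
    have "en r \<in> kadj C" using C(2) bij_betwE[OF en] that by auto
    then show ?thesis by (auto simp: kadj_eq)
  qed
  then obtain \<beta> :: "nat \<Rightarrow> 'a poly" where \<beta>: "\<And>r. r < m \<Longrightarrow> poly (map_poly to_ac (\<beta> r)) C = en r"
    by metis
  have inj\<beta>: "inj_on (\<lambda>r. poly (map_poly to_ac (\<beta> r)) C) {..<m}"
    using bij_betw_imp_inj_on[OF en] \<beta> by (simp add: inj_on_def)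
  have \<beta>\<sigma>: "poly (map_poly to_ac (\<beta> r)) (\<sigma> C) = \<sigma> (en r)" if "\<sigma> \<in> gal" "r < m" for \<sigma> r
    using \<beta>[OF that(2)] that(1) by (simp flip: gal_poly_to_ac)
  have "(1::nat) \<le> 3" by simp
  from generic_polys[OF hil inf C(1) m this inj\<beta>]
  obtain \<tau> where
    sq: "\<forall>\<sigma>\<in>gal. \<forall>r<m. rsquarefree (spec_poly 3 \<tau> (poly (map_poly to_ac (\<beta> r)) (\<sigma> C)))"
    and tr: "\<forall>\<sigma>\<in>gal. \<forall>\<sigma>'\<in>gal. \<forall>x x'.
       (\<forall>r<m. spec_poly 3 \<tau> (poly (map_poly to_ac (\<beta> r)) (\<sigma> C)) = (\<Prod>i<3::nat. [:- x r i, 1:])) \<longrightarrow>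
       (\<forall>r<m. spec_poly 3 \<tau> (poly (map_poly to_ac (\<beta> r)) (\<sigma>' C)) = (\<Prod>i<3::nat. [:- x' r i, 1:])) \<longrightarrow>
       (\<exists>\<rho>\<in>gal. \<rho> (\<sigma> C) = \<sigma>' C \<and> (\<forall>r<m. \<forall>i<3::nat. \<rho> (x r i) = x' r i))"
    by (elim exE conjE)
  define q where "q y = spec_poly 3 \<tau> y" for y
  have qsq: "rsquarefree (q y)" if "y \<in> Ob" for y
    using bspec[OF sq gal_id, THEN spec, THEN mp, OF ix(1)[OF that]] \<beta>[OF ix(1)[OF that]] ix(2)[OF that] by (simp add: q_def)
  have "\<exists>x. \<forall>y\<in>Ob. q y = (\<Prod>i<3::nat. [:- x y i, 1:]) \<and> inj_on (x y) {..<3::nat}"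
  proof (intro bchoice ballI)
    fix y assume "y \<in> Ob"
    then show "\<exists>x. q y = (\<Prod>i<3::nat. [:- x i, 1:]) \<and> inj_on x {..<3::nat}"
      using monic_factorization[OF spec_poly_monic[of 3 \<tau> y]] qsq unfolding q_def by blast
  qed
  then obtain x where x: "\<And>y. y \<in> Ob \<Longrightarrow> q y = (\<Prod>i<3::nat. [:- x y i, 1:])"
      "\<And>y. y \<in> Ob \<Longrightarrow> inj_on (x y) {..<3::nat}" by blast
  \<comment> \<open>The transitivity obtained above with the cubics indexed by the conjugates y of
    \<open>b\<close> instead of numbers; the source is the fixed labelling \<open>x\<close> over
    \<open>C\<close>.\<close>
  have conj_q: "\<exists>\<rho>\<in>gal. \<rho> C = \<sigma> C \<and> (\<forall>y\<in>Ob. \<forall>i<3::nat. \<rho> (x y i) = x' y i)"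
    if \<sigma>: "\<sigma> \<in> gal" and x': "\<And>y. y \<in> Ob \<Longrightarrow> q (\<sigma> y) = (\<Prod>i<3::nat. [:- x' y i, 1:])" for \<sigma> x'
  proof -
    have enOb: "en r \<in> Ob" if "r < m" for r using bij_betwE[OF en] that by auto
    obtain \<rho> where \<rho>: "\<rho> \<in> gal" "\<rho> C = \<sigma> C" "\<And>r i. r < m \<Longrightarrow> i < 3 \<Longrightarrow> \<rho> (x (en r) i) = x' (en r) i"
      using bspec[OF bspec[OF tr gal_id] \<sigma>, THEN spec, THEN spec,
          of "\<lambda>r. x (en r)" "\<lambda>r. x' (en r)"] x(1) x' enOb \<beta> \<beta>\<sigma>[OF \<sigma>]
      by (auto simp: q_def)
    have "\<rho> (x y i) = x' y i" if "y \<in> Ob" "i < 3" for y i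
      using \<rho>(3)[OF ix(1)[OF that(1)] that(2)] ix(2)[OF that(1)] by simp
    then show ?thesis using \<rho>(1,2) by blast
  qed
  have q_root: "\<exists>i<3::nat. z = x y i" if "y \<in> Ob" "poly (q y) z = 0" for y z
    using that(2) x(1)[OF that(1)] by (auto simp: poly_prod)
  have x_root: "poly (q y) (x y i) = 0" if "y \<in> Ob" "i < 3" for y i
    using x(1)[OF that(1)] that(2) by (auto simp: poly_prod)
  define z where "z = x b 0"
  have "separable_element z"
  proof (rule separable_root_over_kadj[OF w(1)])
    show "q b \<in> polys_over (kadj w)" unfolding q_def by (rule spec_poly_over[OF kw bw])
    show "rsquarefree (q b)" by (rule qsq[OF bOb])
    show "poly (q b) z = 0" unfolding z_def by (rule x_root[OF bOb]) simp
  qed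
  then have sep_wz: "separable_element r" if "r \<in> {w, z}" for r using that w(1) by blast
  have fin_wz: "finite {w, z}" by simp
  from primitive_element[OF inf fin_wz sep_wz]
  obtain e where e: "separable_element e" "{w, z} \<subseteq> kadj e"
      and e3': "\<forall>N. subring_over N \<and> {w, z} \<subseteq> N \<longrightarrow> e \<in> N" by blast
  have e3: "e \<in> N" if "subring_over N" "{w, z} \<subseteq> N" for N using e3' that by blast
  define E where "E = kadj e"
  have Esub: "subring_over E" unfolding E_def by (rule subring_over_kadj)
  have wE: "w \<in> E" and zE: "z \<in> E" using e(2) by (simp_all add: E_def)
  have kwE: "kadj w \<subseteq> E" by (rule kadj_least[OF Esub wE])
  have E_eq: "\<sigma> y = \<sigma>' y" if "\<sigma> \<in> gal" "\<sigma>' \<in> gal" "\<sigma> w = \<sigma>' w" "\<sigma> z = \<sigma>' z" "y \<in> E" for \<sigma> \<sigma>' y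
  proof (rule gal_eq_on_kadj[OF that(1,2)])
    show "\<sigma> e = \<sigma>' e" using e3[OF subring_over_equalizer[OF that(1,2)]] that(3,4) by simp
    show "y \<in> kadj e" using that(5) by (simp add: E_def)
  qed
  \<comment> \<open>If \<sigma> z is a root \<open>x (\<sigma> b) i\<close> other than
    \<open>z\<close>, some \<rho> fixes \<open>C\<close> and swaps the labels i and j on the cubic
    of \<sigma> b alone. It fixes \<open>w\<close> and \<open>z\<close>, hence all of
    \<open>E\<close>, but moves \<sigma> z, a contradiction.\<close>
  have rigid: "\<sigma> b = b \<and> \<sigma> z = z" if \<sigma>: "\<sigma> \<in> gal" "\<sigma> z \<in> E" for \<sigma>
  proof -
    have y: "\<sigma> b \<in> Ob" using \<sigma>(1) by (simp add: Ob_def)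
    have "poly (q (\<sigma> b)) (\<sigma> z) = \<sigma> (poly (q b) z)"
      unfolding q_def rhom.poly_hom[OF rhom_gal[OF \<sigma>(1)]] gal_spec_poly[OF \<sigma>(1)] ..
    also have "\<dots> = 0" using x_root[OF bOb, of 0] by (simp add: z_def rhom.hom_0[OF rhom_gal[OF \<sigma>(1)]])
    finally obtain i where i: "i < 3" "\<sigma> z = x (\<sigma> b) i" using q_root[OF y] by blast
    have "\<sigma> b = b \<and> i = 0"
    proof (rule ccontr)
      assume ne: "\<not> (\<sigma> b = b \<and> i = 0)"
      \<comment> \<open>If \<sigma> b = b, then \<open>z\<close> is a root of the very cubic that is
        permuted, with label 0; there i is nonzero and j must avoid 0 for \<open>z\<close> to stay
        fixed.\<close>
      obtain j where j: "j < 3" "j \<noteq> i" "j \<noteq> 0" by (rule obtain_third_index[OF i(1), of 0]) simp_all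
      define x' where "x' y = (if y = \<sigma> b then x y \<circ> transpose i j else x y)" for y
      have "q y = (\<Prod>l<3::nat. [:- x' y l, 1:])" if "y \<in> Ob" for y
      proof (cases "y = \<sigma> b")
        case True
        have "transpose i j permutes {..<3::nat}" using i(1) j(1) by (intro permutes_swap_id) simp_all
        then have "bij_betw (transpose i j) {..<3::nat} {..<3::nat}" by (rule permutes_imp_bij)
        then have "(\<Prod>l<3::nat. [:- x y (transpose i j l), 1:]) = (\<Prod>l<3::nat. [:- x y l, 1:])"
          by (rule prod.reindex_bij_betw)
        then show ?thesis using True x(1)[OF that] by (simp add: x'_def)
      next
        case False
        then show ?thesis using x(1)[OF that] by (simp add: x'_def)
      qed
      then obtain \<rho> where \<rho>: "\<rho> \<in> gal" "\<rho> C = C" "\<forall>y\<in>Ob. \<forall>i<3::nat. \<rho> (x y i) = x' y i"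
        using conj_q[OF gal_id, of x'] by auto
      have "\<rho> w = w"
        using gal_eq_on_kadj[OF \<rho>(1) gal_id, of C w] \<rho>(2) C(2) by simp
      moreover have "\<rho> z = z"
      proof -
        have "x' b 0 = x b 0" using ne j by (cases "\<sigma> b = b") (auto simp: x'_def transpose_def)
        then show ?thesis using \<rho>(3) bOb by (simp add: z_def)
      qed
      ultimately have "\<rho> (\<sigma> z) = \<sigma> z" using E_eq[OF \<rho>(1) gal_id _ _ \<sigma>(2)] by simp
      moreover have "\<rho> (\<sigma> z) = x (\<sigma> b) j"
        using \<rho>(3) y i by (simp add: x'_def)
      ultimately have "x (\<sigma> b) j = x (\<sigma> b) i" using i(2) by simp
      then show False using inj_onD[OF x(2)[OF y]] i(1) j by auto
    qed
    then show ?thesis using i(2) by (simp add: z_def)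
  qed
  \<comment> \<open>\<open>s g\<close> may move \<open>z\<close>. It is replaced by an automorphism
    that agrees with it on \<open>C\<close>, hence on \<open>w\<close>, but carries the labelled
    roots of the cubic of y to those of the cubic of s g y with equal labels; as \<open>s g\<close>
    fixes \<open>b\<close>, this one fixes \<open>z\<close>.\<close>
  have lift: "\<exists>\<sigma>\<in>gal. \<sigma> w = W g \<and> \<sigma> z = z" if g: "g \<in> carrier G" for g
  proof -
    have sg: "s g \<in> gal" using s[OF g] by blast
    have "q (s g y) = (\<Prod>i<3::nat. [:- x (s g y) i, 1:])" if "y \<in> Ob" for y
      using that gal_comp[OF sg] by (intro x(1)) (auto simp: Ob_def)
    then obtain \<rho> where \<rho>: "\<rho> \<in> gal" "\<rho> C = s g C" "\<forall>y\<in>Ob. \<forall>i<3::nat. \<rho> (x y i) = x (s g y) i"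
      using conj_q[OF sg, of "\<lambda>y. x (s g y)"] by blast
    have "\<rho> w = s g w" using gal_eq_on_kadj[OF \<rho>(1) sg \<rho>(2)] C(2) by simp
    then have "\<rho> w = W g" using s[OF g] by simp
    moreover have "\<rho> z = z" using \<rho>(3) bOb s_b[OF g] by (simp add: z_def)
    ultimately show ?thesis using \<rho>(1) by blast
  qed
  have autE: "\<exists>g\<in>carrier G. \<exists>\<sigma>\<in>gal. (\<forall>y\<in>E. \<sigma> y = \<rho> y) \<and> \<sigma> w = W g \<and> \<sigma> z = z"
    if \<rho>: "\<rho> \<in> field_auts E" for \<rho>
  proof -
    obtain \<sigma> where \<sigma>: "\<sigma> \<in> gal" "\<And>y. y \<in> E \<Longrightarrow> \<sigma> y = \<rho> y"
      by (rule field_auts_extend[OF Esub \<rho>]) blast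
    have "\<sigma> z \<in> E" using \<sigma>(2)[OF zE] field_autsD(1)[OF \<rho>] zE by auto
    then have "\<sigma> b = b \<and> \<sigma> z = z" by (rule rigid[OF \<sigma>(1)])
    then show ?thesis using b_stab[OF \<sigma>(1)] \<sigma> by blast
  qed
  \<comment> \<open>An automorphism of \<open>E\<close> fixes \<open>b\<close> by rigidity and so
    sends \<open>w\<close> to some \<open>W g\<close>; the label \<open>g\<close> is unique because
    \<open>W\<close> is injective.\<close>
  define \<gamma> where "\<gamma> \<rho> = inv_into (carrier G) W (\<rho> w)" for \<rho> :: "'a alg_closure \<Rightarrow> 'a alg_closure"
  have \<gamma>I: "\<gamma> \<rho> = g" if "g \<in> carrier G" "\<rho> w = W g" for \<rho> g
    unfolding \<gamma>_def that(2) by (rule inv_into_f_f[OF Winj that(1)])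
  have \<gamma>: "\<gamma> \<rho> \<in> carrier G \<and> (\<exists>\<sigma>\<in>gal. (\<forall>y\<in>E. \<sigma> y = \<rho> y) \<and> \<sigma> w = W (\<gamma> \<rho>) \<and> \<sigma> z = z)"
    if \<rho>: "\<rho> \<in> field_auts E" for \<rho>
  proof -
    obtain g \<sigma> where g: "g \<in> carrier G" "\<sigma> \<in> gal" "\<forall>y\<in>E. \<sigma> y = \<rho> y" "\<sigma> w = W g" "\<sigma> z = z"
      using autE[OF \<rho>] by blast
    have "\<gamma> \<rho> = g" using g wE by (intro \<gamma>I) auto
    then show ?thesis using g by blast
  qed
  have \<gamma>_kw: "\<rho> y = s (\<gamma> \<rho>) y" if \<rho>: "\<rho> \<in> field_auts E" and y: "y \<in> kadj w" for \<rho> y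
  proof -
    obtain \<sigma> where \<sigma>: "\<sigma> \<in> gal" "\<forall>y\<in>E. \<sigma> y = \<rho> y" "\<sigma> w = W (\<gamma> \<rho>)" using \<gamma>[OF \<rho>] by blast
    have g: "\<gamma> \<rho> \<in> carrier G" using \<gamma>[OF \<rho>] by blast
    have "\<sigma> y = s (\<gamma> \<rho>) y"
      by (rule gal_eq_on_kadj[OF \<sigma>(1) _ _ y]) (use s[OF g] \<sigma>(3) in simp_all)
    then show ?thesis using \<sigma>(2) kwE y by auto
  qed
  have "\<gamma> \<in> hom (Aut E) G"
    unfolding hom_def Aut_carrier
  proof (intro CollectI conjI ballI Pi_I)
    show "\<gamma> \<rho> \<in> carrier G" if "\<rho> \<in> field_auts E" for \<rho> using \<gamma>[OF that] by blast
    fix \<rho> \<rho>' assume \<rho>: "\<rho> \<in> field_auts E" "\<rho>' \<in> field_auts E"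
    have g: "\<gamma> \<rho> \<in> carrier G" "\<gamma> \<rho>' \<in> carrier G" using \<gamma> \<rho> by blast+
    have "(\<rho> \<otimes>\<^bsub>Aut E\<^esub> \<rho>') w = \<rho> (\<rho>' w)"
      using Aut_mult[OF \<rho>] wE by (simp add: compose_eq)
    also have "\<rho>' w = W (\<gamma> \<rho>')" using \<gamma>_kw[OF \<rho>(2) mem_kadj] s[OF g(2)] by simp
    also have "\<rho> (W (\<gamma> \<rho>')) = W (\<gamma> \<rho> \<otimes>\<^bsub>G\<^esub> \<gamma> \<rho>')"
      using \<gamma>_kw[OF \<rho>(1)] s[OF g(2)] sW[OF g] by simp
    finally show "\<gamma> (\<rho> \<otimes>\<^bsub>Aut E\<^esub> \<rho>') = \<gamma> \<rho> \<otimes>\<^bsub>G\<^esub> \<gamma> \<rho>'"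
      using g by (intro \<gamma>I) simp_all
  qed
  moreover have "bij_betw \<gamma> (carrier (Aut E)) (carrier G)"
    unfolding Aut_carrier bij_betw_def
  proof (intro conjI inj_onI subset_antisym subsetI)
    fix \<rho> \<rho>' assume \<rho>: "\<rho> \<in> field_auts E" "\<rho>' \<in> field_auts E" and eq: "\<gamma> \<rho> = \<gamma> \<rho>'"
    obtain \<sigma> where \<sigma>: "\<sigma> \<in> gal" "\<forall>y\<in>E. \<sigma> y = \<rho> y" "\<sigma> w = W (\<gamma> \<rho>)" "\<sigma> z = z" using \<gamma>[OF \<rho>(1)] by blast
    obtain \<sigma>' where \<sigma>': "\<sigma>' \<in> gal" "\<forall>y\<in>E. \<sigma>' y = \<rho>' y" "\<sigma>' w = W (\<gamma> \<rho>')" "\<sigma>' z = z" using \<gamma>[OF \<rho>(2)] by blast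
    show "\<rho> = \<rho>'"
    proof (rule extensionalityI[OF field_autsD(2)[OF \<rho>(1)] field_autsD(2)[OF \<rho>(2)]])
      fix y assume y: "y \<in> E"
      have "\<sigma> y = \<sigma>' y" using \<sigma> \<sigma>' eq by (intro E_eq[OF \<sigma>(1) \<sigma>'(1) _ _ y]) simp_all
      then show "\<rho> y = \<rho>' y" using \<sigma>(2) \<sigma>'(2) y by simp
    qed
  next
    show "g \<in> carrier G" if "g \<in> \<gamma> ` field_auts E" for g using that \<gamma> by blast
    fix g assume g: "g \<in> carrier G"
    then obtain \<sigma> where \<sigma>: "\<sigma> \<in> gal" "\<sigma> w = W g" "\<sigma> z = z" using lift by blast
    have "{w, z} \<subseteq> {y. \<sigma> y \<in> E}" using \<sigma>(2,3) s[OF g] kwE zE by auto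
    then have "\<sigma> e \<in> E" using e3[OF subring_over_vimage[OF \<sigma>(1) Esub]] by blast
    then have "kadj (\<sigma> e) \<subseteq> E" by (rule kadj_least[OF Esub])
    then have sub: "\<sigma> ` E \<subseteq> E" using gal_image_kadj[OF \<sigma>(1), of _ e] by (auto simp: E_def)
    \<comment> \<open>That \<sigma> maps onto \<open>E\<close> is checked on the generators:
      \<open>z\<close> is fixed, and \<open>w\<close> has the preimage \<open>W\<close> at the
      inverse of g.\<close>
    have "w \<in> \<sigma> ` E"
    proof (rule image_eqI)
      have "\<sigma> (W (inv\<^bsub>G\<^esub> g)) = s g (W (inv\<^bsub>G\<^esub> g))"
      proof (rule gal_eq_on_kadj[OF \<sigma>(1)])
        show "s g \<in> gal" "\<sigma> w = s g w" using s[OF g] \<sigma>(2) by simp_all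
        show "W (inv\<^bsub>G\<^esub> g) \<in> kadj w" using s[OF inv_closed[OF g]] by blast
      qed
      then show "w = \<sigma> (W (inv\<^bsub>G\<^esub> g))" using sW[OF g inv_closed[OF g]] r_inv[OF g] W1 by simp
      show "W (inv\<^bsub>G\<^esub> g) \<in> E" using s[OF inv_closed[OF g]] kwE by blast
    qed
    moreover have "z \<in> \<sigma> ` E" using \<sigma>(3) zE by (metis imageI)
    ultimately have "{w, z} \<subseteq> {y. inv_into UNIV \<sigma> y \<in> E}"
      by (auto simp: gal_inv_apply[OF \<sigma>(1)])
    then have "inv_into UNIV \<sigma> e \<in> E"
      using e3[OF subring_over_vimage[OF gal_inv[OF \<sigma>(1)] Esub]] by blast
    then have "kadj (inv_into UNIV \<sigma> e) \<subseteq> E" by (rule kadj_least[OF Esub])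
    then have "inv_into UNIV \<sigma> y \<in> E" if "y \<in> E" for y
      using gal_image_kadj[OF gal_inv[OF \<sigma>(1)], of y e] that by (auto simp: E_def)
    then have "E \<subseteq> \<sigma> ` E" using gal_inv_apply(1)[OF \<sigma>(1)] by (metis imageI subsetI)
    with sub have "\<sigma> ` E = E" by blast
    then have "restrict \<sigma> E \<in> field_auts E" by (rule field_auts_restrict[OF Esub \<sigma>(1)])
    moreover have "\<gamma> (restrict \<sigma> E) = g" using g \<sigma>(2) wE by (intro \<gamma>I) simp_all
    ultimately show "g \<in> \<gamma> ` field_auts E" by blast
  qed
  ultimately have "\<gamma> \<in> iso (Aut E) G" by (simp add: iso_def)
  moreover have "\<rho> ` L = L \<and> \<alpha> (\<gamma> \<rho>) = restrict \<rho> L" if "\<rho> \<in> carrier (Aut E)" for \<rho>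
  proof -
    have \<rho>: "\<rho> \<in> field_auts E" using that by (simp add: Aut_carrier)
    have g: "\<gamma> \<rho> \<in> carrier G" using \<gamma>[OF \<rho>] by blast
    have \<alpha>g: "\<alpha> (\<gamma> \<rho>) \<in> field_auts L" using \<alpha> g by (auto simp: hom_def Aut_carrier)
    have eq: "\<rho> y = \<alpha> (\<gamma> \<rho>) y" if "y \<in> L" for y
      using \<gamma>_kw[OF \<rho>] sL[OF g that] w(2) that by auto
    then have "\<rho> ` L = \<alpha> (\<gamma> \<rho>) ` L" by (rule image_cong[OF refl])
    moreover have "\<alpha> (\<gamma> \<rho>) = restrict \<rho> L"
      by (rule extensionalityI[OF field_autsD(2)[OF \<alpha>g] restrict_extensional]) (simp add: eq)
    ultimately show ?thesis using field_autsD(1)[OF \<alpha>g] by simp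
  qed
  moreover have "finite_separable_extension E"
    unfolding E_def by (rule finite_separable_extension_kadj[OF e(1)])
  moreover have "L \<subseteq> E" using w(2) kwE by blast
  ultimately show ?thesis by blast
qed

end
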